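(* Let $I$ be an index set. For $1\leq p\leq 2$, $$(\max\ell^p(I))^h=\min\ell^\infty(I),$$ where $\max\ell^p(I)$ is regarded as an algebra (and left module over itself) under pointwise multiplication.
   Context: $\max E$ and $\min E$ denote the maximal and minimal operator space structures on a Banach space $E$. For $1\le p\le 2$, $\max\ell^p(I)$ is known to be an operator algebra under pointwise multiplication. For a completely contractive Banach algebra $A$ and a left operator $A$-module $X$, $A\otimes^h_A X:=(A\otimes^h X)/N_X$, where $\otimes^h$ is the Haagerup tensor product and $N_X$ is the closed linear span in $A\otimes^h X$ of $\{ab\otimes x-a\otimes b\cdot x:a,b\in A,\ x\in X\}$; the Haagerup dual is $X^h:=(A\otimes^h_A X)^*$ with the dual operator space structure. Here $A=X=\max\ell^p(I)$ with the pointwise product. An equality of operator spaces means completely isometric isomorphism. *)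

theory Defs
  imports
    "Jordan_Normal_Form.VS_Connect"
    "HOL-Algebra.AbelCoset"
    "HOL-Library.Poly_Mapping"
    "HOL-Analysis.L2_Norm"
    "HOL-Analysis.Infinite_Sum"
begin

hide_const (open) Multiset.mult Polynomial.smult Modules.module

section \<open>Normed spaces and matrix norms on a carrier\<close>

text \<open>
  Complex vector spaces are HOL-Algebra modules over \<open>class_ring :: complex ring\<close>; matrices are
  those of Jordan-Normal-Form, which carry their dimensions, so that a single function on
  matrices holds the norms of all the spaces \<open>M\<^sub>n(V)\<close>.  The fields \<open>mult\<close> and \<open>one\<close> that the
  module record inherits from rings are \<open>undefined\<close> when the space has no product or no unit.
\<close>

record 'v normed_space = "(complex, 'v) module" +
  vnorm :: "'v \<Rightarrow> real"

record 'v opspace = "(complex, 'v) module" +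
  mnorm :: "'v mat \<Rightarrow> real"

definition with_mnorm :: "(complex, 'v, 'm) module_scheme \<Rightarrow> ('v mat \<Rightarrow> real) \<Rightarrow> 'v opspace" where
  "with_mnorm V \<rho> =
     \<lparr>carrier = carrier V, mult = mult V, one = one V, zero = zero V, add = add V,
      smult = smult V, mnorm = \<rho>\<rparr>"

definition mats :: "(complex, 'v, 'm) module_scheme \<Rightarrow> nat \<Rightarrow> nat \<Rightarrow> 'v mat set" where
  "mats V r c = {x \<in> carrier_mat r c. elements_mat x \<subseteq> carrier V}"

abbreviation mat1 :: "'v \<Rightarrow> 'v mat" where
  "mat1 v \<equiv> mat 1 1 (\<lambda>_. v)"

definition os_norm :: "'v opspace \<Rightarrow> 'v \<Rightarrow> real" where
  "os_norm V v = mnorm V (mat1 v)"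


section \<open>Abstract operator spaces\<close>

definition cvec_norm :: "complex vec \<Rightarrow> real" where
  "cvec_norm v = L2_set (\<lambda>i. cmod (vec_index v i)) {..<dim_vec v}"

definition mat_opnorm :: "complex mat \<Rightarrow> real" where
  "mat_opnorm A = Sup {cvec_norm (A *\<^sub>v v) | v. v \<in> carrier_vec (dim_col A) \<and> cvec_norm v \<le> 1}"

definition zero_mats :: "(complex, 'v, 'm) module_scheme \<Rightarrow> nat \<Rightarrow> nat \<Rightarrow> 'v mat" where
  "zero_mats V r c = mat r c (\<lambda>_. \<zero>\<^bsub>V\<^esub>)"

definition add_mats :: "(complex, 'v, 'm) module_scheme \<Rightarrow> 'v mat \<Rightarrow> 'v mat \<Rightarrow> 'v mat" where
  "add_mats V x y = mat (dim_row x) (dim_col x) (\<lambda>ij. x $$ ij \<oplus>\<^bsub>V\<^esub> y $$ ij)"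

definition diag_sum :: "(complex, 'v, 'm) module_scheme \<Rightarrow> 'v mat \<Rightarrow> 'v mat \<Rightarrow> 'v mat" where
  "diag_sum V x y = four_block_mat x (zero_mats V (dim_row x) (dim_col y))
                                   (zero_mats V (dim_row y) (dim_col x)) y"

text \<open>The product \<open>\<alpha> x \<beta>\<close> with scalar matrices \<open>\<alpha>\<close> and \<open>\<beta>\<close>.\<close>

definition scalar_sandwich ::
  "(complex, 'v, 'm) module_scheme \<Rightarrow> complex mat \<Rightarrow> 'v mat \<Rightarrow> complex mat \<Rightarrow> 'v mat" where
  "scalar_sandwich V \<alpha> x \<beta> = mat (dim_row \<alpha>) (dim_col \<beta>) (\<lambda>(i, j).
     finsum V (\<lambda>(k, l). (\<alpha> $$ (i, k) * \<beta> $$ (l, j)) \<odot>\<^bsub>V\<^esub> x $$ (k, l))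
       ({..<dim_row x} \<times> {..<dim_col x}))"

text \<open>Ruan's axioms.  The case \<open>n = 0\<close> only says that the norm of the empty matrix is \<open>0\<close>.\<close>

definition operator_space :: "'v opspace \<Rightarrow> bool" where
  "operator_space V \<longleftrightarrow>
     vectorspace class_ring V \<and>
     (\<forall>n. \<forall>x \<in> mats V n n. 0 \<le> mnorm V x \<and> (mnorm V x = 0 \<longleftrightarrow> x = zero_mats V n n)) \<and>
     (\<forall>n. \<forall>x \<in> mats V n n. \<forall>y \<in> mats V n n.
        mnorm V (add_mats V x y) \<le> mnorm V x + mnorm V y) \<and>
     (\<forall>n. \<forall>x \<in> mats V n n. \<forall>c.
        mnorm V (map_mat (\<lambda>v. c \<odot>\<^bsub>V\<^esub> v) x) = cmod c * mnorm V x) \<and>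
     (\<forall>m n. \<forall>x \<in> mats V m m. \<forall>y \<in> mats V n n.
        mnorm V (diag_sum V x y) = max (mnorm V x) (mnorm V y)) \<and>
     (\<forall>m n. \<forall>x \<in> mats V m m. \<forall>\<alpha> \<in> carrier_mat n m. \<forall>\<beta> \<in> carrier_mat m n.
        mnorm V (scalar_sandwich V \<alpha> x \<beta>) \<le> mat_opnorm \<alpha> * mnorm V x * mat_opnorm \<beta>)"

definition completely_isometric_iso :: "'v opspace \<Rightarrow> 'w opspace \<Rightarrow> ('v \<Rightarrow> 'w) \<Rightarrow> bool" where
  "completely_isometric_iso V W T \<longleftrightarrow>
     linear_map class_ring V W T \<and> bij_betw T (carrier V) (carrier W) \<and>
     (\<forall>n. \<forall>x \<in> mats V n n. mnorm W (map_mat T x) = mnorm V x)"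

definition completely_isometric :: "'v opspace \<Rightarrow> 'w opspace \<Rightarrow> bool" where
  "completely_isometric V W \<longleftrightarrow> (\<exists>T. completely_isometric_iso V W T)"


section \<open>Maximal and minimal operator space structures\<close>

text \<open>
  The matrix norms making the normed space \<open>E\<close> an operator space with its given norm on
  \<open>M\<^sub>1(E) = E\<close>.  For a normed space \<open>E\<close> there always is one, and the norms of a matrix under all of
  them lie between \<open>0\<close> and the sum of the norms of its entries, so the \<open>SUP\<close> and \<open>INF\<close> below are
  taken over nonempty bounded sets; they are the largest and the smallest structure.
\<close>

definition os_structures :: "'v normed_space \<Rightarrow> ('v mat \<Rightarrow> real) set" where
  "os_structures E = {\<rho>. operator_space (with_mnorm E \<rho>) \<and>
                          (\<forall>v \<in> carrier E. \<rho> (mat1 v) = vnorm E v)}"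

definition max_os :: "'v normed_space \<Rightarrow> 'v opspace" where
  "max_os E = with_mnorm E (\<lambda>x. SUP \<rho> \<in> os_structures E. \<rho> x)"

definition min_os :: "'v normed_space \<Rightarrow> 'v opspace" where
  "min_os E = with_mnorm E (\<lambda>x. INF \<rho> \<in> os_structures E. \<rho> x)"


section \<open>Quotients, completions and duals\<close>

definition quot_module :: "(complex, 'v, 'm) module_scheme \<Rightarrow> 'v set \<Rightarrow> (complex, 'v set) module" where
  "quot_module V N =
     \<lparr>carrier = A_RCOSETS V N, mult = undefined, one = undefined, zero = N, add = set_add V,
      smult = (\<lambda>c C. \<Union>x \<in> C. N +>\<^bsub>V\<^esub> (c \<odot>\<^bsub>V\<^esub> x))\<rparr>"

definition quot_os :: "'v opspace \<Rightarrow> 'v set \<Rightarrow> 'v set opspace" where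
  "quot_os V N = with_mnorm (quot_module V N)
     (\<lambda>C. Inf {mnorm V x | x. x \<in> mats V (dim_row C) (dim_col C) \<and>
                              map_mat (\<lambda>v. N +>\<^bsub>V\<^esub> v) x = C})"

abbreviation lin_span :: "(complex, 'v, 'm) module_scheme \<Rightarrow> 'v set \<Rightarrow> 'v set" where
  "lin_span V S \<equiv> LinearCombinations.module.span class_ring V S"

definition closed_span :: "'v opspace \<Rightarrow> 'v set \<Rightarrow> 'v set" where
  "closed_span V S = {v \<in> carrier V. \<forall>e > 0. \<exists>w \<in> lin_span V S. os_norm V (v \<ominus>\<^bsub>V\<^esub> w) < e}"

text \<open>
  The completion consists of the Cauchy sequences modulo the null sequences.  The matrix
  seminorms of \<open>cauchy_os\<close> are constant on cosets of null sequences, so the infimum taken in the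
  quotient is over a single value.
\<close>

definition cauchy_os :: "'v opspace \<Rightarrow> (nat \<Rightarrow> 'v) opspace" where
  "cauchy_os V =
     \<lparr>carrier = {s. (\<forall>k. s k \<in> carrier V) \<and>
                    (\<forall>e > 0. \<exists>N. \<forall>k \<ge> N. \<forall>l \<ge> N. os_norm V (s k \<ominus>\<^bsub>V\<^esub> s l) < e)},
      mult = undefined, one = undefined,
      zero = (\<lambda>k. \<zero>\<^bsub>V\<^esub>), add = (\<lambda>s t k. s k \<oplus>\<^bsub>V\<^esub> t k), smult = (\<lambda>c s k. c \<odot>\<^bsub>V\<^esub> s k),
      mnorm = (\<lambda>x. lim (\<lambda>k. mnorm V (map_mat (\<lambda>s. s k) x)))\<rparr>"

definition null_seqs :: "'v opspace \<Rightarrow> (nat \<Rightarrow> 'v) set" where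
  "null_seqs V = {s \<in> carrier (cauchy_os V). (\<lambda>k. os_norm V (s k)) \<longlonglongrightarrow> 0}"

definition completion :: "'v opspace \<Rightarrow> (nat \<Rightarrow> 'v) set opspace" where
  "completion V = quot_os (cauchy_os V) (null_seqs V)"

definition to_completion :: "'v opspace \<Rightarrow> 'v \<Rightarrow> (nat \<Rightarrow> 'v) set" where
  "to_completion V v = null_seqs V +>\<^bsub>cauchy_os V\<^esub> (\<lambda>k. v)"

definition complex_module :: "(complex, complex) module" where
  "complex_module =
     \<lparr>carrier = UNIV, mult = (*), one = 1, zero = 0, add = (+), smult = (*)\<rparr>"

text \<open>\<open>M\<^sub>n\<close> as an operator space, through the identification of \<open>M\<^sub>m(M\<^sub>n)\<close> with \<open>M\<^sub>m\<^sub>n\<close>.\<close>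

definition matrix_os :: "nat \<Rightarrow> complex mat opspace" where
  "matrix_os n = with_mnorm (module_mat TYPE(complex) n n)
     (\<lambda>X. mat_opnorm (mat (dim_row X * n) (dim_col X * n)
            (\<lambda>(r, s). (X $$ (r div n, s div n)) $$ (r mod n, s mod n))))"

definition cb_norm :: "'v opspace \<Rightarrow> 'w opspace \<Rightarrow> ('v \<Rightarrow> 'w) \<Rightarrow> real" where
  "cb_norm V W T = Sup {mnorm W (map_mat T x) | m x. x \<in> mats V m m \<and> mnorm V x \<le> 1}"

text \<open>
  The dual operator space: \<open>M\<^sub>n(V\<^sup>*)\<close> is normed as \<open>CB(V, M\<^sub>n)\<close>.  Every matrix of bounded functionals
  is completely bounded, so the supremum is finite.  Functionals are taken to be \<open>extensional\<close>
  (that is, \<open>undefined\<close> off the carrier) so that they are determined by their values on \<open>V\<close>.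
\<close>

definition dual_os :: "'v opspace \<Rightarrow> ('v \<Rightarrow> complex) opspace" where
  "dual_os V =
     \<lparr>carrier = {\<phi> \<in> extensional (carrier V). linear_map class_ring V complex_module \<phi> \<and>
                   (\<exists>K. \<forall>v \<in> carrier V. cmod (\<phi> v) \<le> K * os_norm V v)},
      mult = undefined, one = undefined,
      zero = (\<lambda>v \<in> carrier V. 0), add = (\<lambda>\<phi> \<psi>. \<lambda>v \<in> carrier V. \<phi> v + \<psi> v),
      smult = (\<lambda>c \<phi>. \<lambda>v \<in> carrier V. c * \<phi> v),
      mnorm = (\<lambda>\<Phi>. cb_norm V (matrix_os (dim_row \<Phi>)) (\<lambda>v. map_mat (\<lambda>\<phi>. \<phi> v) \<Phi>))\<rparr>"


section \<open>Haagerup tensor product\<close>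

definition free_module :: "'s set \<Rightarrow> (complex, 's \<Rightarrow>\<^sub>0 complex) module" where
  "free_module S =
     \<lparr>carrier = {f. Poly_Mapping.keys f \<subseteq> S}, mult = undefined, one = undefined,
      zero = 0, add = (+), smult = (\<lambda>c. Poly_Mapping.map ((*) c))\<rparr>"

definition bilinear_rels ::
  "(complex, 'v, 'm) module_scheme \<Rightarrow> (complex, 'w, 'k) module_scheme \<Rightarrow> ('v \<times> 'w \<Rightarrow>\<^sub>0 complex) set" where
  "bilinear_rels V W =
     {Poly_Mapping.single (v \<oplus>\<^bsub>V\<^esub> v', w) 1
        - Poly_Mapping.single (v, w) 1 - Poly_Mapping.single (v', w) 1
       | v v' w. v \<in> carrier V \<and> v' \<in> carrier V \<and> w \<in> carrier W} \<union>
     {Poly_Mapping.single (v, w \<oplus>\<^bsub>W\<^esub> w') 1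
        - Poly_Mapping.single (v, w) 1 - Poly_Mapping.single (v, w') 1
       | v w w'. v \<in> carrier V \<and> w \<in> carrier W \<and> w' \<in> carrier W} \<union>
     {Poly_Mapping.single (c \<odot>\<^bsub>V\<^esub> v, w) 1 - Poly_Mapping.single (v, w) c
       | c v w. v \<in> carrier V \<and> w \<in> carrier W} \<union>
     {Poly_Mapping.single (v, c \<odot>\<^bsub>W\<^esub> w) 1 - Poly_Mapping.single (v, w) c
       | c v w. v \<in> carrier V \<and> w \<in> carrier W}"

definition tensor_rels ::
  "(complex, 'v, 'm) module_scheme \<Rightarrow> (complex, 'w, 'k) module_scheme \<Rightarrow> ('v \<times> 'w \<Rightarrow>\<^sub>0 complex) set" where
  "tensor_rels V W = lin_span (free_module (carrier V \<times> carrier W)) (bilinear_rels V W)"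

definition tensor_module ::
  "(complex, 'v, 'm) module_scheme \<Rightarrow> (complex, 'w, 'k) module_scheme \<Rightarrow>
     (complex, ('v \<times> 'w \<Rightarrow>\<^sub>0 complex) set) module" where
  "tensor_module V W = quot_module (free_module (carrier V \<times> carrier W)) (tensor_rels V W)"

definition pure_tensor ::
  "(complex, 'v, 'm) module_scheme \<Rightarrow> (complex, 'w, 'k) module_scheme \<Rightarrow> 'v \<Rightarrow> 'w \<Rightarrow>
     ('v \<times> 'w \<Rightarrow>\<^sub>0 complex) set" where
  "pure_tensor V W v w =
     tensor_rels V W +>\<^bsub>free_module (carrier V \<times> carrier W)\<^esub> Poly_Mapping.single (v, w) 1"

text \<open>The matrix with entries \<open>\<Sum>\<^sub>l a\<^sub>i\<^sub>l \<otimes> b\<^sub>l\<^sub>j\<close>.\<close>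

definition tensor_mat_prod ::
  "(complex, 'v, 'm) module_scheme \<Rightarrow> (complex, 'w, 'k) module_scheme \<Rightarrow> 'v mat \<Rightarrow> 'w mat \<Rightarrow>
     ('v \<times> 'w \<Rightarrow>\<^sub>0 complex) set mat" where
  "tensor_mat_prod V W a b = mat (dim_row a) (dim_col b) (\<lambda>(i, j).
     finsum (tensor_module V W) (\<lambda>l. pure_tensor V W (a $$ (i, l)) (b $$ (l, j))) {..<dim_col a})"

text \<open>The norm of a rectangular matrix is that of the square matrix obtained by adding zeros.\<close>

definition rect_norm :: "'v opspace \<Rightarrow> 'v mat \<Rightarrow> real" where
  "rect_norm V x = mnorm V (let N = max (dim_row x) (dim_col x) in
     mat N N (\<lambda>(i, j). if i < dim_row x \<and> j < dim_col x then x $$ (i, j) else \<zero>\<^bsub>V\<^esub>))"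

definition alg_haagerup :: "'v opspace \<Rightarrow> 'w opspace \<Rightarrow> ('v \<times> 'w \<Rightarrow>\<^sub>0 complex) set opspace" where
  "alg_haagerup V W = with_mnorm (tensor_module V W)
     (\<lambda>u. Inf {rect_norm V a * rect_norm W b | a b k.
                 a \<in> mats V (dim_row u) k \<and> b \<in> mats W k (dim_col u) \<and>
                 u = tensor_mat_prod V W a b})"

definition haagerup ::
  "'v opspace \<Rightarrow> 'w opspace \<Rightarrow> (nat \<Rightarrow> ('v \<times> 'w \<Rightarrow>\<^sub>0 complex) set) set opspace" where
  "haagerup V W = completion (alg_haagerup V W)"

definition haagerup_pure ::
  "'v opspace \<Rightarrow> 'w opspace \<Rightarrow> 'v \<Rightarrow> 'w \<Rightarrow> (nat \<Rightarrow> ('v \<times> 'w \<Rightarrow>\<^sub>0 complex) set) set" where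
  "haagerup_pure V W v w = to_completion (alg_haagerup V W) (pure_tensor V W v w)"


section \<open>Module Haagerup tensor product and Haagerup dual\<close>

text \<open>
  Here \<open>A\<close> is an algebra with product \<open>mult A\<close> and \<open>X\<close> a left \<open>A\<close>-module with action
  \<open>act :: 'a \<Rightarrow> 'x \<Rightarrow> 'x\<close>.
\<close>

definition balanced_subspace ::
  "'a opspace \<Rightarrow> 'x opspace \<Rightarrow> ('a \<Rightarrow> 'x \<Rightarrow> 'x) \<Rightarrow> (nat \<Rightarrow> ('a \<times> 'x \<Rightarrow>\<^sub>0 complex) set) set set" where
  "balanced_subspace A X act = closed_span (haagerup A X)
     {haagerup_pure A X (a \<otimes>\<^bsub>A\<^esub> b) x \<ominus>\<^bsub>haagerup A X\<^esub> haagerup_pure A X a (act b x)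
       | a b x. a \<in> carrier A \<and> b \<in> carrier A \<and> x \<in> carrier X}"

definition module_haagerup ::
  "'a opspace \<Rightarrow> 'x opspace \<Rightarrow> ('a \<Rightarrow> 'x \<Rightarrow> 'x) \<Rightarrow>
     (nat \<Rightarrow> ('a \<times> 'x \<Rightarrow>\<^sub>0 complex) set) set set opspace" where
  "module_haagerup A X act = quot_os (haagerup A X) (balanced_subspace A X act)"

definition haagerup_dual ::
  "'a opspace \<Rightarrow> 'x opspace \<Rightarrow> ('a \<Rightarrow> 'x \<Rightarrow> 'x) \<Rightarrow>
     ((nat \<Rightarrow> ('a \<times> 'x \<Rightarrow>\<^sub>0 complex) set) set set \<Rightarrow> complex) opspace" where
  "haagerup_dual A X act = dual_os (module_haagerup A X act)"


section \<open>The sequence spaces\<close>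

text \<open>
  Families indexed by \<open>I\<close> are functions on the whole type that vanish off \<open>I\<close>; hence the supremum
  in \<open>linf_space\<close> may be taken over the type, which also covers \<open>I = {}\<close>.
\<close>

definition lp_space :: "real \<Rightarrow> 'i set \<Rightarrow> ('i \<Rightarrow> complex) normed_space" where
  "lp_space p I =
     \<lparr>carrier = {f. (\<forall>i. i \<notin> I \<longrightarrow> f i = 0) \<and> (\<lambda>i. cmod (f i) powr p) summable_on I},
      mult = (\<lambda>f g i. f i * g i), one = undefined,
      zero = (\<lambda>i. 0), add = (\<lambda>f g i. f i + g i), smult = (\<lambda>c f i. c * f i),
      vnorm = (\<lambda>f. (\<Sum>\<^sub>\<infinity>i\<in>I. cmod (f i) powr p) powr (1 / p))\<rparr>"

definition linf_space :: "'i set \<Rightarrow> ('i \<Rightarrow> complex) normed_space" where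
  "linf_space I =
     \<lparr>carrier = {f. (\<forall>i. i \<notin> I \<longrightarrow> f i = 0) \<and> bdd_above (range (\<lambda>i. cmod (f i)))},
      mult = (\<lambda>f g i. f i * g i), one = (\<lambda>i. if i \<in> I then 1 else 0),
      zero = (\<lambda>i. 0), add = (\<lambda>f g i. f i + g i), smult = (\<lambda>c f i. c * f i),
      vnorm = (\<lambda>f. SUP i. cmod (f i))\<rparr>"

end

theory Submission
  imports Defs "HOL-Analysis.Convex"
begin

text \<open>
  A bounded functional on the module Haagerup tensor product of \<open>A = max l\<^sup>p(I)\<close> with itself is a
  bilinear form \<open>B\<close> with \<open>B(a b, x) = B(a, b x)\<close>.  The unit vectors \<open>e\<^sub>i\<close> are orthogonal idempotents
  and finitely supported families are dense, so \<open>B\<close> is determined by the family \<open>f\<^sub>i = B(e\<^sub>i, e\<^sub>i)\<close>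
  (\<open>functional_zero\<close>), and \<open>f\<close> is bounded because \<open>e\<^sub>i \<otimes> e\<^sub>i\<close> has norm at most one.  Testing a matrix
  of functionals at these tensors shows that its norm is at least the supremum over \<open>i\<close> of the operator
  norms of the scalar matrices \<open>f(i)\<close>.  This supremum is the norm of the minimal structure on
  \<open>l\<^sup>\<infinity>(I)\<close>: the coordinates norm \<open>l\<^sup>\<infinity>(I)\<close>, and contractive functionals are completely contractive for
  every operator space structure (\<open>functional_norm_le\<close>, \<open>min_os_mnorm\<close>).

  Conversely let \<open>f\<close> be a matrix over \<open>l\<^sup>\<infinity>(I)\<close>, and let \<open>u\<close> be the product \<open>a \<odot> b\<close> of matrices over
  \<open>A\<close>.  Since \<open>p \<le> 2\<close>, restriction to a finite set \<open>J\<close> of coordinates is a contraction from \<open>l\<^sup>p(I)\<close>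
  into row and into column Hilbert space over \<open>J\<close>.  The maximal structure dominates every Ruan
  seminorm that is dominated by the norm at the first level (\<open>max_os_dominates\<close>); hence for scalar
  vectors \<open>\<eta>\<close> and \<open>\<xi>\<close> the families \<open>\<eta> a\<close> and \<open>b \<xi>\<close>, restricted to \<open>J\<close>, have \<open>l\<^sup>2\<close> norms at most
  \<open>\<parallel>a\<parallel> \<parallel>\<eta>\<parallel>\<close> and \<open>\<parallel>b\<parallel> \<parallel>\<xi>\<parallel>\<close>.  The matrix of functionals with the diagonal values \<open>f\<close> takes \<open>u\<close> to a
  scalar matrix whose coefficient at \<open>\<eta>\<close>, \<open>\<xi>\<close> is the sum over \<open>i\<close> of \<open>f(i)\<close> evaluated at the
  coordinates \<open>(\<eta> a)(i)\<close> and \<open>(b \<xi>)(i)\<close>.  The Cauchy-Schwarz inequality bounds it by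
  \<open>sup\<^sub>i \<parallel>f(i)\<parallel> \<parallel>a\<parallel> \<parallel>b\<parallel> \<parallel>\<eta>\<parallel> \<parallel>\<xi>\<parallel>\<close> (\<open>finite_pairing_bound\<close>), and the bound passes to the infimum over
  all factorizations of \<open>u\<close>, to limits of Cauchy sequences and to cosets.

  Two general facts support this.  Norms of forms, that is operator norms pulled back along linear
  maps into matrices, satisfy Ruan's axioms (\<open>op_seminorm_fnorm\<close>); they provide the row and column
  seminorms, the minimal structures, and through norming functionals an operator space structure
  on \<open>l\<^sup>p(I)\<close>, so that the maximal one is a supremum over a nonempty set.  And the Haagerup norm is
  a matrix seminorm that is bounded by the norms of the entries; its triangle inequality follows
  from Ruan's axioms by concatenating factorizations (\<open>rect_norm_hcat\<close>, \<open>AH_sem\<close>).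
\<close>

section \<open>Finite square-summable norms\<close>

abbreviation nrm2 :: "'a set \<Rightarrow> ('a \<Rightarrow> complex) \<Rightarrow> real" where
  "nrm2 S f \<equiv> L2_set (\<lambda>i. cmod (f i)) S"

lemma nrm2_power2: "(nrm2 S f)\<^sup>2 = (\<Sum>i\<in>S. (cmod (f i))\<^sup>2)"
  by (simp add: L2_set_def sum_nonneg)

lemma nrm2_leI: "(\<Sum>i\<in>S. (cmod (f i))\<^sup>2) \<le> C\<^sup>2 \<Longrightarrow> 0 \<le> C \<Longrightarrow> nrm2 S f \<le> C"
  unfolding L2_set_def by (rule real_le_lsqrt) (auto intro: sum_nonneg)

lemma nrm2_scale: "nrm2 S (\<lambda>i. c * f i) = cmod c * nrm2 S f"
  by (simp add: norm_mult L2_set_right_distrib)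

lemma cauchy_schwarz_sum: "cmod (\<Sum>i\<in>S. f i * g i) \<le> nrm2 S f * nrm2 S g"
proof -
  have "cmod (\<Sum>i\<in>S. f i * g i) \<le> (\<Sum>i\<in>S. \<bar>cmod (f i)\<bar> * \<bar>cmod (g i)\<bar>)"
    by (rule order_trans[OF norm_sum]) (simp add: norm_mult)
  also have "\<dots> \<le> nrm2 S f * nrm2 S g"
    by (rule L2_set_mult_ineq)
  finally show ?thesis .
qed

text \<open>
  Testing against the conjugate of \<open>f\<close> itself produces the square of its norm.
\<close>

lemma nrm2_le_of_pairings:
  assumes "0 \<le> C" and "\<And>g. cmod (\<Sum>i\<in>S. f i * g i) \<le> C * nrm2 S g"
  shows "nrm2 S f \<le> C"
proof -
  have "complex_of_real ((nrm2 S f)\<^sup>2) = (\<Sum>i\<in>S. f i * cnj (f i))"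
    unfolding nrm2_power2 of_real_sum by (rule sum.cong) (simp_all add: complex_norm_square flip: of_real_power)
  hence "(nrm2 S f)\<^sup>2 = cmod (\<Sum>i\<in>S. f i * cnj (f i))"
    by (metis abs_of_nonneg norm_of_real zero_le_power2)
  also have "\<dots> \<le> C * nrm2 S f"
    using assms(2)[of "\<lambda>i. cnj (f i)"] by simp
  finally have "nrm2 S f * nrm2 S f \<le> C * nrm2 S f"
    by (simp add: power2_eq_square)
  thus ?thesis
    using assms(1) L2_set_nonneg[of "\<lambda>i. cmod (f i)" S] by (metis mult_right_le_imp_le order_le_less)
qed

text \<open>
  The square of a norm over a product is an iterated sum.  Hence an estimate for scalar vectors
  carries over to vectors with values in a finite-dimensional Hilbert space, which takes the place
  of amplifying a matrix by an identity.
\<close>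

lemma nrm2_Times: "finite A \<Longrightarrow> finite B \<Longrightarrow> 
   (nrm2 (A \<times> B) f)\<^sup>2 = (\<Sum>b\<in>B. (nrm2 A (\<lambda>a. f (a, b)))\<^sup>2)"
  unfolding nrm2_power2 by (subst sum.swap) (simp add: sum.cartesian_product)

lemma nrm2_Times_le:
  assumes "finite A" "finite A'" "finite B" "0 \<le> C"
    and "\<And>b. b \<in> B \<Longrightarrow> nrm2 A (\<lambda>a. f (a, b)) \<le> C * nrm2 A' (\<lambda>a. g (a, b))"
  shows "nrm2 (A \<times> B) f \<le> C * nrm2 (A' \<times> B) g"
proof (rule power2_le_imp_le)
  have "(nrm2 (A \<times> B) f)\<^sup>2 = (\<Sum>b\<in>B. (nrm2 A (\<lambda>a. f (a, b)))\<^sup>2)"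
    using assms by (intro nrm2_Times)
  also have "\<dots> \<le> (\<Sum>b\<in>B. (C * nrm2 A' (\<lambda>a. g (a, b)))\<^sup>2)"
    using assms by (intro sum_mono power_mono) auto
  also have "\<dots> = C\<^sup>2 * (\<Sum>b\<in>B. (nrm2 A' (\<lambda>a. g (a, b)))\<^sup>2)"
    by (simp add: power_mult_distrib sum_distrib_left)
  also have "\<dots> = (C * nrm2 (A' \<times> B) g)\<^sup>2"
    using assms by (simp add: nrm2_Times power_mult_distrib)
  finally show "(nrm2 (A \<times> B) f)\<^sup>2 \<le> (C * nrm2 (A' \<times> B) g)\<^sup>2" .
qed (use assms in auto)

section \<open>The operator norm of a scalar matrix\<close>

lemma cvec_norm_vec: "cvec_norm (vec n f) = nrm2 {..<n} f"
  unfolding cvec_norm_def by (auto intro: L2_set_cong)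

lemma mult_mat_vec_eq:
  "A \<in> carrier_mat n m \<Longrightarrow> A *\<^sub>v vec m \<xi> = vec n (\<lambda>i. \<Sum>j<m. A $$ (i, j) * \<xi> j)"
  by (intro eq_vecI) (auto simp: scalar_prod_def atLeast0LessThan)

lemma mat_opnorm_alt:
  assumes "A \<in> carrier_mat n m"
  shows "mat_opnorm A = Sup {nrm2 {..<n} (\<lambda>i. \<Sum>j<m. A $$ (i, j) * \<xi> j) | \<xi>. nrm2 {..<m} \<xi> \<le> 1}"
proof -
  have "{cvec_norm (A *\<^sub>v v) | v. v \<in> carrier_vec (dim_col A) \<and> cvec_norm v \<le> 1}
      = {nrm2 {..<n} (\<lambda>i. \<Sum>j<m. A $$ (i, j) * \<xi> j) | \<xi>. nrm2 {..<m} \<xi> \<le> 1}" (is "?L = ?R")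
  proof (intro subset_antisym subsetI)
    fix r assume "r \<in> ?L"
    then obtain v where v: "r = cvec_norm (A *\<^sub>v v)" "v \<in> carrier_vec m" "cvec_norm v \<le> 1"
      using assms by auto
    define \<xi> where "\<xi> = vec_index v"
    have v\<xi>: "v = vec m \<xi>" using v(2) by (auto simp: \<xi>_def)
    have "r = nrm2 {..<n} (\<lambda>i. \<Sum>j<m. A $$ (i, j) * \<xi> j)" "nrm2 {..<m} \<xi> \<le> 1"
      using v assms by (simp_all add: v\<xi> mult_mat_vec_eq cvec_norm_vec)
    thus "r \<in> ?R" by blast
  next
    fix r assume "r \<in> ?R"
    then obtain \<xi> where \<xi>: "r = nrm2 {..<n} (\<lambda>i. \<Sum>j<m. A $$ (i, j) * \<xi> j)" "nrm2 {..<m} \<xi> \<le> 1"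
      by auto
    show "r \<in> ?L"
      using assms \<xi> by (auto intro!: exI[of _ "vec m \<xi>"] simp: mult_mat_vec_eq cvec_norm_vec)
  qed
  thus ?thesis unfolding mat_opnorm_def by simp
qed

text \<open>
  Bilinear forms do the work of sesquilinear ones, since conjugating a vector keeps its norm.
\<close>

lemma mat_opnorm_leI:
  assumes "A \<in> carrier_mat n m" "0 \<le> C"
    and "\<And>\<eta> \<xi>. cmod (\<Sum>i<n. \<Sum>j<m. \<eta> i * A $$ (i, j) * \<xi> j) \<le> C * nrm2 {..<n} \<eta> * nrm2 {..<m} \<xi>"
  shows "mat_opnorm A \<le> C"
  unfolding mat_opnorm_alt[OF assms(1)]
proof (rule cSup_least)
  show "{nrm2 {..<n} (\<lambda>i. \<Sum>j<m. A $$ (i, j) * \<xi> j) |\<xi>. nrm2 {..<m} \<xi> \<le> 1} \<noteq> {}"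
    by (auto intro!: exI[of _ "\<lambda>_. 0"] simp: L2_set_def)
next
  fix r assume "r \<in> {nrm2 {..<n} (\<lambda>i. \<Sum>j<m. A $$ (i, j) * \<xi> j) |\<xi>. nrm2 {..<m} \<xi> \<le> 1}"
  then obtain \<xi> where r: "r = nrm2 {..<n} (\<lambda>i. \<Sum>j<m. A $$ (i, j) * \<xi> j)" and \<xi>: "nrm2 {..<m} \<xi> \<le> 1"
    by auto
  have "r \<le> C * nrm2 {..<m} \<xi>"
    unfolding r
  proof (rule nrm2_le_of_pairings)
    fix \<eta> :: "nat \<Rightarrow> complex"
    have "(\<Sum>i<n. (\<Sum>j<m. A $$ (i, j) * \<xi> j) * \<eta> i) = (\<Sum>i<n. \<Sum>j<m. \<eta> i * A $$ (i, j) * \<xi> j)"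
      by (simp add: sum_distrib_left sum_distrib_right mult_ac)
    thus "cmod (\<Sum>i<n. (\<Sum>j<m. A $$ (i, j) * \<xi> j) * \<eta> i) \<le> C * nrm2 {..<m} \<xi> * nrm2 {..<n} \<eta>"
      using assms(3)[of \<eta> \<xi>] by (simp add: mult_ac)
  qed (use assms in auto)
  also have "\<dots> \<le> C" using \<xi> assms(2) by (simp add: mult_left_le)
  finally show "r \<le> C" .
qed

lemma mat_opnorm_bdd:
  assumes "A \<in> carrier_mat n m"
  shows "bdd_above {nrm2 {..<n} (\<lambda>i. \<Sum>j<m. A $$ (i, j) * \<xi> j) | \<xi>. nrm2 {..<m} \<xi> \<le> 1}"
proof (rule bdd_aboveI)
  fix r assume "r \<in> {nrm2 {..<n} (\<lambda>i. \<Sum>j<m. A $$ (i, j) * \<xi> j) | \<xi>. nrm2 {..<m} \<xi> \<le> 1}"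
  then obtain \<xi> where r: "r = nrm2 {..<n} (\<lambda>i. \<Sum>j<m. A $$ (i, j) * \<xi> j)" and \<xi>: "nrm2 {..<m} \<xi> \<le> 1"
    by auto
  have "r \<le> (\<Sum>i<n. \<bar>cmod (\<Sum>j<m. A $$ (i, j) * \<xi> j)\<bar>)"
    unfolding r by (rule L2_set_le_sum_abs)
  also have "\<dots> \<le> (\<Sum>i<n. nrm2 {..<m} (\<lambda>j. A $$ (i, j)))"
  proof (rule sum_mono)
    fix i
    have "cmod (\<Sum>j<m. A $$ (i, j) * \<xi> j) \<le> nrm2 {..<m} (\<lambda>j. A $$ (i, j)) * nrm2 {..<m} \<xi>"
      by (rule cauchy_schwarz_sum)
    also have "\<dots> \<le> nrm2 {..<m} (\<lambda>j. A $$ (i, j))"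
      using \<xi> by (simp add: mult_left_le)
    finally show "\<bar>cmod (\<Sum>j<m. A $$ (i, j) * \<xi> j)\<bar> \<le> nrm2 {..<m} (\<lambda>j. A $$ (i, j))" by simp
  qed
  finally show "r \<le> (\<Sum>i<n. nrm2 {..<m} (\<lambda>j. A $$ (i, j)))" .
qed

lemma mat_opnorm_nonneg: "0 \<le> mat_opnorm A"
proof -
  define n m where "n = dim_row A" and "m = dim_col A"
  have A: "A \<in> carrier_mat n m" by (simp add: n_def m_def)
  have "nrm2 {..<n} (\<lambda>i. \<Sum>j<m. A $$ (i, j) * 0) \<le> mat_opnorm A"
    unfolding mat_opnorm_alt[OF A]
    by (rule cSup_upper[OF _ mat_opnorm_bdd[OF A]]) (auto intro!: exI[of _ "\<lambda>_. 0"] simp: L2_set_def)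
  thus ?thesis by (simp add: L2_set_def)
qed

lemma nrm2_mat_apply:
  assumes A: "A \<in> carrier_mat n m"
  shows "nrm2 {..<n} (\<lambda>i. \<Sum>j<m. A $$ (i, j) * \<xi> j) \<le> mat_opnorm A * nrm2 {..<m} \<xi>"
proof (cases "nrm2 {..<m} \<xi> = 0")
  case True
  hence "\<forall>j<m. \<xi> j = 0" by (simp add: L2_set_eq_0_iff)
  thus ?thesis using True by (simp add: L2_set_def)
next
  case False
  define t where "t = nrm2 {..<m} \<xi>"
  have t: "t > 0" using False by (simp add: t_def less_le)
  have "nrm2 {..<m} (\<lambda>j. complex_of_real (1/t) * \<xi> j) = 1"
    unfolding nrm2_scale using t by (simp add: t_def norm_divide)
  hence "nrm2 {..<n} (\<lambda>i. \<Sum>j<m. A $$ (i, j) * (complex_of_real (1/t) * \<xi> j)) \<le> mat_opnorm A"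
    unfolding mat_opnorm_alt[OF A]
    by (intro cSup_upper[OF _ mat_opnorm_bdd[OF A]] CollectI exI[of _ "\<lambda>j. complex_of_real (1/t) * \<xi> j"] conjI) auto
  also have "(\<lambda>i. \<Sum>j<m. A $$ (i, j) * (complex_of_real (1/t) * \<xi> j))
      = (\<lambda>i. complex_of_real (1/t) * (\<Sum>j<m. A $$ (i, j) * \<xi> j))"
    by (simp add: sum_distrib_left mult_ac)
  also have "nrm2 {..<n} \<dots> = (1/t) * nrm2 {..<n} (\<lambda>i. \<Sum>j<m. A $$ (i, j) * \<xi> j)"
    unfolding nrm2_scale using t by (simp add: norm_divide)
  finally show ?thesis using t by (simp add: t_def field_simps)
qed

lemma nrm2_apply_mat:
  assumes A: "A \<in> carrier_mat n m"
  shows "nrm2 {..<m} (\<lambda>j. \<Sum>i<n. \<eta> i * A $$ (i, j)) \<le> mat_opnorm A * nrm2 {..<n} \<eta>"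
proof (rule nrm2_le_of_pairings)
  show "0 \<le> mat_opnorm A * nrm2 {..<n} \<eta>" by (simp add: mat_opnorm_nonneg)
  fix \<xi> :: "nat \<Rightarrow> complex"
  have "(\<Sum>j<m. (\<Sum>i<n. \<eta> i * A $$ (i, j)) * \<xi> j) = (\<Sum>i<n. \<eta> i * (\<Sum>j<m. A $$ (i, j) * \<xi> j))"
    unfolding sum_distrib_left sum_distrib_right by (subst sum.swap) (simp add: mult_ac)
  hence "cmod (\<Sum>j<m. (\<Sum>i<n. \<eta> i * A $$ (i, j)) * \<xi> j) \<le> nrm2 {..<n} \<eta> * nrm2 {..<n} (\<lambda>i. \<Sum>j<m. A $$ (i, j) * \<xi> j)"
    by (simp add: cauchy_schwarz_sum)
  also have "\<dots> \<le> nrm2 {..<n} \<eta> * (mat_opnorm A * nrm2 {..<m} \<xi>)"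
    by (intro mult_left_mono nrm2_mat_apply A) simp
  finally show "cmod (\<Sum>j<m. (\<Sum>i<n. \<eta> i * A $$ (i, j)) * \<xi> j) \<le> mat_opnorm A * nrm2 {..<n} \<eta> * nrm2 {..<m} \<xi>"
    by (simp add: mult_ac)
qed

lemma mat_opnorm_bound:
  assumes A: "A \<in> carrier_mat n m"
  shows "cmod (\<Sum>i<n. \<Sum>j<m. \<eta> i * A $$ (i, j) * \<xi> j) \<le> mat_opnorm A * nrm2 {..<n} \<eta> * nrm2 {..<m} \<xi>"
proof -
  have "(\<Sum>i<n. \<Sum>j<m. \<eta> i * A $$ (i, j) * \<xi> j) = (\<Sum>i<n. \<eta> i * (\<Sum>j<m. A $$ (i, j) * \<xi> j))"
    by (simp add: sum_distrib_left mult_ac)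
  hence "cmod (\<Sum>i<n. \<Sum>j<m. \<eta> i * A $$ (i, j) * \<xi> j) \<le> nrm2 {..<n} \<eta> * nrm2 {..<n} (\<lambda>i. \<Sum>j<m. A $$ (i, j) * \<xi> j)"
    by (simp add: cauchy_schwarz_sum)
  also have "\<dots> \<le> nrm2 {..<n} \<eta> * (mat_opnorm A * nrm2 {..<m} \<xi>)"
    by (intro mult_left_mono nrm2_mat_apply A) simp
  finally show ?thesis by (simp add: mult_ac)
qed

lemma nrm2_mat_apply_Times:
  assumes "A \<in> carrier_mat n m" "finite K"
  shows "nrm2 ({..<n} \<times> K) (\<lambda>(i, k). \<Sum>j<m. A $$ (i, j) * \<xi> (j, k)) \<le> mat_opnorm A * nrm2 ({..<m} \<times> K) \<xi>"
  using assms by (intro nrm2_Times_le) (auto intro: nrm2_mat_apply mat_opnorm_nonneg)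

lemma nrm2_apply_mat_Times:
  assumes "A \<in> carrier_mat n m" "finite K"
  shows "nrm2 ({..<m} \<times> K) (\<lambda>(j, k). \<Sum>i<n. \<eta> (i, k) * A $$ (i, j)) \<le> mat_opnorm A * nrm2 ({..<n} \<times> K) \<eta>"
  using assms by (intro nrm2_Times_le) (auto intro: nrm2_apply_mat mat_opnorm_nonneg)

section \<open>Bilinear forms of matrices of functionals\<close>

text \<open>
  The bilinear form of the block matrix with the scalar blocks \<open>(\<pi> k l (x\<^sub>p\<^sub>q))\<^sub>k\<^sub>l\<close>, whose rows are
  indexed by the pairs \<open>(p, k)\<close> and whose columns by the pairs \<open>(q, l)\<close>.  Working with forms avoids
  enumerating \<open>K\<close> and \<open>L\<close>, which will also be finite sets of coordinates of sequences.
\<close>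

definition mform :: "'k set \<Rightarrow> 'l set \<Rightarrow> ('k \<Rightarrow> 'l \<Rightarrow> 'v \<Rightarrow> complex) \<Rightarrow> 'v mat \<Rightarrow>
    (nat \<times> 'k \<Rightarrow> complex) \<Rightarrow> (nat \<times> 'l \<Rightarrow> complex) \<Rightarrow> complex" where
  "mform K L \<pi> x \<eta> \<xi> = (\<Sum>p<dim_row x. \<Sum>q<dim_col x. \<Sum>k\<in>K. \<Sum>l\<in>L.
      \<eta> (p, k) * \<pi> k l (x $$ (p, q)) * \<xi> (q, l))"

definition fnorm :: "'k set \<Rightarrow> 'l set \<Rightarrow> ('k \<Rightarrow> 'l \<Rightarrow> 'v \<Rightarrow> complex) \<Rightarrow> 'v mat \<Rightarrow> real" where
  "fnorm K L \<pi> x = Sup {cmod (mform K L \<pi> x \<eta> \<xi>) | \<eta> \<xi>.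
     nrm2 ({..<dim_row x} \<times> K) \<eta> \<le> 1 \<and> nrm2 ({..<dim_col x} \<times> L) \<xi> \<le> 1}"

lemma cmod_le_nrm2: "finite S \<Longrightarrow> i \<in> S \<Longrightarrow> cmod (f i) \<le> nrm2 S f"
  using member_le_L2_set[of S i "\<lambda>i. cmod (f i)"] by simp

lemma mform_crude:
  assumes "finite K" "finite L" "nrm2 ({..<dim_row x} \<times> K) \<eta> \<le> 1" "nrm2 ({..<dim_col x} \<times> L) \<xi> \<le> 1"
  shows "cmod (mform K L \<pi> x \<eta> \<xi>) \<le> (\<Sum>p<dim_row x. \<Sum>q<dim_col x. \<Sum>k\<in>K. \<Sum>l\<in>L. cmod (\<pi> k l (x $$ (p, q))))"
  unfolding mform_def
proof (rule sum_norm_le)+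
  fix p q k l assume *: "p \<in> {..<dim_row x}" "q \<in> {..<dim_col x}" "k \<in> K" "l \<in> L"
  have "cmod (\<eta> (p, k)) \<le> 1"
    by (rule order_trans[OF cmod_le_nrm2 assms(3)]) (use * assms in auto)
  moreover have "cmod (\<xi> (q, l)) \<le> 1"
    by (rule order_trans[OF cmod_le_nrm2 assms(4)]) (use * assms in auto)
  ultimately show "cmod (\<eta> (p, k) * \<pi> k l (x $$ (p, q)) * \<xi> (q, l)) \<le> cmod (\<pi> k l (x $$ (p, q)))"
    unfolding norm_mult
    using mult_mono[OF mult_mono[OF \<open>cmod (\<eta> (p, k)) \<le> 1\<close> order_refl], of "cmod (\<pi> k l (x $$ (p, q)))" "cmod (\<xi> (q, l))" 1]
    by simp
qed

lemma fnorm_bdd: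
  assumes "finite K" "finite L"
  shows "bdd_above {cmod (mform K L \<pi> x \<eta> \<xi>) | \<eta> \<xi>.
     nrm2 ({..<dim_row x} \<times> K) \<eta> \<le> 1 \<and> nrm2 ({..<dim_col x} \<times> L) \<xi> \<le> 1}"
  by (rule bdd_aboveI) (auto intro: mform_crude[OF assms])

lemma mform_scale:
  "mform K L \<pi> x (\<lambda>i. c * \<eta> i) (\<lambda>i. d * \<xi> i) = c * d * mform K L \<pi> x \<eta> \<xi>"
  unfolding mform_def sum_distrib_left by (simp add: mult_ac)

lemma nrm2_normalize:
  assumes "nrm2 S f \<noteq> 0" shows "nrm2 S (\<lambda>i. complex_of_real (1 / nrm2 S f) * f i) = 1"
  unfolding nrm2_scale using assms L2_set_nonneg[of "\<lambda>i. cmod (f i)" S] by (simp add: norm_divide)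

lemma fnorm_bound:
  assumes fin: "finite K" "finite L" and x: "x \<in> carrier_mat n m"
  shows "cmod (mform K L \<pi> x \<eta> \<xi>) \<le> fnorm K L \<pi> x * nrm2 ({..<n} \<times> K) \<eta> * nrm2 ({..<m} \<times> L) \<xi>"
proof -
  define a where "a = nrm2 ({..<n} \<times> K) \<eta>"
  define b where "b = nrm2 ({..<m} \<times> L) \<xi>"
  have [simp]: "dim_row x = n" "dim_col x = m" using x by auto
  have nn: "a \<ge> 0" "b \<ge> 0" by (auto simp: a_def b_def)
  show ?thesis
  proof (cases "a = 0 \<or> b = 0")
    case True
    hence "(\<forall>p<n. \<forall>k\<in>K. \<eta> (p, k) = 0) \<or> (\<forall>q<m. \<forall>l\<in>L. \<xi> (q, l) = 0)"
      using fin by (auto simp: a_def b_def L2_set_eq_0_iff)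
    hence "mform K L \<pi> x \<eta> \<xi> = 0"
      unfolding mform_def by (intro sum.neutral ballI) auto
    thus ?thesis using True by (auto simp: a_def b_def)
  next
    case False
    let ?\<eta> = "\<lambda>i. complex_of_real (1/a) * \<eta> i" and ?\<xi> = "\<lambda>i. complex_of_real (1/b) * \<xi> i"
    have "nrm2 ({..<n} \<times> K) ?\<eta> = 1" "nrm2 ({..<m} \<times> L) ?\<xi> = 1"
      using False unfolding a_def b_def by (intro nrm2_normalize; simp)+
    hence "cmod (mform K L \<pi> x ?\<eta> ?\<xi>) \<le> fnorm K L \<pi> x"
      unfolding fnorm_def
      by (intro cSup_upper[OF _ fnorm_bdd[OF fin]] CollectI exI[of _ ?\<eta>] exI[of _ ?\<xi>] conjI refl) simp_all
    hence "cmod (mform K L \<pi> x \<eta> \<xi>) / (a * b) \<le> fnorm K L \<pi> x"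
      unfolding mform_scale using nn by (simp add: norm_mult norm_divide)
    thus ?thesis using False nn unfolding a_def[symmetric] b_def[symmetric]
      by (simp add: field_simps)
  qed
qed

lemma fnorm_leI:
  assumes "x \<in> carrier_mat n m" "0 \<le> C"
    and "\<And>\<eta> \<xi>. cmod (mform K L \<pi> x \<eta> \<xi>) \<le> C * nrm2 ({..<n} \<times> K) \<eta> * nrm2 ({..<m} \<times> L) \<xi>"
  shows "fnorm K L \<pi> x \<le> C"
  unfolding fnorm_def
proof (rule cSup_least)
  show "{cmod (mform K L \<pi> x \<eta> \<xi>) |\<eta> \<xi>. nrm2 ({..<dim_row x} \<times> K) \<eta> \<le> 1 \<and> nrm2 ({..<dim_col x} \<times> L) \<xi> \<le> 1} \<noteq> {}"
    by (auto intro!: exI[of _ "\<lambda>_. 0"] simp: L2_set_def)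
next
  fix r assume "r \<in> {cmod (mform K L \<pi> x \<eta> \<xi>) |\<eta> \<xi>. nrm2 ({..<dim_row x} \<times> K) \<eta> \<le> 1 \<and> nrm2 ({..<dim_col x} \<times> L) \<xi> \<le> 1}"
  then obtain \<eta> \<xi> where r: "r = cmod (mform K L \<pi> x \<eta> \<xi>)" "nrm2 ({..<n} \<times> K) \<eta> \<le> 1" "nrm2 ({..<m} \<times> L) \<xi> \<le> 1"
    using assms(1) by auto
  have "r \<le> C * (nrm2 ({..<n} \<times> K) \<eta> * nrm2 ({..<m} \<times> L) \<xi>)"
    unfolding r using assms(3)[of \<eta> \<xi>] by (simp add: mult_ac)
  also have "\<dots> \<le> C * 1" using r assms(2) by (intro mult_left_mono mult_le_one) auto
  finally show "r \<le> C" by simp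
qed

lemma fnorm_nonneg:
  assumes "finite K" "finite L" shows "0 \<le> fnorm K L \<pi> x"
proof -
  have "cmod (mform K L \<pi> x (\<lambda>_. 0) (\<lambda>_. 0)) \<le> fnorm K L \<pi> x"
    unfolding fnorm_def by (rule cSup_upper[OF _ fnorm_bdd[OF assms]])
      (auto intro!: exI[of _ "\<lambda>_. 0"] simp: L2_set_def)
  thus ?thesis by (simp add: mform_def)
qed

section \<open>Scalar matrices with orthogonal rows or columns\<close>

lemma mat_opnorm_transpose_le: "mat_opnorm A\<^sup>T \<le> mat_opnorm A"
proof (rule mat_opnorm_leI)
  show "A\<^sup>T \<in> carrier_mat (dim_col A) (dim_row A)" by auto
  fix \<eta> \<xi> :: "nat \<Rightarrow> complex"
  have "(\<Sum>i<dim_col A. \<Sum>j<dim_row A. \<eta> i * A\<^sup>T $$ (i, j) * \<xi> j) = (\<Sum>j<dim_row A. \<Sum>i<dim_col A. \<xi> j * A $$ (j, i) * \<eta> i)"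
    by (subst sum.swap) (simp add: mult_ac)
  thus "cmod (\<Sum>i<dim_col A. \<Sum>j<dim_row A. \<eta> i * A\<^sup>T $$ (i, j) * \<xi> j)
       \<le> mat_opnorm A * nrm2 {..<dim_col A} \<eta> * nrm2 {..<dim_row A} \<xi>"
    using mat_opnorm_bound[of A "dim_row A" "dim_col A" \<xi> \<eta>] by (simp add: mult_ac)
qed (rule mat_opnorm_nonneg)

text \<open>
  If every column has at most one nonzero entry, the rows of \<open>A\<close> are orthogonal and the squares of
  the norms of the vectors \<open>\<eta>\<^sub>i A\<^sub>i\<close> add up.  Selections, paddings and the weighted concatenation
  of two identity matrices are all of this kind.
\<close>

lemma mat_opnorm_le_row:
  assumes A: "A \<in> carrier_mat n m" and C: "0 \<le> C"
    and row: "\<And>i. i < n \<Longrightarrow> (\<Sum>j<m. (cmod (A $$ (i, j)))\<^sup>2) \<le> C\<^sup>2"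
    and disj: "\<And>i i' j. i < n \<Longrightarrow> i' < n \<Longrightarrow> j < m \<Longrightarrow> A $$ (i, j) \<noteq> 0 \<Longrightarrow> A $$ (i', j) \<noteq> 0 \<Longrightarrow> i = i'"
  shows "mat_opnorm A \<le> C"
proof (rule mat_opnorm_leI[OF A C])
  fix \<eta> \<xi> :: "nat \<Rightarrow> complex"
  let ?y = "\<lambda>j. \<Sum>i<n. \<eta> i * A $$ (i, j)"
  have col: "(cmod (?y j))\<^sup>2 = (\<Sum>i<n. (cmod (\<eta> i * A $$ (i, j)))\<^sup>2)" if "j < m" for j
  proof (cases "\<exists>i<n. A $$ (i, j) \<noteq> 0")
    case True
    then obtain i0 where i0: "i0 < n" "A $$ (i0, j) \<noteq> 0" by auto
    hence z: "A $$ (i, j) = 0" if "i < n" "i \<noteq> i0" for i using disj[of i i0 j] that \<open>j < m\<close> by blast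
    have "?y j = (\<Sum>i<n. if i = i0 then \<eta> i0 * A $$ (i0, j) else 0)"
      by (rule sum.cong) (auto simp: z)
    moreover have "(\<Sum>i<n. (cmod (\<eta> i * A $$ (i, j)))\<^sup>2) = (\<Sum>i<n. if i = i0 then (cmod (\<eta> i0 * A $$ (i0, j)))\<^sup>2 else 0)"
      by (rule sum.cong) (auto simp: z)
    ultimately show ?thesis using i0 by simp
  qed auto
  have "(nrm2 {..<m} ?y)\<^sup>2 = (\<Sum>j<m. \<Sum>i<n. (cmod (\<eta> i * A $$ (i, j)))\<^sup>2)"
    unfolding nrm2_power2 by (rule sum.cong) (simp_all add: col)
  also have "\<dots> = (\<Sum>i<n. (cmod (\<eta> i))\<^sup>2 * (\<Sum>j<m. (cmod (A $$ (i, j)))\<^sup>2))"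
    by (subst sum.swap) (simp add: norm_mult power_mult_distrib sum_distrib_left)
  also have "\<dots> \<le> (\<Sum>i<n. (cmod (\<eta> i))\<^sup>2 * C\<^sup>2)"
    by (intro sum_mono mult_left_mono row) auto
  also have "\<dots> = (C * nrm2 {..<n} \<eta>)\<^sup>2"
    by (simp add: power_mult_distrib nrm2_power2 sum_distrib_left mult_ac)
  finally have y: "nrm2 {..<m} ?y \<le> C * nrm2 {..<n} \<eta>"
    by (rule power2_le_imp_le) (simp add: C)
  have "(\<Sum>i<n. \<Sum>j<m. \<eta> i * A $$ (i, j) * \<xi> j) = (\<Sum>j<m. ?y j * \<xi> j)"
    by (subst sum.swap) (simp add: sum_distrib_right)
  also have "cmod \<dots> \<le> nrm2 {..<m} ?y * nrm2 {..<m} \<xi>"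
    by (rule cauchy_schwarz_sum)
  also have "\<dots> \<le> C * nrm2 {..<n} \<eta> * nrm2 {..<m} \<xi>"
    by (intro mult_right_mono y) simp
  finally show "cmod (\<Sum>i<n. \<Sum>j<m. \<eta> i * A $$ (i, j) * \<xi> j) \<le> C * nrm2 {..<n} \<eta> * nrm2 {..<m} \<xi>" .
qed

lemma mat_opnorm_le_col:
  assumes A: "A \<in> carrier_mat n m" and C: "0 \<le> C"
    and col: "\<And>j. j < m \<Longrightarrow> (\<Sum>i<n. (cmod (A $$ (i, j)))\<^sup>2) \<le> C\<^sup>2"
    and disj: "\<And>i j j'. i < n \<Longrightarrow> j < m \<Longrightarrow> j' < m \<Longrightarrow> A $$ (i, j) \<noteq> 0 \<Longrightarrow> A $$ (i, j') \<noteq> 0 \<Longrightarrow> j = j'"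
  shows "mat_opnorm A \<le> C"
proof -
  have "mat_opnorm A\<^sup>T \<le> C"
    using A C col disj by (intro mat_opnorm_le_row[of _ m n]) auto
  thus ?thesis using mat_opnorm_transpose_le[of "A\<^sup>T"] by simp
qed

lemma mat_opnorm_01:
  assumes A: "A \<in> carrier_mat n m"
    and v: "\<And>i j. i < n \<Longrightarrow> j < m \<Longrightarrow> A $$ (i, j) \<in> {0, 1}"
    and r: "\<And>i j j'. i < n \<Longrightarrow> j < m \<Longrightarrow> j' < m \<Longrightarrow> A $$ (i, j) \<noteq> 0 \<Longrightarrow> A $$ (i, j') \<noteq> 0 \<Longrightarrow> j = j'"
    and c: "\<And>i i' j. i < n \<Longrightarrow> i' < n \<Longrightarrow> j < m \<Longrightarrow> A $$ (i, j) \<noteq> 0 \<Longrightarrow> A $$ (i', j) \<noteq> 0 \<Longrightarrow> i = i'"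
  shows "mat_opnorm A \<le> 1"
proof (rule mat_opnorm_le_row[OF A _ _ c])
  fix i assume i: "i < n"
  show "(\<Sum>j<m. (cmod (A $$ (i, j)))\<^sup>2) \<le> 1\<^sup>2"
  proof (cases "\<exists>j<m. A $$ (i, j) \<noteq> 0")
    case True
    then obtain j0 where j0: "j0 < m" "A $$ (i, j0) \<noteq> 0" by auto
    have "(\<Sum>j<m. (cmod (A $$ (i, j)))\<^sup>2) = (\<Sum>j<m. if j = j0 then 1 else 0)"
    proof (rule sum.cong)
      fix j assume "j \<in> {..<m}"
      thus "(cmod (A $$ (i, j)))\<^sup>2 = (if j = j0 then 1 else 0)"
        using v[OF i, of j] v[OF i, of j0] r[OF i, of j j0] j0 by (cases "j = j0") auto
    qed simp
    thus ?thesis using j0 by simp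
  qed auto
qed auto

section \<open>Complex vector spaces on carriers\<close>

text \<open>
  The facts of the library's locale of modules speak about the operations of the record
  \<open>class_ring\<close>; here they are restated with the operations of type \<^typ>\<open>complex\<close>.
\<close>

locale cvs = fixes V :: "(complex, 'v, 'm) module_scheme" (structure)
  assumes vectorspace: "vectorspace class_ring V"
begin

lemma is_module: "Module.module class_ring V"
  using vectorspace by (rule vectorspace.axioms)

sublocale abelian_group V
  using is_module by (rule module.axioms)

lemma smult_closed [simp, intro]: "x \<in> carrier V \<Longrightarrow> c \<odot> x \<in> carrier V"
  using module.smult_closed[OF is_module] by simp

lemma smult_l_distr: "x \<in> carrier V \<Longrightarrow> (a + b) \<odot> x = a \<odot> x \<oplus> b \<odot> x"
  using module.smult_l_distr[OF is_module] by simp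

lemma smult_r_distr: "x \<in> carrier V \<Longrightarrow> y \<in> carrier V \<Longrightarrow> a \<odot> (x \<oplus> y) = a \<odot> x \<oplus> a \<odot> y"
  using module.smult_r_distr[OF is_module] by simp

lemma smult_smult: "x \<in> carrier V \<Longrightarrow> a \<odot> (b \<odot> x) = (a * b) \<odot> x"
  using module.smult_assoc1[OF is_module] by simp

lemma smult_one [simp]: "x \<in> carrier V \<Longrightarrow> 1 \<odot> x = x"
  using module.smult_one[OF is_module] by simp

lemma smult_zero [simp]: "x \<in> carrier V \<Longrightarrow> 0 \<odot> x = \<zero>"
  using module.smult_l_null[OF is_module] by simp

lemma smult_zero_right [simp]: "a \<odot> \<zero> = \<zero>"
  using module.smult_r_null[OF is_module] by simp

lemma neg_eq_smult: "x \<in> carrier V \<Longrightarrow> \<ominus> x = (-1) \<odot> x"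
  using module.smult_l_minus[OF is_module, of 1 x] by (simp add: class_ring_simps)

lemma minus_eq_smult: "x \<in> carrier V \<Longrightarrow> y \<in> carrier V \<Longrightarrow> x \<ominus> y = x \<oplus> (-1) \<odot> y"
  by (simp add: a_minus_def neg_eq_smult)

lemma finsum_smult: "finite A \<Longrightarrow> f \<in> A \<rightarrow> carrier V \<Longrightarrow> c \<odot> finsum V f A = finsum V (\<lambda>i. c \<odot> f i) A"
  using module.finsum_smult_ldistr[OF is_module] by simp

end

lemma cvsI:
  fixes V :: "(complex, 'v, 'm) module_scheme" (structure)
  assumes "\<And>x y. x \<in> carrier V \<Longrightarrow> y \<in> carrier V \<Longrightarrow> x \<oplus> y \<in> carrier V"
    and "\<zero> \<in> carrier V"
    and "\<And>c x. x \<in> carrier V \<Longrightarrow> c \<odot> x \<in> carrier V"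
    and "\<And>x y z. x \<in> carrier V \<Longrightarrow> y \<in> carrier V \<Longrightarrow> z \<in> carrier V \<Longrightarrow> (x \<oplus> y) \<oplus> z = x \<oplus> (y \<oplus> z)"
    and "\<And>x y. x \<in> carrier V \<Longrightarrow> y \<in> carrier V \<Longrightarrow> x \<oplus> y = y \<oplus> x"
    and "\<And>x. x \<in> carrier V \<Longrightarrow> \<zero> \<oplus> x = x"
    and neg: "\<And>x. x \<in> carrier V \<Longrightarrow> (-1) \<odot> x \<oplus> x = \<zero>"
    and "\<And>a b x. x \<in> carrier V \<Longrightarrow> (a + b) \<odot> x = a \<odot> x \<oplus> b \<odot> x"
    and "\<And>a x y. x \<in> carrier V \<Longrightarrow> y \<in> carrier V \<Longrightarrow> a \<odot> (x \<oplus> y) = a \<odot> x \<oplus> a \<odot> y"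
    and "\<And>a b x. x \<in> carrier V \<Longrightarrow> (a * b) \<odot> x = a \<odot> (b \<odot> x)"
    and "\<And>x. x \<in> carrier V \<Longrightarrow> 1 \<odot> x = x"
  shows "cvs V"
proof (rule cvs.intro)
  have "abelian_group V"
  proof (rule abelian_groupI)
    fix x assume "x \<in> carrier V"
    thus "\<exists>y\<in>carrier V. y \<oplus> x = \<zero>" using neg assms(3) by blast
  qed (use assms in auto)
  hence "Module.module class_ring V"
    by (intro moduleI class_cring.is_cring) (use assms in auto)
  thus "vectorspace class_ring V"
    by (intro vectorspace.intro class_field)
qed

lemma with_mnorm_simps [simp]:
  "carrier (with_mnorm V \<rho>) = carrier V" "add (with_mnorm V \<rho>) = add V"
  "zero (with_mnorm V \<rho>) = zero V" "smult (with_mnorm V \<rho>) = smult V"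
  "monoid.mult (with_mnorm V \<rho>) = monoid.mult V" "mnorm (with_mnorm V \<rho>) = \<rho>"
  by (simp_all add: with_mnorm_def)

lemma mats_with_mnorm [simp]: "mats (with_mnorm V \<rho>) = mats V"
  by (simp add: mats_def fun_eq_iff)

lemma add_mats_with_mnorm [simp]: "add_mats (with_mnorm V \<rho>) = add_mats V"
  by (simp add: add_mats_def fun_eq_iff)

lemma diag_sum_with_mnorm [simp]: "diag_sum (with_mnorm V \<rho>) = diag_sum V"
  by (simp add: diag_sum_def zero_mats_def fun_eq_iff)

lemma zero_mats_with_mnorm [simp]: "zero_mats (with_mnorm V \<rho>) = zero_mats V"
  by (simp add: zero_mats_def fun_eq_iff)

lemma finsum_with_mnorm [simp]: "finsum (with_mnorm V \<rho>) = finsum V"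
  by (simp add: finsum_def finprod_def fun_eq_iff)

lemma scalar_sandwich_with_mnorm [simp]: "scalar_sandwich (with_mnorm V \<rho>) = scalar_sandwich V"
  by (simp add: scalar_sandwich_def fun_eq_iff)

lemma cvs_with_mnorm: assumes "cvs V" shows "cvs (with_mnorm V \<rho>)"
proof -
  interpret cvs V by fact
  show ?thesis by (rule cvsI)
    (auto simp: a_assoc smult_l_distr smult_r_distr smult_smult l_neg intro: a_comm simp flip: neg_eq_smult)
qed

lemma mats_iff: "x \<in> mats V n m \<longleftrightarrow> x \<in> carrier_mat n m \<and> (\<forall>i<n. \<forall>j<m. x $$ (i, j) \<in> carrier V)"
  unfolding mats_def elements_mat_def carrier_mat_def by (fastforce simp: subset_iff)

lemma matsD: "x \<in> mats V n m \<Longrightarrow> x \<in> carrier_mat n m" "x \<in> mats V n m \<Longrightarrow> dim_row x = n"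
  "x \<in> mats V n m \<Longrightarrow> dim_col x = m"
  by (auto simp: mats_def)

lemma matsE: "x \<in> mats V n m \<Longrightarrow> i < n \<Longrightarrow> j < m \<Longrightarrow> x $$ (i, j) \<in> carrier V"
  by (auto simp: mats_iff)

lemma mat1_mats: "v \<in> carrier V \<Longrightarrow> mat1 v \<in> mats V 1 1"
  by (auto simp: mats_iff)

section \<open>Matrix seminorms and Ruan's axioms\<close>

text \<open>
  The part of Ruan's axioms that passes to quotients and completions by taking infima and limits.
  Homogeneity is an inequality because the reverse one follows by scaling back.
\<close>

definition mat_seminorm :: "(complex, 'v, 'm) module_scheme \<Rightarrow> ('v mat \<Rightarrow> real) \<Rightarrow> bool" where
  "mat_seminorm V \<rho> \<longleftrightarrow>
     (\<forall>n. \<forall>x \<in> mats V n n. 0 \<le> \<rho> x) \<and>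
     (\<forall>n. \<forall>x \<in> mats V n n. \<forall>y \<in> mats V n n. \<rho> (add_mats V x y) \<le> \<rho> x + \<rho> y) \<and>
     (\<forall>n. \<forall>x \<in> mats V n n. \<forall>c. \<rho> (map_mat (\<lambda>v. c \<odot>\<^bsub>V\<^esub> v) x) \<le> cmod c * \<rho> x)"

text \<open>
  This makes the matrix norms continuous in the entries, so that they converge along a matrix of
  Cauchy sequences.
\<close>

definition entry_bounded :: "(complex, 'v, 'm) module_scheme \<Rightarrow> ('v mat \<Rightarrow> real) \<Rightarrow> bool" where
  "entry_bounded V \<rho> \<longleftrightarrow> (\<forall>n. \<forall>x \<in> mats V n n. \<rho> x \<le> (\<Sum>i<n. \<Sum>j<n. \<rho> (mat1 (x $$ (i, j)))))"

text \<open>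
  Ruan's axioms for a seminorm, each in its nontrivial direction; the converse inequalities are
  recovered in \<open>operator_space_with_mnormI\<close>.
\<close>

definition op_seminorm :: "(complex, 'v, 'm) module_scheme \<Rightarrow> ('v mat \<Rightarrow> real) \<Rightarrow> bool" where
  "op_seminorm V \<rho> \<longleftrightarrow> mat_seminorm V \<rho> \<and>
     (\<forall>m n. \<forall>x \<in> mats V m m. \<forall>y \<in> mats V n n. \<rho> (diag_sum V x y) \<le> max (\<rho> x) (\<rho> y)) \<and>
     (\<forall>m n. \<forall>x \<in> mats V m m. \<forall>\<alpha> \<in> carrier_mat n m. \<forall>\<beta> \<in> carrier_mat m n.
        \<rho> (scalar_sandwich V \<alpha> x \<beta>) \<le> mat_opnorm \<alpha> * \<rho> x * mat_opnorm \<beta>)"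

lemma mat_seminormD:
  assumes "mat_seminorm V \<rho>" "x \<in> mats V n n"
  shows "0 \<le> \<rho> x" "y \<in> mats V n n \<Longrightarrow> \<rho> (add_mats V x y) \<le> \<rho> x + \<rho> y"
    "\<rho> (map_mat (\<lambda>v. c \<odot>\<^bsub>V\<^esub> v) x) \<le> cmod c * \<rho> x"
  using assms unfolding mat_seminorm_def by auto

lemma op_seminormD:
  assumes "op_seminorm V \<rho>"
  shows "mat_seminorm V \<rho>"
    "x \<in> mats V m m \<Longrightarrow> y \<in> mats V n n \<Longrightarrow> \<rho> (diag_sum V x y) \<le> max (\<rho> x) (\<rho> y)"
    "x \<in> mats V m m \<Longrightarrow> \<alpha> \<in> carrier_mat n m \<Longrightarrow> \<beta> \<in> carrier_mat m n \<Longrightarrow> 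
        \<rho> (scalar_sandwich V \<alpha> x \<beta>) \<le> mat_opnorm \<alpha> * \<rho> x * mat_opnorm \<beta>"
  using assms unfolding op_seminorm_def by auto

context cvs begin

lemma add_mats_mats: "x \<in> mats V n m \<Longrightarrow> y \<in> mats V n m \<Longrightarrow> add_mats V x y \<in> mats V n m"
  by (auto simp: mats_iff add_mats_def)

lemma smult_mats: "x \<in> mats V n m \<Longrightarrow> map_mat (\<lambda>v. c \<odot> v) x \<in> mats V n m"
  by (auto simp: mats_iff)

lemma zero_mats_mats: "zero_mats V n m \<in> mats V n m"
  by (auto simp: mats_iff zero_mats_def)

lemma diag_sum_mats: "x \<in> mats V n n \<Longrightarrow> y \<in> mats V m m \<Longrightarrow> diag_sum V x y \<in> mats V (n + m) (n + m)"
  by (auto simp: mats_iff diag_sum_def zero_mats_def)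

lemma sandwich_mats:
  assumes "x \<in> mats V r c" "\<alpha> \<in> carrier_mat n r" "\<beta> \<in> carrier_mat c m"
  shows "scalar_sandwich V \<alpha> x \<beta> \<in> mats V n m"
  using assms by (auto simp: mats_iff scalar_sandwich_def intro!: finsum_closed)

lemma sandwich_index:
  assumes "x \<in> mats V r c" "\<alpha> \<in> carrier_mat n r" "\<beta> \<in> carrier_mat c m" "i < n" "j < m"
  shows "scalar_sandwich V \<alpha> x \<beta> $$ (i, j) = finsum V (\<lambda>(k, l). (\<alpha> $$ (i, k) * \<beta> $$ (l, j)) \<odot> x $$ (k, l)) ({..<r} \<times> {..<c})"
  using assms by (auto simp: mats_iff scalar_sandwich_def)

text \<open>
  The scalar matrices used below select, pad or concatenate, so at most one term of the sum that
  defines an entry of the product is nonzero.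
\<close>

lemma sandwich_entry:
  assumes x: "x \<in> mats V r c" "\<alpha> \<in> carrier_mat n r" "\<beta> \<in> carrier_mat c m" "i < n" "j < m"
    and k: "k < r" "l < c"
    and z: "\<And>k' l'. k' < r \<Longrightarrow> l' < c \<Longrightarrow> (k', l') \<noteq> (k, l) \<Longrightarrow> \<alpha> $$ (i, k') * \<beta> $$ (l', j) = 0 \<or> x $$ (k', l') = \<zero>"
  shows "scalar_sandwich V \<alpha> x \<beta> $$ (i, j) = (\<alpha> $$ (i, k) * \<beta> $$ (l, j)) \<odot> x $$ (k, l)"
proof -
  let ?f = "\<lambda>(k, l). (\<alpha> $$ (i, k) * \<beta> $$ (l, j)) \<odot> x $$ (k, l)"
  have "finsum V ?f ({..<r} \<times> {..<c}) = finsum V (\<lambda>q. if (k, l) = q then ?f q else \<zero>) ({..<r} \<times> {..<c})"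
  proof (rule finsum_cong')
    fix q assume q: "q \<in> {..<r} \<times> {..<c}"
    show "?f q = (if (k, l) = q then ?f q else \<zero>)"
    proof (cases "q = (k, l)")
      case False
      obtain k' l' where q': "q = (k', l')" by force
      have "?f q = \<zero>"
      proof (cases "\<alpha> $$ (i, k') * \<beta> $$ (l', j) = 0")
        case True
        show ?thesis using q matsE[OF x(1)] by (simp only: q' prod.case True) simp
      next
        case nonzero: False
        have "x $$ (k', l') = \<zero>" using z[of k' l'] q False nonzero unfolding q' by blast
        thus ?thesis by (simp add: q')
      qed
      thus ?thesis using False by simp
    qed auto
  qed (use matsE[OF x(1)] in auto)
  also have "\<dots> = ?f (k, l)"
    by (rule finsum_singleton) (use matsE[OF x(1)] k in auto)
  finally show ?thesis unfolding sandwich_index[OF x] by simp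
qed

lemma sandwich_entry_zero:
  assumes x: "x \<in> mats V r c" "\<alpha> \<in> carrier_mat n r" "\<beta> \<in> carrier_mat c m" "i < n" "j < m"
    and z: "\<And>k l. k < r \<Longrightarrow> l < c \<Longrightarrow> \<alpha> $$ (i, k) * \<beta> $$ (l, j) = 0"
  shows "scalar_sandwich V \<alpha> x \<beta> $$ (i, j) = \<zero>"
proof -
  have "finsum V (\<lambda>(k, l). (\<alpha> $$ (i, k) * \<beta> $$ (l, j)) \<odot> x $$ (k, l)) ({..<r} \<times> {..<c}) = finsum V (\<lambda>_. \<zero>) ({..<r} \<times> {..<c})"
  proof (rule finsum_cong')
    fix q assume q: "q \<in> {..<r} \<times> {..<c}"
    obtain k l where q': "q = (k, l)" by force
    have z': "\<alpha> $$ (i, k) * \<beta> $$ (l, j) = 0" using z[of k l] q unfolding q' by blast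
    show "(case q of (k, l) \<Rightarrow> (\<alpha> $$ (i, k) * \<beta> $$ (l, j)) \<odot> x $$ (k, l)) = \<zero>"
      using q matsE[OF x(1)] by (simp only: q' prod.case z') simp
  qed auto
  thus ?thesis unfolding sandwich_index[OF x] by (simp add: finsum_zero)
qed

lemma mat_seminorm_zero:
  assumes "mat_seminorm V \<rho>" shows "\<rho> (zero_mats V n n) = 0"
proof -
  have "map_mat (\<lambda>v. 0 \<odot> v) (zero_mats V n n) = zero_mats V n n"
    by (rule eq_matI) (auto simp: zero_mats_def)
  hence "\<rho> (zero_mats V n n) \<le> 0"
    using mat_seminormD(3)[OF assms zero_mats_mats[of n n], where c=0] by simp
  thus ?thesis using mat_seminormD(1)[OF assms zero_mats_mats[of n n]] by simp
qed

lemma entry_boundedI: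
  assumes \<rho>: "mat_seminorm V \<rho>"
    and single: "\<And>n i j v. i < n \<Longrightarrow> j < n \<Longrightarrow> v \<in> carrier V \<Longrightarrow>
      \<rho> (mat n n (\<lambda>ij. if ij = (i, j) then v else \<zero>)) \<le> \<rho> (mat1 v)"
  shows "entry_bounded V \<rho>"
  unfolding entry_bounded_def
proof (intro allI ballI)
  fix n x assume x: "x \<in> mats V n n"
  define R where "R S = mat n n (\<lambda>ij. if ij \<in> S then x $$ ij else \<zero>)" for S
  have R: "R S \<in> mats V n n" for S using matsE[OF x] by (auto simp: mats_iff R_def)
  have "\<rho> (R S) \<le> (\<Sum>ij\<in>S. \<rho> (mat1 (x $$ ij)))" if "finite S" "S \<subseteq> {..<n} \<times> {..<n}" for S
    using that
  proof (induction S)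
    case empty
    have "R {} = zero_mats V n n" by (rule eq_matI) (auto simp: R_def zero_mats_def)
    thus ?case using mat_seminorm_zero[OF \<rho>] by simp
  next
    case (insert ij S)
    obtain i j where ij: "ij = (i, j)" "i < n" "j < n" using insert.prems by auto
    let ?E = "mat n n (\<lambda>kl. if kl = (i, j) then x $$ (i, j) else \<zero>)"
    have E: "?E \<in> mats V n n" using matsE[OF x] ij by (auto simp: mats_iff)
    have "R (insert ij S) = add_mats V (R S) ?E"
      using matsE[OF x] insert.hyps by (intro eq_matI) (auto simp: R_def add_mats_def ij)
    hence "\<rho> (R (insert ij S)) \<le> \<rho> (R S) + \<rho> ?E"
      using mat_seminormD(2)[OF \<rho> R E] by simp
    also have "\<dots> \<le> (\<Sum>ij\<in>S. \<rho> (mat1 (x $$ ij))) + \<rho> (mat1 (x $$ ij))"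
      using insert.IH insert.prems single[OF ij(2,3) matsE[OF x ij(2,3)]] ij by auto
    also have "\<dots> = (\<Sum>ij\<in>insert ij S. \<rho> (mat1 (x $$ ij)))"
      using insert.hyps by simp
    finally show ?case .
  qed
  from this[of "{..<n} \<times> {..<n}"] have "\<rho> (R ({..<n} \<times> {..<n})) \<le> (\<Sum>ij\<in>{..<n} \<times> {..<n}. \<rho> (mat1 (x $$ ij)))"
    by simp
  moreover have "R ({..<n} \<times> {..<n}) = x"
    using matsD[OF x] by (intro eq_matI) (auto simp: R_def)
  ultimately show "\<rho> x \<le> (\<Sum>i<n. \<Sum>j<n. \<rho> (mat1 (x $$ (i, j))))"
    by (simp add: sum.cartesian_product case_prod_unfold)
qed

text \<open>
  A single-entry matrix is its entry, multiplied by a unit column and a unit row.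
\<close>

lemma op_seminorm_entry_bounded:
  assumes \<rho>: "op_seminorm V \<rho>" shows "entry_bounded V \<rho>"
proof (rule entry_boundedI)
  show ms: "mat_seminorm V \<rho>" using op_seminormD(1)[OF \<rho>] .
  fix n i j :: nat and v assume ij: "i < n" "j < n" and v: "v \<in> carrier V"
  define \<alpha> where "\<alpha> = mat n 1 (\<lambda>(k, l). if k = i then 1 else 0 :: complex)"
  define \<beta> where "\<beta> = mat 1 n (\<lambda>(k, l). if l = j then 1 else 0 :: complex)"
  have "scalar_sandwich V \<alpha> (mat1 v) \<beta> = mat n n (\<lambda>kl. if kl = (i, j) then v else \<zero>)"
  proof (rule eq_matI)
    fix k l assume "k < dim_row (mat n n (\<lambda>kl. if kl = (i, j) then v else \<zero>))"
      "l < dim_col (mat n n (\<lambda>kl. if kl = (i, j) then v else \<zero>))"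
    hence kl: "k < n" "l < n" by auto
    have "scalar_sandwich V \<alpha> (mat1 v) \<beta> $$ (k, l) = (\<alpha> $$ (k, 0) * \<beta> $$ (0, l)) \<odot> mat1 v $$ (0, 0)"
      by (rule sandwich_entry[OF mat1_mats[OF v], of _ n _ n]) (auto simp: \<alpha>_def \<beta>_def kl)
    thus "scalar_sandwich V \<alpha> (mat1 v) \<beta> $$ (k, l) = mat n n (\<lambda>kl. if kl = (i, j) then v else \<zero>) $$ (k, l)"
      using kl v by (auto simp: \<alpha>_def \<beta>_def)
  qed (auto simp: scalar_sandwich_def \<alpha>_def \<beta>_def)
  hence "\<rho> (mat n n (\<lambda>kl. if kl = (i, j) then v else \<zero>)) \<le> mat_opnorm \<alpha> * \<rho> (mat1 v) * mat_opnorm \<beta>"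
    using op_seminormD(3)[OF \<rho> mat1_mats[OF v], of \<alpha> n \<beta>] by (simp add: \<alpha>_def \<beta>_def)
  also have "\<dots> \<le> 1 * \<rho> (mat1 v) * 1"
    using mat_seminormD(1)[OF ms mat1_mats[OF v]]
    by (intro mult_mono mat_opnorm_01[of \<alpha> n 1] mat_opnorm_01[of \<beta> 1 n])
       (auto simp: \<alpha>_def \<beta>_def mat_opnorm_nonneg split: if_splits)
  finally show "\<rho> (mat n n (\<lambda>kl. if kl = (i, j) then v else \<zero>)) \<le> \<rho> (mat1 v)" by simp
qed

lemma op_seminorm_entry_le:
  assumes \<rho>: "op_seminorm V \<rho>" and x: "x \<in> mats V n n" and ij: "i < n" "j < n"
  shows "\<rho> (mat1 (x $$ (i, j))) \<le> \<rho> x"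
proof -
  have ms: "mat_seminorm V \<rho>" using op_seminormD(1)[OF \<rho>] .
  define \<alpha> where "\<alpha> = mat 1 n (\<lambda>(k, l). if l = i then 1 else 0 :: complex)"
  define \<beta> where "\<beta> = mat n 1 (\<lambda>(k, l). if k = j then 1 else 0 :: complex)"
  have "scalar_sandwich V \<alpha> x \<beta> $$ (0, 0) = (\<alpha> $$ (0, i) * \<beta> $$ (j, 0)) \<odot> x $$ (i, j)"
    by (rule sandwich_entry[OF x, of _ 1 _ 1]) (use ij in \<open>auto simp: \<alpha>_def \<beta>_def\<close>)
  hence "scalar_sandwich V \<alpha> x \<beta> = mat1 (x $$ (i, j))"
    using ij matsE[OF x ij] by (intro eq_matI) (auto simp: \<alpha>_def \<beta>_def scalar_sandwich_def)
  hence "\<rho> (mat1 (x $$ (i, j))) \<le> mat_opnorm \<alpha> * \<rho> x * mat_opnorm \<beta>"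
    using op_seminormD(3)[OF \<rho> x, of \<alpha> 1 \<beta>] by (simp add: \<alpha>_def \<beta>_def)
  also have "\<dots> \<le> 1 * \<rho> x * 1"
    using mat_seminormD(1)[OF ms x]
    by (intro mult_mono mat_opnorm_01[of \<alpha> 1 n] mat_opnorm_01[of \<beta> n 1])
       (auto simp: \<alpha>_def \<beta>_def mat_opnorm_nonneg split: if_splits)
  finally show ?thesis by simp
qed

text \<open>
  Both blocks are compressions of the direct sum by coordinate isometries.
\<close>

lemma diag_sum_ge:
  assumes \<rho>: "op_seminorm V \<rho>" and x: "x \<in> mats V m m" and y: "y \<in> mats V n n"
  shows "max (\<rho> x) (\<rho> y) \<le> \<rho> (diag_sum V x y)"
proof -
  have ms: "mat_seminorm V \<rho>" using op_seminormD(1)[OF \<rho>] .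
  let ?d = "diag_sum V x y"
  have d: "?d \<in> mats V (m + n) (m + n)" using diag_sum_mats[OF x y] .
  have key: "\<rho> z \<le> \<rho> ?d" if z: "z \<in> mats V k k" and s: "s + k \<le> m + n" 
    and zd: "\<And>i j. i < k \<Longrightarrow> j < k \<Longrightarrow> z $$ (i, j) = ?d $$ (s + i, s + j)" for z k s
  proof -
    define \<alpha> where "\<alpha> = mat k (m + n) (\<lambda>(i, j). if j = s + i then 1 else 0 :: complex)"
    define \<beta> where "\<beta> = mat (m + n) k (\<lambda>(i, j). if i = s + j then 1 else 0 :: complex)"
    have "scalar_sandwich V \<alpha> ?d \<beta> = z"
    proof (rule eq_matI)
      fix i j assume "i < dim_row z" "j < dim_col z"
      hence ij: "i < k" "j < k" using matsD[OF z] by auto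
      have "scalar_sandwich V \<alpha> ?d \<beta> $$ (i, j) = (\<alpha> $$ (i, s + i) * \<beta> $$ (s + j, j)) \<odot> ?d $$ (s + i, s + j)"
        by (rule sandwich_entry[OF d, of _ k _ k]) (use ij s in \<open>auto simp: \<alpha>_def \<beta>_def\<close>)
      thus "scalar_sandwich V \<alpha> ?d \<beta> $$ (i, j) = z $$ (i, j)"
        using ij s zd[OF ij] matsE[OF z ij] by (simp add: \<alpha>_def \<beta>_def)
    qed (use matsD[OF z] in \<open>auto simp: scalar_sandwich_def \<alpha>_def \<beta>_def\<close>)
    hence "\<rho> z \<le> mat_opnorm \<alpha> * \<rho> ?d * mat_opnorm \<beta>"
      using op_seminormD(3)[OF \<rho> d, of \<alpha> k \<beta>] by (simp add: \<alpha>_def \<beta>_def)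
    also have "\<dots> \<le> 1 * \<rho> ?d * 1"
      using mat_seminormD(1)[OF ms d]
      by (intro mult_mono mat_opnorm_01[of \<alpha> k "m + n"] mat_opnorm_01[of \<beta> "m + n" k])
         (auto simp: \<alpha>_def \<beta>_def mat_opnorm_nonneg split: if_splits)
    finally show ?thesis by simp
  qed
  have "\<rho> x \<le> \<rho> ?d"
    by (rule key[OF x, of 0]) (use matsD[OF x] matsD[OF y] in \<open>auto simp: diag_sum_def\<close>)
  moreover have "\<rho> y \<le> \<rho> ?d"
    by (rule key[OF y, of m]) (use matsD[OF x] matsD[OF y] in \<open>auto simp: diag_sum_def\<close>)
  ultimately show ?thesis by simp
qed

text \<open>
  The norm of an entry is at most the norm of the matrix, so definiteness at the first level
  gives it at all levels.
\<close>

lemma operator_space_with_mnormI: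
  assumes \<rho>: "op_seminorm V \<rho>" and def: "\<And>v. v \<in> carrier V \<Longrightarrow> \<rho> (mat1 v) = 0 \<Longrightarrow> v = \<zero>"
  shows "operator_space (with_mnorm V \<rho>)"
proof -
  have ms: "mat_seminorm V \<rho>" using op_seminormD(1)[OF \<rho>] .
  have vs: "vectorspace class_ring (with_mnorm V \<rho>)"
    using cvs_with_mnorm[OF cvs_axioms] by (rule cvs.vectorspace)
  have z: "\<rho> x = 0 \<longleftrightarrow> x = zero_mats V n n" if x: "x \<in> mats V n n" for n x
  proof
    assume "\<rho> x = 0"
    hence "x $$ (i, j) = \<zero>" if "i < n" "j < n" for i j
      using that op_seminorm_entry_le[OF \<rho> x that] mat_seminormD(1)[OF ms mat1_mats[OF matsE[OF x that]]]
      by (intro def matsE[OF x]) auto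
    thus "x = zero_mats V n n"
      using matsD[OF x] by (intro eq_matI) (auto simp: zero_mats_def)
  qed (use mat_seminorm_zero[OF ms] in auto)
  have h: "\<rho> (map_mat (\<lambda>v. c \<odot> v) x) = cmod c * \<rho> x" if x: "x \<in> mats V n n" for n x c
  proof (cases "c = 0")
    case True
    have "map_mat (\<lambda>v. 0 \<odot> v) x = zero_mats V n n"
      using matsD[OF x] matsE[OF x] by (intro eq_matI) (auto simp: zero_mats_def)
    thus ?thesis using True mat_seminorm_zero[OF ms] by simp
  next
    case False
    let ?y = "map_mat (\<lambda>v. c \<odot> v) x"
    have "map_mat (\<lambda>v. (1/c) \<odot> v) ?y = x"
      using matsD[OF x] matsE[OF x] False by (intro eq_matI) (auto simp: smult_smult)
    hence "\<rho> x \<le> cmod (1/c) * \<rho> ?y"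
      using mat_seminormD(3)[OF ms smult_mats[OF x], of "1/c" c] by simp
    hence "cmod c * \<rho> x \<le> \<rho> ?y" using False by (simp add: norm_divide field_simps)
    thus ?thesis using mat_seminormD(3)[OF ms x, of c] by simp
  qed
  have d: "\<rho> (diag_sum V x y) = max (\<rho> x) (\<rho> y)" if "x \<in> mats V m m" "y \<in> mats V n n" for m n x y
    using op_seminormD(2)[OF \<rho> that] diag_sum_ge[OF \<rho> that] by simp
  show ?thesis
    unfolding operator_space_def
    using vs z h d mat_seminormD(1,2)[OF ms] op_seminormD(3)[OF \<rho>]
    by (simp; blast)
qed

end

lemma operator_space_cvs: "operator_space V \<Longrightarrow> cvs V"
  unfolding operator_space_def cvs_def by blast

lemma operator_space_op_seminorm: "operator_space V \<Longrightarrow> op_seminorm V (mnorm V)"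
  unfolding operator_space_def op_seminorm_def mat_seminorm_def by auto

lemma op_seminorm_with_mnorm [simp]: "op_seminorm (with_mnorm V \<sigma>) \<rho> = op_seminorm V \<rho>"
  unfolding op_seminorm_def mat_seminorm_def by simp

lemma mat_seminorm_with_mnorm [simp]: "mat_seminorm (with_mnorm V \<sigma>) \<rho> = mat_seminorm V \<rho>"
  unfolding op_seminorm_def mat_seminorm_def by simp

lemma entry_bounded_with_mnorm [simp]: "entry_bounded (with_mnorm V \<sigma>) \<rho> = entry_bounded V \<rho>"
  unfolding entry_bounded_def by simp

lemma os_structures_op_seminorm: "\<rho> \<in> os_structures E \<Longrightarrow> op_seminorm E \<rho>"
  using operator_space_op_seminorm[of "with_mnorm E \<rho>"] unfolding os_structures_def by simp

definition linear_on :: "(complex, 'v, 'm) module_scheme \<Rightarrow> ('v \<Rightarrow> complex) \<Rightarrow> bool" where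
  "linear_on V \<phi> \<longleftrightarrow> (\<forall>v\<in>carrier V. \<forall>w\<in>carrier V. \<phi> (v \<oplus>\<^bsub>V\<^esub> w) = \<phi> v + \<phi> w) \<and>
     (\<forall>v\<in>carrier V. \<forall>c. \<phi> (c \<odot>\<^bsub>V\<^esub> v) = c * \<phi> v)"

lemma linear_onD:
  assumes "linear_on V \<phi>" "v \<in> carrier V"
  shows "w \<in> carrier V \<Longrightarrow> \<phi> (v \<oplus>\<^bsub>V\<^esub> w) = \<phi> v + \<phi> w" "\<phi> (c \<odot>\<^bsub>V\<^esub> v) = c * \<phi> v"
  using assms unfolding linear_on_def by auto

lemma linear_on_with_mnorm [simp]: "linear_on (with_mnorm V \<rho>) = linear_on V"
  by (simp add: linear_on_def fun_eq_iff)

context cvs begin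

lemma linear_on_zero: "linear_on V \<phi> \<Longrightarrow> \<phi> \<zero> = 0"
  using linear_onD(2)[of V \<phi> "\<zero>" 0] by simp

lemma linear_on_minus: "linear_on V \<phi> \<Longrightarrow> x \<in> carrier V \<Longrightarrow> y \<in> carrier V \<Longrightarrow> \<phi> (x \<ominus> y) = \<phi> x - \<phi> y"
  by (simp add: minus_eq_smult linear_onD)

lemma linear_on_finsum:
  assumes "linear_on V \<phi>" "finite A" "f \<in> A \<rightarrow> carrier V"
  shows "\<phi> (finsum V f A) = (\<Sum>a\<in>A. \<phi> (f a))"
  using assms(2,3)
proof (induction A)
  case (insert a A)
  have "\<phi> (finsum V f (insert a A)) = \<phi> (f a \<oplus> finsum V f A)"
    using insert by (subst finsum_insert) auto
  also have "\<dots> = \<phi> (f a) + \<phi> (finsum V f A)"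
    using insert.prems by (intro linear_onD[OF assms(1)] finsum_closed) auto
  finally show ?case using insert by auto
qed (simp add: linear_on_zero[OF assms(1)])

end

section \<open>Norms of forms are Ruan seminorms\<close>

lemma sum_swap22:
  "(\<Sum>p\<in>P. \<Sum>q\<in>Q. \<Sum>k\<in>K. \<Sum>l\<in>L. f p q k l) = (\<Sum>k\<in>K. \<Sum>l\<in>L. \<Sum>p\<in>P. \<Sum>q\<in>Q. f p q k l)"
proof -
  have "(\<Sum>p\<in>P. \<Sum>q\<in>Q. \<Sum>k\<in>K. \<Sum>l\<in>L. f p q k l)
      = (\<Sum>z\<in>P \<times> Q. \<Sum>w\<in>K \<times> L. f (fst z) (snd z) (fst w) (snd w))"
    by (simp add: sum.cartesian_product')
  also have "\<dots> = (\<Sum>w\<in>K \<times> L. \<Sum>z\<in>P \<times> Q. f (fst z) (snd z) (fst w) (snd w))"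
    by (rule sum.swap)
  also have "\<dots> = (\<Sum>k\<in>K. \<Sum>l\<in>L. \<Sum>p\<in>P. \<Sum>q\<in>Q. f p q k l)"
    by (simp add: sum.cartesian_product')
  finally show ?thesis .
qed

lemma sum_sandwich:
  fixes \<eta> :: "'p \<Rightarrow> complex"
  shows "(\<Sum>p\<in>P. \<Sum>q\<in>Q. \<eta> p * (\<Sum>a\<in>A. \<Sum>b\<in>B. (\<alpha> p a * \<beta> b q) * X a b) * \<xi> q)
       = (\<Sum>a\<in>A. \<Sum>b\<in>B. (\<Sum>p\<in>P. \<eta> p * \<alpha> p a) * X a b * (\<Sum>q\<in>Q. \<beta> b q * \<xi> q))"
proof -
  have "(\<Sum>p\<in>P. \<Sum>q\<in>Q. \<eta> p * (\<Sum>a\<in>A. \<Sum>b\<in>B. (\<alpha> p a * \<beta> b q) * X a b) * \<xi> q)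
      = (\<Sum>p\<in>P. \<Sum>q\<in>Q. \<Sum>a\<in>A. \<Sum>b\<in>B. \<eta> p * \<alpha> p a * X a b * (\<beta> b q * \<xi> q))"
    by (simp add: sum_distrib_left sum_distrib_right mult_ac)
  also have "\<dots> = (\<Sum>a\<in>A. \<Sum>b\<in>B. \<Sum>p\<in>P. \<Sum>q\<in>Q. \<eta> p * \<alpha> p a * X a b * (\<beta> b q * \<xi> q))"
    by (rule sum_swap22)
  also have "\<dots> = (\<Sum>a\<in>A. \<Sum>b\<in>B. (\<Sum>p\<in>P. \<eta> p * \<alpha> p a) * X a b * (\<Sum>q\<in>Q. \<beta> b q * \<xi> q))"
    by (simp add: sum_product sum_distrib_left sum_distrib_right mult_ac sum.swap[of _ Q P])
  finally show ?thesis .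
qed

lemma sum_lessThan_add: "(\<Sum>i<m + n. f i) = (\<Sum>i<m. f i) + (\<Sum>i<n. f (m + i :: nat))"
  for f :: "nat \<Rightarrow> 'b::comm_monoid_add"
  by (induction n) (auto simp: add.assoc)

lemma nrm2_split:
  fixes m n :: nat
  assumes "finite K"
  shows "(nrm2 ({..<m + n} \<times> K) \<eta>)\<^sup>2 = (nrm2 ({..<m} \<times> K) \<eta>)\<^sup>2 + (nrm2 ({..<n} \<times> K) (\<lambda>(p, k). \<eta> (m + p, k)))\<^sup>2"
  using assms unfolding nrm2_power2 sum.cartesian_product' by (simp add: sum_lessThan_add)

lemma mform_alt:
  assumes "x \<in> carrier_mat n m"
  shows "mform K L \<pi> x \<eta> \<xi> = (\<Sum>k\<in>K. \<Sum>l\<in>L. \<Sum>p<n. \<Sum>q<m. \<eta> (p, k) * \<pi> k l (x $$ (p, q)) * \<xi> (q, l))"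
  using assms unfolding mform_def by (auto intro: sum_swap22)

context cvs begin

lemma mform_add:
  assumes "\<forall>k\<in>K. \<forall>l\<in>L. linear_on V (\<pi> k l)" "x \<in> mats V n m" "y \<in> mats V n m"
  shows "mform K L \<pi> (add_mats V x y) \<eta> \<xi> = mform K L \<pi> x \<eta> \<xi> + mform K L \<pi> y \<eta> \<xi>"
  using matsD[OF assms(2)] matsD[OF assms(3)]
  unfolding mform_def sum.distrib[symmetric]
  by (auto simp: add_mats_def linear_onD[OF assms(1)[rule_format]] matsE[OF assms(2)] matsE[OF assms(3)] algebra_simps intro!: sum.cong)

lemma mform_smult:
  assumes "\<forall>k\<in>K. \<forall>l\<in>L. linear_on V (\<pi> k l)" "x \<in> mats V n m"
  shows "mform K L \<pi> (map_mat (\<lambda>v. c \<odot> v) x) \<eta> \<xi> = c * mform K L \<pi> x \<eta> \<xi>"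
  using matsD[OF assms(2)]
  unfolding mform_def sum_distrib_left
  by (auto simp: linear_onD[OF assms(1)[rule_format]] matsE[OF assms(2)] algebra_simps intro!: sum.cong)

lemma mform_diag:
  assumes lin: "\<forall>k\<in>K. \<forall>l\<in>L. linear_on V (\<pi> k l)" and x: "x \<in> mats V m m" and y: "y \<in> mats V n n"
  shows "mform K L \<pi> (diag_sum V x y) \<eta> \<xi>
    = mform K L \<pi> x \<eta> \<xi> + mform K L \<pi> y (\<lambda>(p, k). \<eta> (m + p, k)) (\<lambda>(q, l). \<xi> (m + q, l))"
proof -
  have [simp]: "dim_row x = m" "dim_col x = m" "dim_row y = n" "dim_col y = n"
    using matsD[OF x] matsD[OF y] by auto
  have [simp]: "dim_row (diag_sum V x y) = m + n" "dim_col (diag_sum V x y) = m + n"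
    by (simp_all add: diag_sum_def)
  have z: "\<pi> k l \<zero> = 0" if "k \<in> K" "l \<in> L" for k l
    using linear_on_zero[OF lin[rule_format, OF that]] .
  show ?thesis
    unfolding mform_def
    by (simp add: sum_lessThan_add diag_sum_def zero_mats_def z sum.distrib)
qed

lemma mform_sandwich:
  assumes lin: "\<forall>k\<in>K. \<forall>l\<in>L. linear_on V (\<pi> k l)" and x: "x \<in> mats V r c"
    and a: "\<alpha> \<in> carrier_mat n r" "\<beta> \<in> carrier_mat c m"
  shows "mform K L \<pi> (scalar_sandwich V \<alpha> x \<beta>) \<eta> \<xi>
    = mform K L \<pi> x (\<lambda>(a, k). \<Sum>p<n. \<eta> (p, k) * \<alpha> $$ (p, a)) (\<lambda>(b, l). \<Sum>q<m. \<beta> $$ (b, q) * \<xi> (q, l))"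
proof -
  have s: "scalar_sandwich V \<alpha> x \<beta> \<in> carrier_mat n m" using matsD(1)[OF sandwich_mats[OF x a]] .
  have e: "\<pi> k l (scalar_sandwich V \<alpha> x \<beta> $$ (p, q)) = (\<Sum>a<r. \<Sum>b<c. (\<alpha> $$ (p, a) * \<beta> $$ (b, q)) * \<pi> k l (x $$ (a, b)))"
    if "p < n" "q < m" "k \<in> K" "l \<in> L" for p q k l
  proof -
    have "\<pi> k l (scalar_sandwich V \<alpha> x \<beta> $$ (p, q))
        = (\<Sum>z\<in>{..<r} \<times> {..<c}. \<pi> k l (case z of (k, l) \<Rightarrow> (\<alpha> $$ (p, k) * \<beta> $$ (l, q)) \<odot> x $$ (k, l)))"
      unfolding sandwich_index[OF x a that(1,2)]
      by (rule linear_on_finsum[OF lin[rule_format, OF that(3,4)]]) (use matsE[OF x] in auto)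
    also have "\<dots> = (\<Sum>z\<in>{..<r} \<times> {..<c}. case z of (a, b) \<Rightarrow> (\<alpha> $$ (p, a) * \<beta> $$ (b, q)) * \<pi> k l (x $$ (a, b)))"
      by (rule sum.cong[OF refl]) (use matsE[OF x] linear_onD(2)[OF lin[rule_format, OF that(3,4)]] in auto)
    finally show ?thesis by (simp add: sum.cartesian_product)
  qed
  show ?thesis
    unfolding mform_alt[OF s] mform_alt[OF matsD(1)[OF x]]
    by (rule sum.cong[OF refl], rule sum.cong[OF refl]) (simp add: e flip: sum_sandwich)
qed

text \<open>
  The form of a direct sum splits into the forms of the summands at orthogonal pieces of the two
  vectors, and the form of \<open>\<alpha> x \<beta>\<close> is the form of \<open>x\<close> at the vectors moved by \<open>\<alpha>\<close> and \<open>\<beta>\<close>.  Thus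
  the operator norm satisfies Ruan's axioms when pulled back along any linear map into matrices.
\<close>

lemma op_seminorm_fnorm:
  assumes fin: "finite K" "finite L" and lin: "\<forall>k\<in>K. \<forall>l\<in>L. linear_on V (\<pi> k l)"
  shows "op_seminorm V (fnorm K L \<pi>)"
proof -
  note nn = fnorm_nonneg[OF fin] and bd = fnorm_bound[OF fin matsD(1)]
  have tri: "fnorm K L \<pi> (add_mats V x y) \<le> fnorm K L \<pi> x + fnorm K L \<pi> y"
    if x: "x \<in> mats V n n" and y: "y \<in> mats V n n" for n x y
  proof (rule fnorm_leI)
    show "add_mats V x y \<in> carrier_mat n n" using add_mats_mats[OF x y] by (rule matsD)
    fix \<eta> \<xi>
    show "cmod (mform K L \<pi> (add_mats V x y) \<eta> \<xi>)
        \<le> (fnorm K L \<pi> x + fnorm K L \<pi> y) * nrm2 ({..<n} \<times> K) \<eta> * nrm2 ({..<n} \<times> L) \<xi>"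
      unfolding mform_add[OF lin x y] using bd[OF x, of \<pi> \<eta> \<xi>] bd[OF y, of \<pi> \<eta> \<xi>]
      by (intro order_trans[OF norm_triangle_ineq]) (simp add: algebra_simps)
  qed (simp add: nn)
  have hom: "fnorm K L \<pi> (map_mat (\<lambda>v. c \<odot> v) x) \<le> cmod c * fnorm K L \<pi> x" if x: "x \<in> mats V n n" for n x c
  proof (rule fnorm_leI)
    show "map_mat (\<lambda>v. c \<odot> v) x \<in> carrier_mat n n" using smult_mats[OF x] by (rule matsD)
    fix \<eta> \<xi>
    show "cmod (mform K L \<pi> (map_mat (\<lambda>v. c \<odot> v) x) \<eta> \<xi>)
        \<le> cmod c * fnorm K L \<pi> x * nrm2 ({..<n} \<times> K) \<eta> * nrm2 ({..<n} \<times> L) \<xi>"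
      unfolding mform_smult[OF lin x] norm_mult using mult_left_mono[OF bd[OF x, of \<pi> \<eta> \<xi>], of "cmod c"]
      by (simp add: mult_ac)
  qed (simp add: nn)
  have diag: "fnorm K L \<pi> (diag_sum V x y) \<le> max (fnorm K L \<pi> x) (fnorm K L \<pi> y)" (is "_ \<le> ?M")
    if x: "x \<in> mats V m m" and y: "y \<in> mats V n n" for m n x y
  proof (rule fnorm_leI)
    show "diag_sum V x y \<in> carrier_mat (m + n) (m + n)" using diag_sum_mats[OF x y] by (rule matsD)
    show M: "0 \<le> ?M" using nn[of \<pi> x] by simp
    fix \<eta> :: "nat \<times> 'a \<Rightarrow> complex" and \<xi> :: "nat \<times> 'b \<Rightarrow> complex"
    let ?\<eta> = "\<lambda>(p, k). \<eta> (m + p, k)" and ?\<xi> = "\<lambda>(q, l). \<xi> (m + q, l)"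
    define a1 a2 b1 b2 where "a1 = nrm2 ({..<m} \<times> K) \<eta>" and "a2 = nrm2 ({..<n} \<times> K) ?\<eta>"
      and "b1 = nrm2 ({..<m} \<times> L) \<xi>" and "b2 = nrm2 ({..<n} \<times> L) ?\<xi>"
    have nn': "0 \<le> a1" "0 \<le> a2" "0 \<le> b1" "0 \<le> b2" by (auto simp: a1_def a2_def b1_def b2_def)
    have "cmod (mform K L \<pi> (diag_sum V x y) \<eta> \<xi>) \<le> fnorm K L \<pi> x * a1 * b1 + fnorm K L \<pi> y * a2 * b2"
      unfolding mform_diag[OF lin x y] a1_def a2_def b1_def b2_def
      by (intro order_trans[OF norm_triangle_ineq] add_mono bd[OF x] bd[OF y])
    also have "\<dots> \<le> ?M * a1 * b1 + ?M * a2 * b2"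
      using nn' by (intro add_mono mult_right_mono) auto
    also have "\<dots> = ?M * (a1 * b1 + a2 * b2)" by (simp add: algebra_simps)
    also have "\<dots> \<le> ?M * (nrm2 ({..<m + n} \<times> K) \<eta> * nrm2 ({..<m + n} \<times> L) \<xi>)"
    proof (rule mult_left_mono[OF _ M], rule power2_le_imp_le)
      have "(a1 * b1 + a2 * b2)\<^sup>2 \<le> (a1\<^sup>2 + a2\<^sup>2) * (b1\<^sup>2 + b2\<^sup>2)"
        using zero_le_power2[of "a1 * b2 - a2 * b1"] by (simp add: power2_eq_square algebra_simps)
      also have "\<dots> = (nrm2 ({..<m + n} \<times> K) \<eta> * nrm2 ({..<m + n} \<times> L) \<xi>)\<^sup>2"
        unfolding power_mult_distrib nrm2_split[OF fin(1)] nrm2_split[OF fin(2)]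
        by (simp add: a1_def a2_def b1_def b2_def)
      finally show "(a1 * b1 + a2 * b2)\<^sup>2 \<le> (nrm2 ({..<m + n} \<times> K) \<eta> * nrm2 ({..<m + n} \<times> L) \<xi>)\<^sup>2" .
    qed auto
    finally show "cmod (mform K L \<pi> (diag_sum V x y) \<eta> \<xi>)
        \<le> ?M * nrm2 ({..<m + n} \<times> K) \<eta> * nrm2 ({..<m + n} \<times> L) \<xi>" by (simp add: mult_ac)
  qed
  have sand: "fnorm K L \<pi> (scalar_sandwich V \<alpha> x \<beta>) \<le> mat_opnorm \<alpha> * fnorm K L \<pi> x * mat_opnorm \<beta>"
    if x: "x \<in> mats V m m" and ab: "\<alpha> \<in> carrier_mat n m" "\<beta> \<in> carrier_mat m n" for m n x \<alpha> \<beta>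
  proof (rule fnorm_leI)
    show "scalar_sandwich V \<alpha> x \<beta> \<in> carrier_mat n n" using sandwich_mats[OF x ab] by (rule matsD)
    fix \<eta> :: "nat \<times> 'a \<Rightarrow> complex" and \<xi> :: "nat \<times> 'b \<Rightarrow> complex"
    let ?\<eta> = "\<lambda>(a, k). \<Sum>p<n. \<eta> (p, k) * \<alpha> $$ (p, a)" and ?\<xi> = "\<lambda>(b, l). \<Sum>q<n. \<beta> $$ (b, q) * \<xi> (q, l)"
    have "cmod (mform K L \<pi> (scalar_sandwich V \<alpha> x \<beta>) \<eta> \<xi>)
        \<le> fnorm K L \<pi> x * nrm2 ({..<m} \<times> K) ?\<eta> * nrm2 ({..<m} \<times> L) ?\<xi>"
      unfolding mform_sandwich[OF lin x ab] by (rule bd[OF x])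
    also have "\<dots> \<le> fnorm K L \<pi> x * (mat_opnorm \<alpha> * nrm2 ({..<n} \<times> K) \<eta>) * (mat_opnorm \<beta> * nrm2 ({..<n} \<times> L) \<xi>)"
      using nrm2_apply_mat_Times[OF ab(1) fin(1), of \<eta>] nrm2_mat_apply_Times[OF ab(2) fin(2), of \<xi>]
      by (intro mult_mono mult_left_mono) (auto simp: nn mat_opnorm_nonneg)
    finally show "cmod (mform K L \<pi> (scalar_sandwich V \<alpha> x \<beta>) \<eta> \<xi>)
        \<le> mat_opnorm \<alpha> * fnorm K L \<pi> x * mat_opnorm \<beta> * nrm2 ({..<n} \<times> K) \<eta> * nrm2 ({..<n} \<times> L) \<xi>"
      by (simp add: mult_ac)
  qed (simp add: nn mat_opnorm_nonneg)
  show ?thesis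
    unfolding op_seminorm_def mat_seminorm_def using nn tri hom diag sand by blast
qed

end

section \<open>Suprema of Ruan seminorms\<close>

lemma op_seminorm_Sup:
  assumes V: "cvs V" and ne: "S \<noteq> {}" and \<rho>: "\<And>\<rho>. \<rho> \<in> S \<Longrightarrow> op_seminorm V \<rho>"
    and bd: "\<And>n x. x \<in> mats V n n \<Longrightarrow> bdd_above ((\<lambda>\<rho>. \<rho> x) ` S)"
  shows "op_seminorm V (\<lambda>x. SUP \<rho>\<in>S. \<rho> x)"
proof -
  interpret cvs V by fact
  let ?\<sigma> = "\<lambda>x. SUP \<rho>\<in>S. \<rho> x"
  have le: "\<rho> x \<le> ?\<sigma> x" if "x \<in> mats V n n" "\<rho> \<in> S" for x n \<rho>
    using that by (intro cSUP_upper bd)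
  note ms = op_seminormD(1)[OF \<rho>]
  have nn: "0 \<le> ?\<sigma> x" if x: "x \<in> mats V n n" for x n
    using ne le[OF x] mat_seminormD(1)[OF ms x] by (metis all_not_in_conv order_trans)
  have tri: "?\<sigma> (add_mats V x y) \<le> ?\<sigma> x + ?\<sigma> y" if x: "x \<in> mats V n n" and y: "y \<in> mats V n n" for n x y
  proof (rule cSUP_least[OF ne])
    fix \<rho> assume "\<rho> \<in> S"
    thus "\<rho> (add_mats V x y) \<le> ?\<sigma> x + ?\<sigma> y"
      using mat_seminormD(2)[OF ms x y, of \<rho>] le[OF x, of \<rho>] le[OF y, of \<rho>] by simp
  qed
  have hom: "?\<sigma> (map_mat (\<lambda>v. c \<odot>\<^bsub>V\<^esub> v) x) \<le> cmod c * ?\<sigma> x" if x: "x \<in> mats V n n" for n x c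
  proof (rule cSUP_least[OF ne])
    fix \<rho> assume r: "\<rho> \<in> S"
    show "\<rho> (map_mat (\<lambda>v. c \<odot>\<^bsub>V\<^esub> v) x) \<le> cmod c * ?\<sigma> x"
      by (rule order_trans[OF mat_seminormD(3)[OF ms[OF r] x]]) (intro mult_left_mono le[OF x r] norm_ge_zero)
  qed
  have diag: "?\<sigma> (diag_sum V x y) \<le> max (?\<sigma> x) (?\<sigma> y)"
    if x: "x \<in> mats V m m" and y: "y \<in> mats V n n" for m n x y
  proof (rule cSUP_least[OF ne])
    fix \<rho> assume r: "\<rho> \<in> S"
    show "\<rho> (diag_sum V x y) \<le> max (?\<sigma> x) (?\<sigma> y)"
      by (rule order_trans[OF op_seminormD(2)[OF \<rho>[OF r] x y]]) (intro max.mono le[OF x r] le[OF y r])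
  qed
  have sand: "?\<sigma> (scalar_sandwich V \<alpha> x \<beta>) \<le> mat_opnorm \<alpha> * ?\<sigma> x * mat_opnorm \<beta>"
    if x: "x \<in> mats V m m" and ab: "\<alpha> \<in> carrier_mat n m" "\<beta> \<in> carrier_mat m n" for m n x \<alpha> \<beta>
  proof (rule cSUP_least[OF ne])
    fix \<rho> assume r: "\<rho> \<in> S"
    show "\<rho> (scalar_sandwich V \<alpha> x \<beta>) \<le> mat_opnorm \<alpha> * ?\<sigma> x * mat_opnorm \<beta>"
      by (rule order_trans[OF op_seminormD(3)[OF \<rho>[OF r] x ab]])
        (intro mult_left_mono mult_right_mono le[OF x r] mat_opnorm_nonneg)
  qed
  show ?thesis
    unfolding op_seminorm_def mat_seminorm_def using nn tri hom diag sand by blast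
qed

section \<open>Maximal structures\<close>

text \<open>
  One structure that induces the norm is enough for the supremum in \<open>max_os\<close> to run over a nonempty
  bounded set, the bound being the sum of the norms of the entries.
\<close>

locale normed_cvs = cvs E for E :: "'v normed_space" +
  assumes structures_nonempty: "os_structures E \<noteq> {}"
begin

lemma os_structures_le_entries:
  assumes "\<rho> \<in> os_structures E" "x \<in> mats E n n"
  shows "\<rho> x \<le> (\<Sum>i<n. \<Sum>j<n. vnorm E (x $$ (i, j)))"
proof -
  have "\<rho> x \<le> (\<Sum>i<n. \<Sum>j<n. \<rho> (mat1 (x $$ (i, j))))"
    using op_seminorm_entry_bounded[OF os_structures_op_seminorm[OF assms(1)]] assms(2)
    unfolding entry_bounded_def by blast
  also have "\<dots> = (\<Sum>i<n. \<Sum>j<n. vnorm E (x $$ (i, j)))"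
    using assms(1) matsE[OF assms(2)] by (intro sum.cong refl) (auto simp: os_structures_def)
  finally show ?thesis .
qed

lemma os_structures_bdd:
  assumes "x \<in> mats E n n" shows "bdd_above ((\<lambda>\<rho>. \<rho> x) ` os_structures E)"
  using os_structures_le_entries[OF _ assms] by (intro bdd_aboveI2) blast

lemma vnorm_definite:
  assumes "v \<in> carrier E" "vnorm E v = 0" shows "v = \<zero>\<^bsub>E\<^esub>"
proof -
  obtain \<rho> where \<rho>: "\<rho> \<in> os_structures E" using structures_nonempty by auto
  hence os: "operator_space (with_mnorm E \<rho>)" and "\<rho> (mat1 v) = 0"
    using assms by (auto simp: os_structures_def)
  hence "mat1 v = zero_mats E 1 1"
    using mat1_mats[OF assms(1)] unfolding operator_space_def by auto
  hence "mat1 v $$ (0, 0) = zero_mats E 1 1 $$ (0, 0)" by simp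
  thus ?thesis by (simp add: zero_mats_def)
qed

lemma os_structures_SupI:
  assumes "S \<noteq> {}" "\<And>\<rho>. \<rho> \<in> S \<Longrightarrow> op_seminorm E \<rho>"
    and "\<And>n x. x \<in> mats E n n \<Longrightarrow> bdd_above ((\<lambda>\<rho>. \<rho> x) ` S)"
    and "\<And>v. v \<in> carrier E \<Longrightarrow> (SUP \<rho>\<in>S. \<rho> (mat1 v)) = vnorm E v"
  shows "(\<lambda>x. SUP \<rho>\<in>S. \<rho> x) \<in> os_structures E"
  unfolding os_structures_def mem_Collect_eq using assms
  by (intro conjI operator_space_with_mnormI op_seminorm_Sup cvs_axioms) (auto intro: vnorm_definite)

lemma max_os_norm:
  assumes "v \<in> carrier E" shows "os_norm (max_os E) v = vnorm E v"
proof -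
  have "(SUP \<rho>\<in>os_structures E. \<rho> (mat1 v)) = (SUP \<rho>\<in>os_structures E. vnorm E v)"
    by (rule SUP_cong) (use assms in \<open>auto simp: os_structures_def\<close>)
  thus ?thesis using structures_nonempty by (simp add: os_norm_def max_os_def)
qed

lemma max_os_operator_space: "operator_space (max_os E)"
  unfolding max_os_def
proof (rule operator_space_with_mnormI)
  show "op_seminorm E (\<lambda>x. SUP \<rho>\<in>os_structures E. \<rho> x)"
    by (intro op_seminorm_Sup cvs_axioms structures_nonempty os_structures_op_seminorm os_structures_bdd)
  fix v assume v: "v \<in> carrier E" "(SUP \<rho>\<in>os_structures E. \<rho> (mat1 v)) = 0"
  thus "v = \<zero>\<^bsub>E\<^esub>" using max_os_norm[OF v(1)] by (intro vnorm_definite) (auto simp: os_norm_def max_os_def)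
qed

text \<open>
  The universal property of the maximal structure.  The larger of a given structure and of \<open>\<sigma>\<close> is
  again one of the structures over which the supremum is taken.
\<close>

lemma max_os_dominates:
  assumes \<sigma>: "op_seminorm E \<sigma>" and le: "\<And>v. v \<in> carrier E \<Longrightarrow> \<sigma> (mat1 v) \<le> vnorm E v"
    and x: "x \<in> mats E n n"
  shows "\<sigma> x \<le> mnorm (max_os E) x"
proof -
  obtain \<rho> where \<rho>: "\<rho> \<in> os_structures E" using structures_nonempty by auto
  let ?\<tau> = "\<lambda>x. SUP \<mu>\<in>{\<rho>, \<sigma>}. \<mu> x"
  have "?\<tau> \<in> os_structures E"
  proof (rule os_structures_SupI)
    fix v assume v: "v \<in> carrier E"
    show "(SUP \<mu>\<in>{\<rho>, \<sigma>}. \<mu> (mat1 v)) = vnorm E v"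
      using le[OF v] v \<rho> by (subst cSup_eq_Max) (auto simp: os_structures_def max_def)
  qed (use \<sigma> os_structures_op_seminorm[OF \<rho>] in auto)
  have "\<sigma> x \<le> ?\<tau> x" by (rule cSUP_upper) auto
  also have "\<dots> \<le> mnorm (max_os E) x"
    unfolding max_os_def using cSUP_upper[OF \<open>?\<tau> \<in> os_structures E\<close> os_structures_bdd[OF x]] by simp
  finally show ?thesis .
qed

end

section \<open>Minimal structures from norming functionals\<close>

abbreviation functional_norm :: "('v \<Rightarrow> complex) \<Rightarrow> 'v mat \<Rightarrow> real" where
  "functional_norm \<phi> \<equiv> fnorm {()} {()} (\<lambda>_ _. \<phi>)"

lemma nrm2_unit: "nrm2 (A \<times> {()}) \<eta> = nrm2 A (\<lambda>p. \<eta> (p, ()))"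
  by (simp add: L2_set_def sum.cartesian_product')

lemma nrm2_single [simp]: "nrm2 {..<Suc 0} f = cmod (f 0)"
  by (simp add: L2_set_def)

lemma mform_unit: "mform {()} {()} (\<lambda>_ _. \<phi>) x \<eta> \<xi> =
    (\<Sum>p<dim_row x. \<Sum>q<dim_col x. \<eta> (p, ()) * \<phi> (x $$ (p, q)) * \<xi> (q, ()))"
  by (simp add: mform_def)

lemma functional_norm_mat1: "functional_norm \<phi> (mat1 v) = cmod (\<phi> v)"
proof (rule antisym)
  show "functional_norm \<phi> (mat1 v) \<le> cmod (\<phi> v)"
    by (rule fnorm_leI[of _ 1 1]) (auto simp: mform_unit nrm2_unit norm_mult mult_ac)
  show "cmod (\<phi> v) \<le> functional_norm \<phi> (mat1 v)"
    using fnorm_bound[of "{()}" "{()}" "mat1 v" 1 1 "\<lambda>_ _. \<phi>" "\<lambda>_. 1" "\<lambda>_. 1"]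
    unfolding nrm2_unit by (simp add: mform_unit L2_set_def)
qed

context cvs begin

text \<open>
  Contractive functionals are completely contractive: a coefficient of \<open>(\<phi> (x\<^sub>p\<^sub>q))\<close> is the value of
  \<open>\<phi>\<close> at the \<open>1 \<times> 1\<close> compression of \<open>x\<close> by the two vectors.
\<close>

lemma functional_norm_le:
  assumes \<rho>: "op_seminorm V \<rho>" and \<phi>: "linear_on V \<phi>"
    and le: "\<And>v. v \<in> carrier V \<Longrightarrow> cmod (\<phi> v) \<le> \<rho> (mat1 v)" and x: "x \<in> mats V n n"
  shows "functional_norm \<phi> x \<le> \<rho> x"
proof (rule fnorm_leI[OF matsD(1)[OF x]])
  show nn: "0 \<le> \<rho> x" using mat_seminormD(1)[OF op_seminormD(1)[OF \<rho>] x] .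
  fix \<eta> \<xi> :: "nat \<times> unit \<Rightarrow> complex"
  define \<alpha> where "\<alpha> = mat 1 n (\<lambda>(i, p). \<eta> (p, ()))"
  define \<beta> where "\<beta> = mat n 1 (\<lambda>(q, j). \<xi> (q, ()))"
  have ab: "\<alpha> \<in> carrier_mat 1 n" "\<beta> \<in> carrier_mat n 1" by (auto simp: \<alpha>_def \<beta>_def)
  let ?s = "scalar_sandwich V \<alpha> x \<beta>"
  have s: "?s \<in> mats V 1 1" using sandwich_mats[OF x ab] .
  have s1: "mat1 (?s $$ (0, 0)) = ?s"
    using matsD[OF s] by (intro eq_matI) auto
  have "mform {()} {()} (\<lambda>_ _. \<phi>) x \<eta> \<xi> = mform {()} {()} (\<lambda>_ _. \<phi>) ?s (\<lambda>_. 1) (\<lambda>_. 1)"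
    unfolding mform_sandwich[OF _ x ab, of "{()}" "{()}" "\<lambda>_ _. \<phi>", simplified, OF \<phi>]
    unfolding mform_def using matsD[OF x] by (simp add: \<alpha>_def \<beta>_def)
  also have "\<dots> = \<phi> (?s $$ (0, 0))"
    using matsD[OF s] by (simp add: mform_unit)
  finally have "cmod (mform {()} {()} (\<lambda>_ _. \<phi>) x \<eta> \<xi>) \<le> \<rho> ?s"
    using le[OF matsE[OF s]] s1 by simp
  also have "\<dots> \<le> mat_opnorm \<alpha> * \<rho> x * mat_opnorm \<beta>"
    using op_seminormD(3)[OF \<rho> x ab] .
  also have "\<dots> \<le> nrm2 {..<n} (\<lambda>p. \<eta> (p, ())) * \<rho> x * nrm2 {..<n} (\<lambda>q. \<xi> (q, ()))"
    using nn by (intro mult_mono mat_opnorm_le_row[OF ab(1)] mat_opnorm_le_col[OF ab(2)])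
      (auto simp: \<alpha>_def \<beta>_def nrm2_power2 mat_opnorm_nonneg)
  finally show "cmod (mform {()} {()} (\<lambda>_ _. \<phi>) x \<eta> \<xi>) \<le> \<rho> x * nrm2 ({..<n} \<times> {()}) \<eta> * nrm2 ({..<n} \<times> {()}) \<xi>"
    by (simp add: nrm2_unit mult_ac)
qed

end

text \<open>
  A space normed by a family of functionals, such as the coordinates for the supremum norm.  The
  functionals embed it into the bounded functions on \<open>\<Gamma>\<close>, and this yields its minimal structure.
\<close>

locale normed_by = cvs E for E :: "'v normed_space" +
  fixes \<Gamma> :: "('v \<Rightarrow> complex) set"
  assumes nonempty: "\<Gamma> \<noteq> {}"
    and linear: "\<phi> \<in> \<Gamma> \<Longrightarrow> linear_on E \<phi>"
    and bounded: "v \<in> carrier E \<Longrightarrow> bdd_above ((\<lambda>\<phi>. cmod (\<phi> v)) ` \<Gamma>)"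
    and norming: "v \<in> carrier E \<Longrightarrow> vnorm E v = (SUP \<phi>\<in>\<Gamma>. cmod (\<phi> v))"
    and definite: "v \<in> carrier E \<Longrightarrow> vnorm E v = 0 \<Longrightarrow> v = \<zero>\<^bsub>E\<^esub>"
begin

lemma contractive: "\<phi> \<in> \<Gamma> \<Longrightarrow> v \<in> carrier E \<Longrightarrow> cmod (\<phi> v) \<le> vnorm E v"
  unfolding norming by (intro cSUP_upper bounded)

lemma functional_norm_op_seminorm: "\<phi> \<in> \<Gamma> \<Longrightarrow> op_seminorm E (functional_norm \<phi>)"
  by (intro op_seminorm_fnorm) (auto intro: linear)

lemma functional_norm_bdd:
  assumes x: "x \<in> mats E n n" shows "bdd_above ((\<lambda>\<phi>. functional_norm \<phi> x) ` \<Gamma>)"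
proof (rule bdd_aboveI2)
  fix \<phi> assume \<phi>: "\<phi> \<in> \<Gamma>"
  have "functional_norm \<phi> x \<le> (\<Sum>i<n. \<Sum>j<n. functional_norm \<phi> (mat1 (x $$ (i, j))))"
    using op_seminorm_entry_bounded[OF functional_norm_op_seminorm[OF \<phi>]] x unfolding entry_bounded_def by blast
  also have "\<dots> \<le> (\<Sum>i<n. \<Sum>j<n. vnorm E (x $$ (i, j)))"
    unfolding functional_norm_mat1 by (intro sum_mono contractive[OF \<phi>] matsE[OF x]) auto
  finally show "functional_norm \<phi> x \<le> (\<Sum>i<n. \<Sum>j<n. vnorm E (x $$ (i, j)))" .
qed

lemma functional_norms_structure: "(\<lambda>x. SUP \<phi>\<in>\<Gamma>. functional_norm \<phi> x) \<in> os_structures E"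
proof -
  have l1: "(SUP \<phi>\<in>\<Gamma>. functional_norm \<phi> (mat1 v)) = vnorm E v" if "v \<in> carrier E" for v
    unfolding functional_norm_mat1 norming[OF that] ..
  have "op_seminorm E (\<lambda>x. SUP \<rho>\<in>functional_norm ` \<Gamma>. \<rho> x)"
    by (rule op_seminorm_Sup[OF cvs_axioms])
      (use nonempty functional_norm_op_seminorm functional_norm_bdd in \<open>auto simp: image_image\<close>)
  hence "op_seminorm E (\<lambda>x. SUP \<phi>\<in>\<Gamma>. functional_norm \<phi> x)"
    by (simp add: image_image)
  thus ?thesis
    unfolding os_structures_def using l1 definite by (auto intro!: operator_space_with_mnormI)
qed

text \<open>
  Every structure lies above the norms of the single functionals, which are completely contractive
  for it.
\<close>

lemma min_os_mnorm:
  assumes x: "x \<in> mats E n n" shows "mnorm (min_os E) x = (SUP \<phi>\<in>\<Gamma>. functional_norm \<phi> x)"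
proof -
  have le: "(SUP \<phi>\<in>\<Gamma>. functional_norm \<phi> x) \<le> \<rho> x" if "\<rho> \<in> os_structures E" for \<rho>
    using that contractive
    by (intro cSUP_least nonempty functional_norm_le[OF _ _ _ x] os_structures_op_seminorm linear)
       (auto simp: os_structures_def)
  have "(INF \<rho>\<in>os_structures E. \<rho> x) = (SUP \<phi>\<in>\<Gamma>. functional_norm \<phi> x)"
    by (rule cInf_eq_minimum) (use functional_norms_structure le in auto)
  thus ?thesis by (simp add: min_os_def)
qed

sublocale normed_cvs E
  by unfold_locales (use functional_norms_structure in auto)

end

section \<open>The spaces of p-summable families\<close>

text \<open>
  Young's inequality with the conjugate exponent cleared, so that it includes \<open>p = 1\<close>.
\<close>

lemma powr_young:
  fixes s t p :: real
  assumes "s > 0" "t \<ge> 0" "p \<ge> 1"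
  shows "p * (s powr (p - 1) * t) \<le> (p - 1) * s powr p + t powr p"
proof (cases "t = 0")
  case False
  have "(s powr p) powr ((p - 1) / p) * (t powr p) powr (1 / p) \<le> (p - 1) / p * s powr p + 1 / p * t powr p"
    using assms False by (intro Youngs_inequality_0) (auto simp: field_simps)
  hence "s powr (p - 1) * t \<le> (p - 1) / p * s powr p + 1 / p * t powr p"
    using assms False by (simp add: powr_powr)
  thus ?thesis using assms by (simp add: field_simps)
qed (use assms in auto)

locale lp =
  fixes p :: real and I :: "'i set"
  assumes p1: "1 \<le> p"
begin

abbreviation "E \<equiv> lp_space p I"

lemma lp_simps: "zero E = (\<lambda>_. 0)" "add E = (\<lambda>f g i. f i + g i)" "smult E = (\<lambda>c f i. c * f i)"
  "monoid.mult E = (\<lambda>f g i. f i * g i)"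
  by (simp_all add: lp_space_def)

lemma carrier_iff: "f \<in> carrier E \<longleftrightarrow> (\<forall>i. i \<notin> I \<longrightarrow> f i = 0) \<and> (\<lambda>i. cmod (f i) powr p) summable_on I"
  by (simp add: lp_space_def)

lemma carrier_dominated:
  assumes "\<And>i. i \<notin> I \<Longrightarrow> f i = 0" "g summable_on I" "\<And>i. i \<in> I \<Longrightarrow> cmod (f i) powr p \<le> g i"
  shows "f \<in> carrier E"
  unfolding carrier_iff using assms by (auto intro: summable_on_comparison_test[OF assms(2)])

lemma cvs_lp: "cvs E"
proof (rule cvsI)
  fix f g :: "'i \<Rightarrow> complex" and c :: complex
  assume f: "f \<in> carrier E"
  have "(\<lambda>i. cmod c powr p * cmod (f i) powr p) summable_on I"
    using f by (auto simp: carrier_iff intro: summable_on_cmult_right)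
  thus "c \<odot>\<^bsub>E\<^esub> f \<in> carrier E"
    by (rule carrier_dominated[rotated]) (use f in \<open>auto simp: lp_simps carrier_iff norm_mult powr_mult\<close>)
  assume g: "g \<in> carrier E"
  have "(\<lambda>i. 2 powr p * (cmod (f i) powr p + cmod (g i) powr p)) summable_on I"
    using f g by (auto simp: carrier_iff intro!: summable_on_cmult_right summable_on_add)
  thus "f \<oplus>\<^bsub>E\<^esub> g \<in> carrier E"
  proof (rule carrier_dominated[rotated])
    fix i
    have "cmod (f i + g i) powr p \<le> (2 * max (cmod (f i)) (cmod (g i))) powr p"
      using p1 norm_triangle_ineq[of "f i" "g i"] by (intro powr_mono2) auto
    also have "\<dots> = 2 powr p * max (cmod (f i)) (cmod (g i)) powr p"
      by (simp add: powr_mult)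
    also have "\<dots> \<le> 2 powr p * (cmod (f i) powr p + cmod (g i) powr p)"
      by (intro mult_left_mono) (auto simp: max_def)
    finally show "cmod ((f \<oplus>\<^bsub>E\<^esub> g) i) powr p \<le> 2 powr p * (cmod (f i) powr p + cmod (g i) powr p)"
      by (simp add: lp_simps)
  qed (use f g in \<open>auto simp: lp_simps carrier_iff\<close>)
qed (auto simp: lp_simps carrier_iff algebra_simps)

lemma sum_le_vnorm:
  assumes "f \<in> carrier E" "finite J" "J \<subseteq> I"
  shows "(\<Sum>i\<in>J. cmod (f i) powr p) \<le> vnorm E f powr p"
proof -
  have "(\<Sum>i\<in>J. cmod (f i) powr p) \<le> (\<Sum>\<^sub>\<infinity>i\<in>I. cmod (f i) powr p)"
    using assms by (intro finite_sum_le_infsum) (auto simp: carrier_iff)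
  also have "\<dots> = vnorm E f powr p"
    using p1 by (simp add: lp_space_def powr_powr infsum_nonneg)
  finally show ?thesis .
qed

lemma vnorm_nonneg: "0 \<le> vnorm E f"
  by (simp add: lp_space_def)

lemma coord_le_vnorm:
  assumes "f \<in> carrier E" shows "cmod (f i) \<le> vnorm E f"
proof (cases "i \<in> I")
  case True
  have "cmod (f i) powr p \<le> vnorm E f powr p"
    using sum_le_vnorm[OF assms, of "{i}"] True by simp
  thus ?thesis using p1 powr_less_mono2[of p "vnorm E f" "cmod (f i)"] vnorm_nonneg[of f] by fastforce
qed (use assms vnorm_nonneg in \<open>auto simp: carrier_iff\<close>)

lemma vnorm_leI:
  assumes f: "f \<in> carrier E" and C: "0 \<le> C"
    and "\<And>J. finite J \<Longrightarrow> J \<subseteq> I \<Longrightarrow> (\<Sum>i\<in>J. cmod (f i) powr p) \<le> C powr p"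
  shows "vnorm E f \<le> C"
proof -
  have "(\<Sum>\<^sub>\<infinity>i\<in>I. cmod (f i) powr p) \<le> C powr p"
    using assms by (intro infsum_le_finite_sums) (auto simp: carrier_iff)
  hence "(\<Sum>\<^sub>\<infinity>i\<in>I. cmod (f i) powr p) powr (1 / p) \<le> (C powr p) powr (1 / p)"
    using p1 by (intro powr_mono2) (auto intro: infsum_nonneg)
  thus ?thesis using p1 C by (simp add: lp_space_def powr_powr)
qed

definition contractions :: "(('i \<Rightarrow> complex) \<Rightarrow> complex) set" where
  "contractions = {\<phi>. linear_on E \<phi> \<and> (\<forall>v\<in>carrier E. cmod (\<phi> v) \<le> vnorm E v)}"

text \<open>
  Hoelder's inequality against the extremal weights, by summing Young's inequality for the
  normalized entries.
\<close>

lemma holder_sum: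
  assumes v: "\<And>i. i \<in> J \<Longrightarrow> v i \<noteq> 0" and J: "finite J" "J \<subseteq> I"
    and M: "M > 0" "M powr p = (\<Sum>i\<in>J. cmod (v i) powr p)" and h: "h \<in> carrier E"
  shows "(\<Sum>i\<in>J. cmod (v i) powr (p - 1) * cmod (h i)) \<le> M powr (p - 1) * vnorm E h"
proof (cases "vnorm E h = 0")
  case True
  hence "h i = 0" for i using coord_le_vnorm[OF h, of i] by simp
  thus ?thesis using True by simp
next
  case False
  define N where "N = vnorm E h"
  have N: "N > 0" using False vnorm_nonneg[of h] by (simp add: N_def)
  have "p * (\<Sum>i\<in>J. (cmod (v i) / M) powr (p - 1) * (cmod (h i) / N))
      \<le> (\<Sum>i\<in>J. (p - 1) * (cmod (v i) / M) powr p + (cmod (h i) / N) powr p)"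
    unfolding sum_distrib_left using M N v p1 by (intro sum_mono powr_young) auto
  also have "\<dots> = (p - 1) * ((\<Sum>i\<in>J. cmod (v i) powr p) / M powr p) + (\<Sum>i\<in>J. cmod (h i) powr p) / N powr p"
    using M(1) N by (simp add: sum.distrib powr_divide flip: sum_divide_distrib sum_distrib_left)
  also have "\<dots> \<le> (p - 1) * 1 + 1"
    using M N sum_le_vnorm[OF h J] by (intro add_mono mult_left_mono) (auto simp: N_def p1)
  finally have "(\<Sum>i\<in>J. (cmod (v i) / M) powr (p - 1) * (cmod (h i) / N)) \<le> 1"
    using p1 by simp
  moreover have "(\<Sum>i\<in>J. (cmod (v i) / M) powr (p - 1) * (cmod (h i) / N))
      = (\<Sum>i\<in>J. cmod (v i) powr (p - 1) * cmod (h i)) / (M powr (p - 1) * N)"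
    using M N by (simp add: powr_divide sum_divide_distrib)
  ultimately show ?thesis using M N by (simp add: N_def field_simps)
qed

text \<open>
  The extremal functional of Hoelder's inequality has the weights
  \<open>g\<^sub>i = \<bar>v\<^sub>i\<bar>\<^bsup>p-1\<^esup> cnj (sgn v\<^sub>i) / M\<^bsup>p-1\<^esup>\<close>, where \<open>M\<close> is the norm of \<open>v\<close> on \<open>J\<close>.
\<close>

lemma contraction_attaining:
  assumes v: "v \<in> carrier E" and J: "finite J" "J \<subseteq> I"
  shows "\<exists>\<phi>\<in>contractions. (cmod (\<phi> v)) powr p = (\<Sum>i\<in>J. cmod (v i) powr p)"
proof -
  \<comment> \<open>Young's inequality is applied to the moduli of these entries, which have to be positive.\<close>
  define K where "K = {i\<in>J. v i \<noteq> 0}"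
  have K: "finite K" "K \<subseteq> I" and nz: "\<And>i. i \<in> K \<Longrightarrow> v i \<noteq> 0" using J by (auto simp: K_def)
  define S where "S = (\<Sum>i\<in>K. cmod (v i) powr p)"
  have S: "(\<Sum>i\<in>J. cmod (v i) powr p) = S"
    unfolding S_def using J by (intro sum.mono_neutral_right) (auto simp: K_def)
  show ?thesis
  proof (cases "K = {}")
    case True
    thus ?thesis unfolding S using v
      by (intro bexI[of _ "\<lambda>_. 0"]) (auto simp: S_def contractions_def linear_on_def vnorm_nonneg)
  next
    case False
    have S0: "S > 0" unfolding S_def using K False nz by (intro sum_pos) auto
    define M where "M = S powr (1 / p)"
    have M: "M > 0" "M powr p = S" using S0 p1 by (auto simp: M_def powr_powr)
    define g where "g i = complex_of_real (cmod (v i) powr (p - 1) / M powr (p - 1)) * cnj (sgn (v i))" for i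
    define \<phi> where "\<phi> h = (\<Sum>i\<in>K. g i * h i)" for h :: "'i \<Rightarrow> complex"
    have cg: "cmod (g i) = cmod (v i) powr (p - 1) / M powr (p - 1)" if "i \<in> K" for i
      using nz[OF that] by (simp add: g_def norm_mult norm_sgn norm_divide)
    have lin: "linear_on E \<phi>"
      by (auto simp: linear_on_def \<phi>_def lp_simps algebra_simps sum.distrib sum_distrib_left)
    have "cmod (\<phi> h) \<le> vnorm E h" if h: "h \<in> carrier E" for h
    proof -
      have "cmod (\<phi> h) \<le> (\<Sum>i\<in>K. cmod (g i) * cmod (h i))"
        unfolding \<phi>_def by (rule order_trans[OF norm_sum]) (simp add: norm_mult)
      also have "\<dots> = (\<Sum>i\<in>K. cmod (v i) powr (p - 1) * cmod (h i)) / M powr (p - 1)"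
        by (simp add: cg sum_divide_distrib)
      also have "\<dots> \<le> vnorm E h"
        using holder_sum[OF nz K M(1) _ h] M by (simp add: S_def field_simps)
      finally show ?thesis .
    qed
    hence \<phi>: "\<phi> \<in> contractions" using lin by (simp add: contractions_def)
    have "\<phi> v = (\<Sum>i\<in>K. complex_of_real (cmod (v i) powr p / M powr (p - 1)))"
      unfolding \<phi>_def
    proof (rule sum.cong[OF refl])
      fix i assume i: "i \<in> K"
      have "cnj (sgn (v i)) * v i = complex_of_real (cmod (v i))"
        using nz[OF i] by (simp add: sgn_eq complex_norm_square[symmetric] power2_eq_square mult.commute[of "cnj _"] field_simps)
      hence "g i * v i = complex_of_real (cmod (v i) powr (p - 1) / M powr (p - 1) * cmod (v i))"
        by (simp add: g_def mult.assoc)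
      also have "cmod (v i) powr (p - 1) / M powr (p - 1) * cmod (v i) = cmod (v i) powr p / M powr (p - 1)"
        using nz[OF i] powr_add[of "cmod (v i)" "p - 1" 1] by simp
      finally show "g i * v i = complex_of_real (cmod (v i) powr p / M powr (p - 1))" .
    qed
    also have "\<dots> = complex_of_real (S / M powr (p - 1))"
      by (simp add: S_def sum_divide_distrib)
    also have "S / M powr (p - 1) = M"
      using M powr_add[of M "p - 1" 1] by (simp add: M(2)[symmetric] field_simps)
    finally have "cmod (\<phi> v) powr p = S" using M by simp
    thus ?thesis using \<phi> S by auto
  qed
qed

text \<open>
  The norm is determined by finite partial sums, and each of these is attained by a contraction.
\<close>

lemma normed_by_contractions: "normed_by E contractions"
proof -
  interpret cvs E by (rule cvs_lp)
  have bd: "bdd_above ((\<lambda>\<phi>. cmod (\<phi> v)) ` contractions)" if "v \<in> carrier E" for v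
    using that by (intro bdd_aboveI2[of _ _ "vnorm E v"]) (auto simp: contractions_def)
  have z: "(\<lambda>_. 0) \<in> contractions" by (auto simp: contractions_def linear_on_def vnorm_nonneg)
  show ?thesis
  proof
    fix v assume v: "v \<in> carrier E"
    show "vnorm E v = (SUP \<phi>\<in>contractions. cmod (\<phi> v))"
    proof (rule antisym)
      show "vnorm E v \<le> (SUP \<phi>\<in>contractions. cmod (\<phi> v))"
      proof (rule vnorm_leI[OF v])
        show "0 \<le> (SUP \<phi>\<in>contractions. cmod (\<phi> v))"
          using cSUP_upper[OF z bd[OF v]] by simp
        fix J assume J: "finite J" "J \<subseteq> I"
        then obtain \<phi> where \<phi>: "\<phi> \<in> contractions" "cmod (\<phi> v) powr p = (\<Sum>i\<in>J. cmod (v i) powr p)"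
          using contraction_attaining[OF v] by blast
        show "(\<Sum>i\<in>J. cmod (v i) powr p) \<le> (SUP \<phi>\<in>contractions. cmod (\<phi> v)) powr p"
          unfolding \<phi>(2)[symmetric] using p1 cSUP_upper[OF \<phi>(1) bd[OF v]] by (intro powr_mono2) auto
      qed
      show "(SUP \<phi>\<in>contractions. cmod (\<phi> v)) \<le> vnorm E v"
        using v z by (intro cSUP_least) (auto simp: contractions_def)
    qed
  next
    fix v assume v: "v \<in> carrier E" "vnorm E v = 0"
    have "v i = 0" for i using coord_le_vnorm[OF v(1), of i] v(2) by simp
    thus "v = \<zero>\<^bsub>E\<^esub>" by (auto simp: lp_simps)
  qed (use bd z in \<open>auto simp: contractions_def\<close>)
qed

text \<open>
  After scaling to norm one every coordinate has modulus at most one, so its square is at most its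
  \<open>p\<close>-th power.
\<close>

lemma l2_le_vnorm:
  assumes p2: "p \<le> 2" and h: "h \<in> carrier E" and J: "finite J" "J \<subseteq> I"
  shows "nrm2 J h \<le> vnorm E h"
proof (cases "vnorm E h = 0")
  case True
  hence "h i = 0" for i using coord_le_vnorm[OF h, of i] by simp
  thus ?thesis using True by (simp add: L2_set_def)
next
  case False
  define N where "N = vnorm E h"
  have N: "N > 0" using False vnorm_nonneg[of h] by (simp add: N_def)
  have "(\<Sum>i\<in>J. (cmod (h i))\<^sup>2) = N\<^sup>2 * (\<Sum>i\<in>J. (cmod (h i) / N)\<^sup>2)"
    using N by (simp add: sum_distrib_left power_divide)
  also have "(\<Sum>i\<in>J. (cmod (h i) / N)\<^sup>2) \<le> (\<Sum>i\<in>J. (cmod (h i) / N) powr p)"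
  proof (rule sum_mono)
    fix i
    show "(cmod (h i) / N)\<^sup>2 \<le> (cmod (h i) / N) powr p"
    proof (cases "h i = 0")
      case False
      have "(cmod (h i) / N) powr 2 \<le> (cmod (h i) / N) powr p"
        using False N p2 coord_le_vnorm[OF h, of i] by (intro powr_mono') (auto simp: N_def)
      thus ?thesis using False N by (simp add: powr_numeral)
    qed simp
  qed
  also have "\<dots> = (\<Sum>i\<in>J. cmod (h i) powr p) / N powr p"
    using N by (simp add: powr_divide sum_divide_distrib)
  also have "\<dots> \<le> 1" using N sum_le_vnorm[OF h J] by (simp add: N_def)
  finally have "(\<Sum>i\<in>J. (cmod (h i))\<^sup>2) \<le> N\<^sup>2" using N by simp
  thus ?thesis unfolding N_def[symmetric] using N by (intro nrm2_leI) auto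
qed

end

context lp begin

lemma coord_linear: "linear_on E (\<lambda>v. v i)"
  by (auto simp: linear_on_def lp_simps)

text \<open>
  This is where \<open>p \<le> 2\<close> enters.  Restriction to finitely many coordinates is then a contraction into
  row and into column Hilbert space, hence a complete contraction on the maximal structure.
\<close>

lemma row_form_le:
  assumes p2: "p \<le> 2" and J: "finite J" "J \<subseteq> I" and x: "x \<in> mats E n n"
  shows "fnorm {()} J (\<lambda>_ i v. v i) x \<le> mnorm (max_os E) x"
    and "fnorm J {()} (\<lambda>i _ v. v i) x \<le> mnorm (max_os E) x"
proof -
  interpret normed_by E contractions by (rule normed_by_contractions)
  show "fnorm {()} J (\<lambda>_ i v. v i) x \<le> mnorm (max_os E) x"
  proof (rule max_os_dominates[OF op_seminorm_fnorm _ x])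
    fix v assume v: "v \<in> carrier E"
    show "fnorm {()} J (\<lambda>_ i v. v i) (mat1 v) \<le> vnorm E v"
    proof (rule fnorm_leI[of _ 1 1])
      fix \<eta> :: "nat \<times> unit \<Rightarrow> complex" and \<xi> :: "nat \<times> 'i \<Rightarrow> complex"
      have "mform {()} J (\<lambda>_ i v. v i) (mat1 v) \<eta> \<xi> = \<eta> (0, ()) * (\<Sum>i\<in>J. v i * \<xi> (0, i))"
        by (simp add: mform_def sum_distrib_left mult_ac)
      moreover have "cmod (\<Sum>i\<in>J. v i * \<xi> (0, i)) \<le> vnorm E v * nrm2 J (\<lambda>i. \<xi> (0, i))"
        by (rule order_trans[OF cauchy_schwarz_sum]) (intro mult_right_mono l2_le_vnorm[OF p2 v J], simp)
      moreover have "nrm2 ({..<1} \<times> {()}) \<eta> = cmod (\<eta> (0, ()))" "nrm2 ({..<1} \<times> J) \<xi> = nrm2 J (\<lambda>i. \<xi> (0, i))"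
        by (simp_all add: L2_set_def sum.cartesian_product')
      ultimately show "cmod (mform {()} J (\<lambda>_ i v. v i) (mat1 v) \<eta> \<xi>)
          \<le> vnorm E v * nrm2 ({..<1} \<times> {()}) \<eta> * nrm2 ({..<1} \<times> J) \<xi>"
        using mult_left_mono[of "cmod (\<Sum>i\<in>J. v i * \<xi> (0, i))" "vnorm E v * nrm2 J (\<lambda>i. \<xi> (0, i))" "cmod (\<eta> (0, ()))"]
        by (simp add: norm_mult mult_ac)
    qed (auto simp: vnorm_nonneg)
  qed (use J coord_linear in auto)
  show "fnorm J {()} (\<lambda>i _ v. v i) x \<le> mnorm (max_os E) x"
  proof (rule max_os_dominates[OF op_seminorm_fnorm _ x])
    fix v assume v: "v \<in> carrier E"
    show "fnorm J {()} (\<lambda>i _ v. v i) (mat1 v) \<le> vnorm E v"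
    proof (rule fnorm_leI[of _ 1 1])
      fix \<eta> :: "nat \<times> 'i \<Rightarrow> complex" and \<xi> :: "nat \<times> unit \<Rightarrow> complex"
      have "mform J {()} (\<lambda>i _ v. v i) (mat1 v) \<eta> \<xi> = \<xi> (0, ()) * (\<Sum>i\<in>J. v i * \<eta> (0, i))"
        by (simp add: mform_def sum_distrib_left mult_ac)
      moreover have "cmod (\<Sum>i\<in>J. v i * \<eta> (0, i)) \<le> vnorm E v * nrm2 J (\<lambda>i. \<eta> (0, i))"
        by (rule order_trans[OF cauchy_schwarz_sum]) (intro mult_right_mono l2_le_vnorm[OF p2 v J], simp)
      moreover have "nrm2 ({..<1} \<times> {()}) \<xi> = cmod (\<xi> (0, ()))" "nrm2 ({..<1} \<times> J) \<eta> = nrm2 J (\<lambda>i. \<eta> (0, i))"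
        by (simp_all add: L2_set_def sum.cartesian_product')
      ultimately show "cmod (mform J {()} (\<lambda>i _ v. v i) (mat1 v) \<eta> \<xi>)
          \<le> vnorm E v * nrm2 ({..<1} \<times> J) \<eta> * nrm2 ({..<1} \<times> {()}) \<xi>"
        using mult_left_mono[of "cmod (\<Sum>i\<in>J. v i * \<eta> (0, i))" "vnorm E v * nrm2 J (\<lambda>i. \<eta> (0, i))" "cmod (\<xi> (0, ()))"]
        by (simp add: norm_mult mult_ac)
    qed (auto simp: vnorm_nonneg)
  qed (use J coord_linear in auto)
qed

end

section \<open>The space of bounded families\<close>

lemma linf_simps: "zero (linf_space I) = (\<lambda>_. 0)" "add (linf_space I) = (\<lambda>f g i. f i + g i)"
  "smult (linf_space I) = (\<lambda>c f i. c * f i)" "vnorm (linf_space I) f = (SUP i. cmod (f i))"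
  by (simp_all add: linf_space_def)

lemma linf_carrier_iff: "f \<in> carrier (linf_space I) \<longleftrightarrow> (\<forall>i. i \<notin> I \<longrightarrow> f i = 0) \<and> (\<exists>C. \<forall>i. cmod (f i) \<le> C)"
  by (auto simp: linf_space_def bdd_above_def)

lemma cvs_linf: "cvs (linf_space I)"
proof (rule cvsI)
  fix f g :: "'a \<Rightarrow> complex" and c :: complex
  assume f: "f \<in> carrier (linf_space I)"
  then obtain C where C: "\<And>i. cmod (f i) \<le> C" by (auto simp: linf_carrier_iff)
  have "cmod (c * f i) \<le> cmod c * C" for i using C[of i] by (simp add: norm_mult mult_left_mono)
  thus "c \<odot>\<^bsub>linf_space I\<^esub> f \<in> carrier (linf_space I)" using f by (auto simp: linf_carrier_iff linf_simps)
  assume g: "g \<in> carrier (linf_space I)"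
  then obtain D where D: "\<And>i. cmod (g i) \<le> D" by (auto simp: linf_carrier_iff)
  have "cmod (f i + g i) \<le> C + D" for i by (rule norm_triangle_mono) (rule C D)+
  thus "f \<oplus>\<^bsub>linf_space I\<^esub> g \<in> carrier (linf_space I)" using f g by (auto simp: linf_carrier_iff linf_simps)
qed (auto simp: linf_simps linf_carrier_iff algebra_simps intro: exI[of _ 0])

lemma normed_by_coordinates: "normed_by (linf_space I) (range (\<lambda>i v. v i))"
proof -
  interpret cvs "linf_space I" by (rule cvs_linf)
  have bd: "bdd_above (range (\<lambda>i. cmod (v i)))" if "v \<in> carrier (linf_space I)" for v
    using that by (auto simp: linf_space_def)
  show ?thesis
  proof
    fix v assume v: "v \<in> carrier (linf_space I)" "vnorm (linf_space I) v = 0"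
    have "v i = 0" for i using cSUP_upper[OF _ bd[OF v(1)], of i] v(2) by (simp add: linf_simps)
    thus "v = \<zero>\<^bsub>linf_space I\<^esub>" by (auto simp: linf_simps)
  qed (use bd in \<open>auto simp: linf_simps linear_on_def image_image\<close>)
qed

lemma min_linf_bound:
  assumes x: "x \<in> mats (linf_space I) n n"
  shows "cmod (\<Sum>k<n. \<Sum>l<n. \<eta> k * (x $$ (k, l)) i * \<xi> l)
    \<le> mnorm (min_os (linf_space I)) x * nrm2 {..<n} \<eta> * nrm2 {..<n} \<xi>"
proof -
  interpret normed_by "linf_space I" "range (\<lambda>i v. v i)" by (rule normed_by_coordinates)
  let ?\<phi> = "\<lambda>v :: 'a \<Rightarrow> complex. v i"
  have "functional_norm ?\<phi> x \<le> mnorm (min_os (linf_space I)) x"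
    unfolding min_os_mnorm[OF x] by (intro cSUP_upper functional_norm_bdd[OF x]) auto
  moreover have "cmod (mform {()} {()} (\<lambda>_ _. ?\<phi>) x (\<lambda>(k, _). \<eta> k) (\<lambda>(l, _). \<xi> l)) \<le>
      functional_norm ?\<phi> x * nrm2 ({..<n} \<times> {()}) (\<lambda>(k, _). \<eta> k) * nrm2 ({..<n} \<times> {()}) (\<lambda>(l, _). \<xi> l)"
    by (rule fnorm_bound) (use matsD[OF x] in auto)
  ultimately show ?thesis
    using matsD[OF x] mult_right_mono[of "functional_norm ?\<phi> x" "mnorm (min_os (linf_space I)) x" "nrm2 {..<n} \<eta> * nrm2 {..<n} \<xi>"]
    by (simp add: mform_unit nrm2_unit mult_ac)
qed

lemma min_linf_nonneg:
  assumes x: "x \<in> mats (linf_space I) n n" shows "0 \<le> mnorm (min_os (linf_space I)) x"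
proof -
  interpret normed_by "linf_space I" "range (\<lambda>i v. v i)" by (rule normed_by_coordinates)
  have "0 \<le> functional_norm (\<lambda>v. v undefined) x" by (rule fnorm_nonneg) auto
  also have "\<dots> \<le> mnorm (min_os (linf_space I)) x"
    unfolding min_os_mnorm[OF x] by (intro cSUP_upper functional_norm_bdd[OF x]) auto
  finally show ?thesis .
qed

text \<open>
  Together with \<open>min_linf_bound\<close> this identifies the norm of \<open>x\<close> with the supremum over \<open>i\<close> of the
  operator norms of the scalar matrices \<open>(x\<^sub>k\<^sub>l(i))\<close>.
\<close>

lemma min_linf_leI:
  assumes x: "x \<in> mats (linf_space I) n n" and C: "0 \<le> C"
    and le: "\<And>i \<eta> \<xi>. cmod (\<Sum>k<n. \<Sum>l<n. \<eta> k * (x $$ (k, l)) i * \<xi> l) \<le> C * nrm2 {..<n} \<eta> * nrm2 {..<n} \<xi>"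
  shows "mnorm (min_os (linf_space I)) x \<le> C"
proof -
  interpret normed_by "linf_space I" "range (\<lambda>i v. v i)" by (rule normed_by_coordinates)
  have "functional_norm (\<lambda>v. v i) x \<le> C" for i
    by (rule fnorm_leI[of _ n n]) (use matsD[OF x] le C in \<open>auto simp: mform_unit nrm2_unit\<close>)
  thus ?thesis unfolding min_os_mnorm[OF x] by (intro cSUP_least) auto
qed

section \<open>Quotients of matrix seminormed spaces\<close>

text \<open>
  The functional that \<open>\<phi>\<close> induces on cosets when it vanishes on \<open>N\<close>.
\<close>

definition descend :: "(complex, 'v, 'm) module_scheme \<Rightarrow> 'v set \<Rightarrow> ('v \<Rightarrow> complex) \<Rightarrow> 'v set \<Rightarrow> complex" where
  "descend V N \<phi> C = \<phi> (SOME v. v \<in> carrier V \<and> N +>\<^bsub>V\<^esub> v = C)"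

locale cvs_sub = cvs V for V :: "(complex, 'v, 'm) module_scheme" (structure) +
  fixes N :: "'v set"
  assumes sub: "N \<subseteq> carrier V" and zero_in: "\<zero> \<in> N"
    and add_in: "v \<in> N \<Longrightarrow> w \<in> N \<Longrightarrow> v \<oplus> w \<in> N"
    and smult_in: "v \<in> N \<Longrightarrow> c \<odot> v \<in> N"
begin

sublocale abelian_subgroup N V
proof (rule abelian_subgroupI3)
  show "additive_subgroup N V"
  proof (rule additive_subgroupI)
    show "subgroup N (add_monoid V)"
    proof
      fix x assume x: "x \<in> N"
      hence "\<ominus> x \<in> N" using smult_in[OF x, of "-1"] sub neg_eq_smult[of x] by auto
      thus "inv\<^bsub>add_monoid V\<^esub> x \<in> N" by (simp add: a_inv_def)
    qed (use sub zero_in add_in in auto)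
  qed
qed (rule abelian_group_axioms)

abbreviation Q where "Q \<equiv> quot_module V N"
abbreviation proj where "proj v \<equiv> N +> v"

lemma quot_carrier: "carrier Q = proj ` carrier V"
  by (auto simp: quot_module_def A_RCOSETS_def')

lemma proj_closed: "v \<in> carrier V \<Longrightarrow> proj v \<in> carrier Q"
  by (simp add: quot_carrier)

lemma proj_eq_iff: "v \<in> carrier V \<Longrightarrow> w \<in> carrier V \<Longrightarrow> proj v = proj w \<longleftrightarrow> v \<ominus> w \<in> N"
  by (metis a_rcos_module a_rcos_self a_repr_independence' a_minus_def)

lemma proj_add: "v \<in> carrier V \<Longrightarrow> w \<in> carrier V \<Longrightarrow> proj v \<oplus>\<^bsub>Q\<^esub> proj w = proj (v \<oplus> w)"
  by (simp add: quot_module_def a_rcos_sum)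

lemma proj_smult:
  assumes v: "v \<in> carrier V" shows "c \<odot>\<^bsub>Q\<^esub> proj v = proj (c \<odot> v)"
proof -
  have "proj (c \<odot> x) = proj (c \<odot> v)" if "x \<in> proj v" for x
  proof -
    have x: "x \<in> carrier V" "x \<ominus> v \<in> N"
      using that v a_elemrcos_carrier[OF v that] by (auto simp: a_rcos_module a_minus_def)
    have "c \<odot> x \<ominus> c \<odot> v = c \<odot> (x \<ominus> v)"
      using x v by (simp add: minus_eq_smult smult_r_distr smult_smult mult.commute)
    thus ?thesis using x v smult_in[OF x(2)] by (simp add: proj_eq_iff)
  qed
  moreover have "v \<in> proj v" using v by (rule a_rcos_self)
  ultimately have "(\<Union>x\<in>proj v. proj (c \<odot> x)) = proj (c \<odot> v)" by (intro UN_constant_eq ballI) blast+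
  thus ?thesis by (simp add: quot_module_def)
qed

lemma proj_zero: "proj \<zero> = N" "\<zero>\<^bsub>Q\<^esub> = proj \<zero>"
  using a_coset_add_zero[OF sub] by (simp_all add: quot_module_def)

lemma cvs_quot: "cvs Q"
  by (rule cvsI)
    (auto simp: quot_carrier proj_add proj_smult proj_zero(2) a_assoc smult_l_distr smult_r_distr smult_smult l_neg
      intro: arg_cong[of _ _ proj, OF a_comm] simp flip: neg_eq_smult del: equalityI subsetI)

lemma proj_minus: "v \<in> carrier V \<Longrightarrow> w \<in> carrier V \<Longrightarrow> proj v \<ominus>\<^bsub>Q\<^esub> proj w = proj (v \<ominus> w)"
  by (simp add: cvs.minus_eq_smult[OF cvs_quot] proj_closed proj_smult proj_add minus_eq_smult)

lemma descend_proj: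
  assumes \<phi>: "linear_on V \<phi>" "\<And>v. v \<in> N \<Longrightarrow> \<phi> v = 0" and v: "v \<in> carrier V"
  shows "descend V N \<phi> (proj v) = \<phi> v"
proof -
  let ?w = "SOME w. w \<in> carrier V \<and> proj w = proj v"
  have w: "?w \<in> carrier V \<and> proj ?w = proj v" by (rule someI[of _ v]) (use v in auto)
  hence "?w \<ominus> v \<in> N" using v proj_eq_iff by blast
  hence "\<phi> (?w \<ominus> v) = 0" by (rule \<phi>(2))
  hence "\<phi> ?w - \<phi> v = 0" using linear_on_minus[OF \<phi>(1) conjunct1[OF w] v] by simp
  thus ?thesis by (simp add: descend_def)
qed

lemma descend_linear:
  assumes \<phi>: "linear_on V \<phi>" "\<And>v. v \<in> N \<Longrightarrow> \<phi> v = 0"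
  shows "linear_on Q (descend V N \<phi>)"
  unfolding linear_on_def quot_carrier
  by (auto simp: proj_add proj_smult descend_proj[OF \<phi>] linear_onD[OF \<phi>(1)])

lemma lift_mats:
  assumes "C \<in> mats Q n m" shows "\<exists>x\<in>mats V n m. map_mat proj x = C"
proof -
  have "\<exists>v. v \<in> carrier V \<and> proj v = C $$ (i, j)" if "i < n" "j < m" for i j
    using matsE[OF assms that] by (auto simp: quot_carrier)
  then obtain f where f: "\<And>i j. i < n \<Longrightarrow> j < m \<Longrightarrow> f i j \<in> carrier V \<and> proj (f i j) = C $$ (i, j)"
    by metis
  have "map_mat proj (mat n m (\<lambda>(i, j). f i j)) = C"
    using f matsD[OF assms] by (intro eq_matI) auto
  moreover have "mat n m (\<lambda>(i, j). f i j) \<in> mats V n m"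
    using f by (auto simp: mats_iff)
  ultimately show ?thesis by blast
qed

end

locale matrix_seminormed = cvs V for V :: "'v opspace" (structure) +
  assumes seminorm: "mat_seminorm V (mnorm V)"
begin

lemma mnorm_nonneg: "x \<in> mats V n n \<Longrightarrow> 0 \<le> mnorm V x"
  using mat_seminormD(1)[OF seminorm] .

lemma mnorm_add: "x \<in> mats V n n \<Longrightarrow> y \<in> mats V n n \<Longrightarrow> mnorm V (add_mats V x y) \<le> mnorm V x + mnorm V y"
  using mat_seminormD(2)[OF seminorm] .

lemma mnorm_smult: "x \<in> mats V n n \<Longrightarrow> mnorm V (map_mat (\<lambda>v. c \<odot> v) x) \<le> cmod c * mnorm V x"
  using mat_seminormD(3)[OF seminorm] .

lemma os_norm_nonneg: "v \<in> carrier V \<Longrightarrow> 0 \<le> os_norm V v"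
  unfolding os_norm_def by (rule mnorm_nonneg[OF mat1_mats])

lemma os_norm_add: "v \<in> carrier V \<Longrightarrow> w \<in> carrier V \<Longrightarrow> os_norm V (v \<oplus> w) \<le> os_norm V v + os_norm V w"
proof -
  assume vw: "v \<in> carrier V" "w \<in> carrier V"
  have "add_mats V (mat1 v) (mat1 w) = mat1 (v \<oplus> w)" by (rule eq_matI) (auto simp: add_mats_def)
  thus ?thesis using mnorm_add[OF mat1_mats mat1_mats, OF vw] by (simp add: os_norm_def)
qed

lemma os_norm_smult: "v \<in> carrier V \<Longrightarrow> os_norm V (c \<odot> v) \<le> cmod c * os_norm V v"
proof -
  assume v: "v \<in> carrier V"
  have "map_mat (\<lambda>v. c \<odot> v) (mat1 v) = mat1 (c \<odot> v)" by (rule eq_matI) auto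
  thus ?thesis using mnorm_smult[OF mat1_mats[OF v], of c] by (simp add: os_norm_def)
qed

lemma os_norm_zero: "os_norm V \<zero> = 0"
  using os_norm_smult[of \<zero> 0] os_norm_nonneg[of \<zero>] by simp

lemma os_norm_minus_commute: "v \<in> carrier V \<Longrightarrow> w \<in> carrier V \<Longrightarrow> os_norm V (v \<ominus> w) \<le> os_norm V (w \<ominus> v)"
proof -
  assume vw: "v \<in> carrier V" "w \<in> carrier V"
  have "v \<ominus> w = (-1) \<odot> (w \<ominus> v)"
    using vw by (simp add: minus_eq_smult smult_r_distr smult_smult a_comm)
  thus ?thesis using os_norm_smult[of "w \<ominus> v" "-1"] vw by simp
qed

end

locale matrix_seminormed_sub = matrix_seminormed V + cvs_sub V N for V :: "'v opspace" (structure) and N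
begin

abbreviation QO where "QO \<equiv> quot_os V N"

lemma QO_simps [simp]: "carrier QO = carrier Q" "add QO = add Q" "smult QO = smult Q" "zero QO = zero Q"
  "mats QO = mats Q" "add_mats QO = add_mats Q"
  by (simp_all add: quot_os_def)

lemma quot_mnorm_proj:
  assumes x: "x \<in> mats V n n" shows "mnorm QO (map_mat proj x) \<le> mnorm V x"
proof -
  have "Inf {mnorm V y |y. y \<in> mats V n n \<and> map_mat proj y = map_mat proj x} \<le> mnorm V x"
    using x by (intro cInf_lower bdd_belowI[of _ 0]) (auto intro: mnorm_nonneg)
  thus ?thesis using matsD[OF x] by (simp add: quot_os_def)
qed

lemma quot_mnorm_greatest:
  assumes C: "C \<in> mats Q n n" and le: "\<And>x. x \<in> mats V n n \<Longrightarrow> map_mat proj x = C \<Longrightarrow> a \<le> mnorm V x"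
  shows "a \<le> mnorm QO C"
proof -
  have "a \<le> Inf {mnorm V y |y. y \<in> mats V n n \<and> map_mat proj y = C}"
    using lift_mats[OF C] le by (intro cInf_greatest) auto
  thus ?thesis using matsD[OF C] by (simp add: quot_os_def)
qed

lemma quot_matrix_seminormed: "matrix_seminormed QO"
proof (rule matrix_seminormed.intro)
  show c: "cvs QO" unfolding quot_os_def by (intro cvs_with_mnorm cvs_quot)
  show "matrix_seminormed_axioms QO"
  proof
    have nn: "0 \<le> mnorm QO C" if "C \<in> mats Q n n" for C n
      using that by (rule quot_mnorm_greatest) (rule mnorm_nonneg)
    have tri: "mnorm QO (add_mats Q C D) \<le> mnorm QO C + mnorm QO D"
      if C: "C \<in> mats Q n n" and D: "D \<in> mats Q n n" for C D n
    proof -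
      have "mnorm QO (add_mats Q C D) - mnorm QO D \<le> mnorm QO C"
      proof (rule quot_mnorm_greatest[OF C])
        fix x assume x: "x \<in> mats V n n" "map_mat proj x = C"
        have "mnorm QO (add_mats Q C D) - mnorm V x \<le> mnorm QO D"
        proof (rule quot_mnorm_greatest[OF D])
          fix y assume y: "y \<in> mats V n n" "map_mat proj y = D"
          have "map_mat proj (add_mats V x y) = add_mats Q C D"
            using matsD[OF x(1)] matsD[OF y(1)] matsE[OF x(1)] matsE[OF y(1)] unfolding x(2)[symmetric] y(2)[symmetric]
            by (intro eq_matI) (auto simp: add_mats_def proj_add)
          thus "mnorm QO (add_mats Q C D) - mnorm V x \<le> mnorm V y"
            using quot_mnorm_proj[OF add_mats_mats[OF x(1) y(1)]] mnorm_add[OF x(1) y(1)] by simp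
        qed
        thus "mnorm QO (add_mats Q C D) - mnorm QO D \<le> mnorm V x" by simp
      qed
      thus ?thesis by simp
    qed
    have hom: "mnorm QO (map_mat (\<lambda>v. c \<odot>\<^bsub>Q\<^esub> v) C) \<le> cmod c * mnorm QO C" if C: "C \<in> mats Q n n" for C n c
    proof -
      have key: "mnorm QO (map_mat (\<lambda>v. c \<odot>\<^bsub>Q\<^esub> v) C) \<le> cmod c * mnorm V x"
        if x: "x \<in> mats V n n" "map_mat proj x = C" for x
      proof -
        have "map_mat proj (map_mat (\<lambda>v. c \<odot> v) x) = map_mat (\<lambda>v. c \<odot>\<^bsub>Q\<^esub> v) C"
          using matsD[OF x(1)] matsE[OF x(1)] unfolding x(2)[symmetric]
          by (intro eq_matI) (auto simp: proj_smult)
        thus ?thesis using quot_mnorm_proj[OF smult_mats[OF x(1)], of c] mnorm_smult[OF x(1), of c] by simp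
      qed
      show ?thesis
      proof (cases "c = 0")
        case True
        obtain x where "x \<in> mats V n n" "map_mat proj x = C" using lift_mats[OF C] by auto
        thus ?thesis using key[of x] True by simp
      next
        case False
        have "mnorm QO (map_mat (\<lambda>v. c \<odot>\<^bsub>Q\<^esub> v) C) / cmod c \<le> mnorm QO C"
          using key False by (intro quot_mnorm_greatest[OF C]) (simp add: field_simps)
        thus ?thesis using False by (simp add: field_simps)
      qed
    qed
    show "mat_seminorm QO (mnorm QO)"
      unfolding mat_seminorm_def QO_simps using nn tri hom by blast
  qed
qed

text \<open>
  A bound valid for all lifts of a matrix is valid for the infimum of their norms, so a matrix of
  functionals that vanish on \<open>N\<close> keeps its completely bounded norm on the quotient.
\<close>

lemma quot_fnorm_le:
  assumes K: "0 \<le> K" and lin: "\<And>k l. linear_on V (\<phi> k l)" and z: "\<And>k l v. v \<in> N \<Longrightarrow> \<phi> k l v = 0"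
    and le: "\<And>x. x \<in> mats V m m \<Longrightarrow> fnorm S T \<phi> x \<le> K * mnorm V x" and C: "C \<in> mats Q m m"
  shows "fnorm S T (\<lambda>k l. descend V N (\<phi> k l)) C \<le> K * mnorm QO C"
proof -
  have key: "fnorm S T (\<lambda>k l. descend V N (\<phi> k l)) C \<le> K * mnorm V x"
    if x: "x \<in> mats V m m" "map_mat proj x = C" for x
  proof -
    have "mform S T (\<lambda>k l. descend V N (\<phi> k l)) C \<eta> \<xi> = mform S T \<phi> x \<eta> \<xi>" for \<eta> \<xi>
      unfolding mform_def x(2)[symmetric] using matsD[OF x(1)] matsE[OF x(1)]
      by (auto intro!: sum.cong simp: descend_proj[OF lin z])
    hence "fnorm S T (\<lambda>k l. descend V N (\<phi> k l)) C = fnorm S T \<phi> x"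
      unfolding fnorm_def x(2)[symmetric] by simp
    thus ?thesis using le[OF x(1)] by simp
  qed
  show ?thesis
  proof (cases "K = 0")
    case True
    obtain x where "x \<in> mats V m m" "map_mat proj x = C" using lift_mats[OF C] by auto
    thus ?thesis using key[of x] True by simp
  next
    case False
    have "fnorm S T (\<lambda>k l. descend V N (\<phi> k l)) C / K \<le> mnorm QO C"
      using key False K by (intro quot_mnorm_greatest[OF C]) (simp add: field_simps)
    thus ?thesis using False K by (simp add: field_simps)
  qed
qed

lemma quot_os_norm_proj: "v \<in> carrier V \<Longrightarrow> os_norm QO (proj v) \<le> os_norm V v"
proof -
  assume v: "v \<in> carrier V"
  have "map_mat proj (mat1 v) = mat1 (proj v)" by (rule eq_matI) auto
  thus ?thesis using quot_mnorm_proj[OF mat1_mats[OF v]] by (simp add: os_norm_def)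
qed

end

section \<open>Completion\<close>

locale matrix_seminormed_entries = matrix_seminormed +
  assumes entries: "entry_bounded V (mnorm V)"
begin

abbreviation CS where "CS \<equiv> cauchy_os V"

lemma CS_simps: "zero CS = (\<lambda>k. \<zero>)" "add CS = (\<lambda>s t k. s k \<oplus> t k)" "smult CS = (\<lambda>c s k. c \<odot> s k)"
  by (simp_all add: cauchy_os_def)

lemma CS_iff: "s \<in> carrier CS \<longleftrightarrow> (\<forall>k. s k \<in> carrier V) \<and> (\<forall>e>0. \<exists>K. \<forall>k\<ge>K. \<forall>l\<ge>K. os_norm V (s k \<ominus> s l) < e)"
  by (simp add: cauchy_os_def)

lemma CS_closed: "s \<in> carrier CS \<Longrightarrow> s k \<in> carrier V"
  by (simp add: CS_iff)

lemma minus_add_minus: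
  assumes "a \<in> carrier V" "b \<in> carrier V" "c \<in> carrier V" "d \<in> carrier V"
  shows "(a \<oplus> b) \<ominus> (c \<oplus> d) = (a \<ominus> c) \<oplus> (b \<ominus> d)"
  using assms by (simp add: minus_eq_smult smult_r_distr a_ac)

lemma smult_minus_smult:
  assumes "a \<in> carrier V" "b \<in> carrier V"
  shows "c \<odot> a \<ominus> c \<odot> b = c \<odot> (a \<ominus> b)"
  using assms by (simp add: minus_eq_smult smult_r_distr smult_smult mult.commute)

lemma CS_add:
  assumes s: "s \<in> carrier CS" and t: "t \<in> carrier CS" shows "(\<lambda>k. s k \<oplus> t k) \<in> carrier CS"
  unfolding CS_iff
proof (intro conjI allI impI)
  fix e :: real assume "e > 0"
  hence e: "e / 2 > 0" by simp
  obtain K where K: "\<And>k l. k \<ge> K \<Longrightarrow> l \<ge> K \<Longrightarrow> os_norm V (s k \<ominus> s l) < e / 2" using s e unfolding CS_iff by blast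
  obtain L where L: "\<And>k l. k \<ge> L \<Longrightarrow> l \<ge> L \<Longrightarrow> os_norm V (t k \<ominus> t l) < e / 2" using t e unfolding CS_iff by blast
  show "\<exists>K. \<forall>k\<ge>K. \<forall>l\<ge>K. os_norm V (s k \<oplus> t k \<ominus> (s l \<oplus> t l)) < e"
  proof (intro exI allI impI)
    fix k l assume "k \<ge> max K L" "l \<ge> max K L"
    thus "os_norm V (s k \<oplus> t k \<ominus> (s l \<oplus> t l)) < e"
      using K[of k l] L[of k l] os_norm_add[of "s k \<ominus> s l" "t k \<ominus> t l"] s t
      by (simp add: minus_add_minus CS_closed)
  qed
qed (use s t in \<open>auto simp: CS_closed\<close>)

lemma CS_smult:
  assumes s: "s \<in> carrier CS" shows "(\<lambda>k. c \<odot> s k) \<in> carrier CS"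
  unfolding CS_iff
proof (intro conjI allI impI)
  fix e :: real assume e: "e > 0"
  have c: "cmod c + 1 > 0" by (simp add: add_nonneg_pos)
  obtain K where K: "\<And>k l. k \<ge> K \<Longrightarrow> l \<ge> K \<Longrightarrow> os_norm V (s k \<ominus> s l) < e / (cmod c + 1)"
    using s e c unfolding CS_iff by (meson divide_pos_pos)
  show "\<exists>K. \<forall>k\<ge>K. \<forall>l\<ge>K. os_norm V (c \<odot> s k \<ominus> c \<odot> s l) < e"
  proof (intro exI allI impI)
    fix k l assume kl: "k \<ge> K" "l \<ge> K"
    have "os_norm V (c \<odot> s k \<ominus> c \<odot> s l) \<le> cmod c * os_norm V (s k \<ominus> s l)"
      using s by (simp add: smult_minus_smult CS_closed os_norm_smult)
    also have "\<dots> \<le> (cmod c + 1) * os_norm V (s k \<ominus> s l)"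
      using s by (intro mult_right_mono os_norm_nonneg) (auto simp: CS_closed)
    also have "\<dots> < e" using K[OF kl] c by (simp add: field_simps)
    finally show "os_norm V (c \<odot> s k \<ominus> c \<odot> s l) < e" .
  qed
qed (use s in \<open>auto simp: CS_closed\<close>)

lemma minus_self [simp]: "v \<in> carrier V \<Longrightarrow> v \<ominus> v = \<zero>"
  by (simp add: a_minus_def r_neg)

lemma const_CS: "v \<in> carrier V \<Longrightarrow> (\<lambda>k. v) \<in> carrier CS"
  by (auto simp: CS_iff os_norm_zero)

lemma cvs_CS: "cvs CS"
  by (rule cvsI)
    (auto simp: CS_simps CS_closed CS_add CS_smult a_assoc smult_l_distr smult_r_distr smult_smult l_neg
      const_CS intro!: ext intro: a_comm simp flip: neg_eq_smult)

lemma CS_minus: "s \<in> carrier CS \<Longrightarrow> t \<in> carrier CS \<Longrightarrow> s \<ominus>\<^bsub>CS\<^esub> t = (\<lambda>k. s k \<ominus> t k)"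
  by (simp add: cvs.minus_eq_smult[OF cvs_CS] CS_simps minus_eq_smult CS_closed)

lemma mnorm_diff_le:
  assumes x: "x \<in> mats V n n" and y: "y \<in> mats V n n"
  shows "\<bar>mnorm V x - mnorm V y\<bar> \<le> (\<Sum>i<n. \<Sum>j<n. os_norm V (x $$ (i, j) \<ominus> y $$ (i, j)))"
proof -
  have one: "mnorm V x - mnorm V y \<le> (\<Sum>i<n. \<Sum>j<n. os_norm V (x $$ (i, j) \<ominus> y $$ (i, j)))"
    if x: "x \<in> mats V n n" and y: "y \<in> mats V n n" for x y
  proof -
    let ?d = "mat n n (\<lambda>ij. x $$ ij \<ominus> y $$ ij)"
    have d: "?d \<in> mats V n n" using matsE[OF x] matsE[OF y] by (auto simp: mats_iff)
    have "add_mats V ?d y = x"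
      using matsD[OF x] matsD[OF y] matsE[OF x] matsE[OF y]
      by (intro eq_matI) (auto simp: add_mats_def a_minus_def a_assoc l_neg)
    hence "mnorm V x - mnorm V y \<le> mnorm V ?d" using mnorm_add[OF d y] by simp
    also have "\<dots> \<le> (\<Sum>i<n. \<Sum>j<n. mnorm V (mat1 (?d $$ (i, j))))"
      using entries d unfolding entry_bounded_def by blast
    also have "\<dots> = (\<Sum>i<n. \<Sum>j<n. os_norm V (x $$ (i, j) \<ominus> y $$ (i, j)))"
      by (intro sum.cong refl) (auto simp: os_norm_def)
    finally show ?thesis .
  qed
  have "(\<Sum>i<n. \<Sum>j<n. os_norm V (y $$ (i, j) \<ominus> x $$ (i, j))) \<le> (\<Sum>i<n. \<Sum>j<n. os_norm V (x $$ (i, j) \<ominus> y $$ (i, j)))"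
    using matsE[OF x] matsE[OF y] by (intro sum_mono os_norm_minus_commute) auto
  thus ?thesis using one[OF x y] one[OF y x] by linarith
qed

abbreviation at_k where "at_k z k \<equiv> map_mat (\<lambda>s. s k) z"

lemma at_k_mats: "z \<in> mats CS n m \<Longrightarrow> at_k z k \<in> mats V n m"
  by (auto simp: mats_iff CS_closed)

text \<open>
  By the bound on the entries the matrix norms along a matrix of Cauchy sequences are a Cauchy
  sequence of reals, so the limit in the definition of the norm exists.
\<close>

lemma CS_mnorm_limit:
  assumes z: "z \<in> mats CS n n"
  shows "(\<lambda>k. mnorm V (at_k z k)) \<longlonglongrightarrow> mnorm CS z"
proof -
  have "Cauchy (\<lambda>k. mnorm V (at_k z k))"
  proof (rule metric_CauchyI)
    fix e :: real assume e: "e > 0"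
    define d where "d = e / (real n * real n + 1)"
    have d: "d > 0" using e by (simp add: d_def add_pos_nonneg add_nonneg_pos)
    have "\<exists>K. \<forall>k\<ge>K. \<forall>l\<ge>K. os_norm V ((z $$ (i, j)) k \<ominus> (z $$ (i, j)) l) < d" if "i < n" "j < n" for i j
      using matsE[OF z that] d unfolding CS_iff by blast
    then obtain K where K: "\<And>i j k l. i < n \<Longrightarrow> j < n \<Longrightarrow> k \<ge> K i j \<Longrightarrow> l \<ge> K i j \<Longrightarrow>
        os_norm V ((z $$ (i, j)) k \<ominus> (z $$ (i, j)) l) < d" by metis
    define M where "M = (\<Sum>i<n. \<Sum>j<n. K i j)"
    have KM: "K i j \<le> M" if "i < n" "j < n" for i j
    proof -
      have "K i j \<le> (\<Sum>j<n. K i j)" using that by (intro member_le_sum) auto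
      also have "\<dots> \<le> M" unfolding M_def using that by (intro member_le_sum) auto
      finally show ?thesis .
    qed
    show "\<exists>M. \<forall>k\<ge>M. \<forall>l\<ge>M. dist (mnorm V (at_k z k)) (mnorm V (at_k z l)) < e"
    proof (intro exI allI impI)
      fix k l assume kl: "k \<ge> M" "l \<ge> M"
      have "dist (mnorm V (at_k z k)) (mnorm V (at_k z l)) \<le>
          (\<Sum>i<n. \<Sum>j<n. os_norm V (at_k z k $$ (i, j) \<ominus> at_k z l $$ (i, j)))"
        unfolding dist_real_def by (intro mnorm_diff_le at_k_mats z)
      also have "\<dots> \<le> (\<Sum>i<n. \<Sum>j<n. d)"
        using matsD[OF z] kl by (intro sum_mono) (auto intro!: less_imp_le[OF K] intro: order_trans[OF KM])
      also have "\<dots> = real n * real n * d" by simp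
      also have "\<dots> < (real n * real n + 1) * d" using d by simp
      also have "\<dots> = e" by (simp add: d_def add_nonneg_eq_0_iff)
      finally show "dist (mnorm V (at_k z k)) (mnorm V (at_k z l)) < e" .
    qed
  qed
  hence "convergent (\<lambda>k. mnorm V (at_k z k))" by (rule Cauchy_convergent)
  thus ?thesis unfolding convergent_LIMSEQ_iff by (simp add: cauchy_os_def)
qed

lemma at_k_mat1: "at_k (mat1 s) k = mat1 (s k)"
  by (rule eq_matI) auto

lemma CS_os_norm_limit: "s \<in> carrier CS \<Longrightarrow> (\<lambda>k. os_norm V (s k)) \<longlonglongrightarrow> os_norm CS s"
  using CS_mnorm_limit[OF mat1_mats, of s] by (simp add: os_norm_def at_k_mat1[simplified])

lemma CS_matrix_seminormed: "matrix_seminormed CS"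
proof (rule matrix_seminormed.intro[OF cvs_CS])
  show "matrix_seminormed_axioms CS"
  proof
    have nn: "0 \<le> mnorm CS z" if z: "z \<in> mats CS n n" for z n
      by (rule LIMSEQ_le_const[OF CS_mnorm_limit[OF z]]) (use mnorm_nonneg[OF at_k_mats[OF z]] in auto)
    have tri: "mnorm CS (add_mats CS z w) \<le> mnorm CS z + mnorm CS w"
      if z: "z \<in> mats CS n n" and w: "w \<in> mats CS n n" for z w n
    proof (rule LIMSEQ_le)
      show "(\<lambda>k. mnorm V (at_k (add_mats CS z w) k)) \<longlonglongrightarrow> mnorm CS (add_mats CS z w)"
        by (rule CS_mnorm_limit[OF cvs.add_mats_mats[OF cvs_CS z w]])
      show "(\<lambda>k. mnorm V (at_k z k) + mnorm V (at_k w k)) \<longlonglongrightarrow> mnorm CS z + mnorm CS w"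
        by (intro tendsto_add CS_mnorm_limit[OF z] CS_mnorm_limit[OF w])
      have "at_k (add_mats CS z w) k = add_mats V (at_k z k) (at_k w k)" for k
        using matsD[OF z] matsD[OF w] by (intro eq_matI) (auto simp: add_mats_def CS_simps)
      thus "\<exists>K. \<forall>k\<ge>K. mnorm V (at_k (add_mats CS z w) k) \<le> mnorm V (at_k z k) + mnorm V (at_k w k)"
        using mnorm_add[OF at_k_mats[OF z] at_k_mats[OF w]] by simp
    qed
    have hom: "mnorm CS (map_mat (\<lambda>v. c \<odot>\<^bsub>CS\<^esub> v) z) \<le> cmod c * mnorm CS z" if z: "z \<in> mats CS n n" for z n c
    proof (rule LIMSEQ_le)
      show "(\<lambda>k. mnorm V (at_k (map_mat (\<lambda>v. c \<odot>\<^bsub>CS\<^esub> v) z) k)) \<longlonglongrightarrow> mnorm CS (map_mat (\<lambda>v. c \<odot>\<^bsub>CS\<^esub> v) z)"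
        by (rule CS_mnorm_limit[OF cvs.smult_mats[OF cvs_CS z]])
      show "(\<lambda>k. cmod c * mnorm V (at_k z k)) \<longlonglongrightarrow> cmod c * mnorm CS z"
        by (intro tendsto_mult_left CS_mnorm_limit[OF z])
      have "at_k (map_mat (\<lambda>v. c \<odot>\<^bsub>CS\<^esub> v) z) k = map_mat (\<lambda>v. c \<odot> v) (at_k z k)" for k
        using matsD[OF z] by (intro eq_matI) (auto simp: CS_simps)
      thus "\<exists>K. \<forall>k\<ge>K. mnorm V (at_k (map_mat (\<lambda>v. c \<odot>\<^bsub>CS\<^esub> v) z) k) \<le> cmod c * mnorm V (at_k z k)"
        using mnorm_smult[OF at_k_mats[OF z]] by simp
    qed
    show "mat_seminorm CS (mnorm CS)"
      unfolding mat_seminorm_def using nn tri hom by blast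
  qed
qed

lemma null_sub: "cvs_sub CS (null_seqs V)"
proof (rule cvs_sub.intro[OF cvs_CS])
  show "cvs_sub_axioms CS (null_seqs V)"
  proof
    fix s t c assume s: "s \<in> null_seqs V"
    have "(\<lambda>k. os_norm V (c \<odot> s k)) \<longlonglongrightarrow> 0"
    proof (rule tendsto_sandwich[OF _ _ tendsto_const])
      show "(\<lambda>k. cmod c * os_norm V (s k)) \<longlonglongrightarrow> 0"
        using s tendsto_mult_left[of "\<lambda>k. os_norm V (s k)" 0 _ "cmod c"] by (simp add: null_seqs_def)
    qed (use s in \<open>auto intro!: always_eventually os_norm_nonneg os_norm_smult simp: null_seqs_def CS_closed\<close>)
    thus "c \<odot>\<^bsub>CS\<^esub> s \<in> null_seqs V" using s by (auto simp: null_seqs_def CS_simps CS_smult)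
    assume t: "t \<in> null_seqs V"
    have "(\<lambda>k. os_norm V (s k \<oplus> t k)) \<longlonglongrightarrow> 0"
    proof (rule tendsto_sandwich[OF _ _ tendsto_const])
      show "(\<lambda>k. os_norm V (s k) + os_norm V (t k)) \<longlonglongrightarrow> 0"
        using s t tendsto_add[of "\<lambda>k. os_norm V (s k)" 0 _ "\<lambda>k. os_norm V (t k)" 0] by (simp add: null_seqs_def)
    qed (use s t in \<open>auto intro!: always_eventually os_norm_nonneg os_norm_add simp: null_seqs_def CS_closed\<close>)
    thus "s \<oplus>\<^bsub>CS\<^esub> t \<in> null_seqs V" using s t by (auto simp: null_seqs_def CS_simps CS_add)
  qed (auto simp: null_seqs_def CS_simps const_CS os_norm_zero)
qed

sublocale C: matrix_seminormed_sub CS "null_seqs V"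
  by (intro matrix_seminormed_sub.intro CS_matrix_seminormed null_sub)

abbreviation H where "H \<equiv> completion V"
abbreviation emb where "emb \<equiv> to_completion V"

lemma H_eq: "H = C.QO"
  by (simp add: completion_def)

sublocale H: matrix_seminormed H
  unfolding H_eq by (rule C.quot_matrix_seminormed)

lemma emb_closed: "v \<in> carrier V \<Longrightarrow> emb v \<in> carrier H"
  by (simp add: H_eq to_completion_def C.proj_closed const_CS)

lemma emb_add: "v \<in> carrier V \<Longrightarrow> w \<in> carrier V \<Longrightarrow> emb (v \<oplus> w) = emb v \<oplus>\<^bsub>H\<^esub> emb w"
  by (simp add: H_eq to_completion_def C.proj_add const_CS CS_simps)

lemma emb_smult: "v \<in> carrier V \<Longrightarrow> emb (c \<odot> v) = c \<odot>\<^bsub>H\<^esub> emb v"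
  by (simp add: H_eq to_completion_def C.proj_smult const_CS CS_simps)

lemma os_norm_emb: "v \<in> carrier V \<Longrightarrow> os_norm H (emb v) \<le> os_norm V v"
proof -
  assume v: "v \<in> carrier V"
  have "os_norm H (emb v) \<le> os_norm CS (\<lambda>k. v)"
    unfolding H_eq to_completion_def by (rule C.quot_os_norm_proj[OF const_CS[OF v]])
  also have "os_norm CS (\<lambda>k. v) = os_norm V v"
    by (rule LIMSEQ_unique[OF CS_os_norm_limit[OF const_CS[OF v]]]) simp
  finally show ?thesis .
qed

text \<open>
  The class of a Cauchy sequence is approximated by its own terms.
\<close>

lemma emb_dense:
  assumes h: "h \<in> carrier H" and e: "e > 0"
  shows "\<exists>v\<in>carrier V. os_norm H (h \<ominus>\<^bsub>H\<^esub> emb v) \<le> e"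
proof -
  obtain s where s: "s \<in> carrier CS" "h = C.proj s"
    using h by (auto simp: H_eq C.quot_carrier)
  obtain K where K: "\<And>k l. k \<ge> K \<Longrightarrow> l \<ge> K \<Longrightarrow> os_norm V (s k \<ominus> s l) < e" using s e unfolding CS_iff by blast
  have c: "(\<lambda>k. s K) \<in> carrier CS" using s(1) by (simp add: const_CS CS_closed)
  have "h \<ominus>\<^bsub>H\<^esub> emb (s K) = h \<ominus>\<^bsub>C.Q\<^esub> emb (s K)"
    using h c by (simp add: H.minus_eq_smult cvs.minus_eq_smult[OF C.cvs_quot] emb_closed s(1) CS_closed)
       (simp add: H_eq to_completion_def cvs.minus_eq_smult[OF C.cvs_quot] C.proj_closed)
  also have "\<dots> = C.proj (s \<ominus>\<^bsub>CS\<^esub> (\<lambda>k. s K))"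
    using C.proj_minus[OF s(1) c] s(2) by (simp add: to_completion_def)
  finally have "os_norm H (h \<ominus>\<^bsub>H\<^esub> emb (s K)) \<le> os_norm CS (s \<ominus>\<^bsub>CS\<^esub> (\<lambda>k. s K))"
    using C.quot_os_norm_proj[of "s \<ominus>\<^bsub>CS\<^esub> (\<lambda>k. s K)"] s(1) c by (simp add: H_eq)
  also have "\<dots> \<le> e"
  proof (rule LIMSEQ_le_const2[OF CS_os_norm_limit])
    show "s \<ominus>\<^bsub>CS\<^esub> (\<lambda>k. s K) \<in> carrier CS" using s(1) c by simp
    show "\<exists>M. \<forall>k\<ge>M. os_norm V ((s \<ominus>\<^bsub>CS\<^esub> (\<lambda>k. s K)) k) \<le> e"
      using K by (intro exI[of _ K]) (auto simp: CS_minus[OF s(1) c] intro: less_imp_le)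
  qed
  finally show ?thesis using s(1) by (intro bexI[of _ "s K"]) (auto simp: CS_closed)
qed

text \<open>
  Extension of a bounded functional by continuity.
\<close>

definition extend :: "('a \<Rightarrow> complex) \<Rightarrow> (nat \<Rightarrow> 'a) set \<Rightarrow> complex" where
  "extend \<phi> = descend CS (null_seqs V) (\<lambda>s. lim (\<lambda>k. \<phi> (s k)))"

context
  fixes \<phi> :: "'a \<Rightarrow> complex" and K :: real
  assumes lin: "linear_on V \<phi>" and bd: "\<And>v. v \<in> carrier V \<Longrightarrow> cmod (\<phi> v) \<le> K * os_norm V v"
begin

lemma lim_functional:
  assumes s: "s \<in> carrier CS" shows "(\<lambda>k. \<phi> (s k)) \<longlonglongrightarrow> lim (\<lambda>k. \<phi> (s k))"
proof -
  have "Cauchy (\<lambda>k. \<phi> (s k))"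
  proof (rule metric_CauchyI)
    fix e :: real assume e: "e > 0"
    have c: "\<bar>K\<bar> + 1 > 0" by simp
    obtain M where M: "\<And>k l. k \<ge> M \<Longrightarrow> l \<ge> M \<Longrightarrow> os_norm V (s k \<ominus> s l) < e / (\<bar>K\<bar> + 1)"
      using s e c unfolding CS_iff by (meson divide_pos_pos)
    show "\<exists>M. \<forall>k\<ge>M. \<forall>l\<ge>M. dist (\<phi> (s k)) (\<phi> (s l)) < e"
    proof (intro exI allI impI)
      fix k l assume kl: "k \<ge> M" "l \<ge> M"
      have "dist (\<phi> (s k)) (\<phi> (s l)) = cmod (\<phi> (s k \<ominus> s l))"
        using s by (simp add: dist_norm linear_on_minus[OF lin] CS_closed)
      also have "\<dots> \<le> K * os_norm V (s k \<ominus> s l)" using s by (intro bd) (simp add: CS_closed)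
      also have "\<dots> \<le> (\<bar>K\<bar> + 1) * os_norm V (s k \<ominus> s l)"
        using s by (intro mult_right_mono os_norm_nonneg) (auto simp: CS_closed)
      also have "\<dots> < e" using M[OF kl] c by (simp add: field_simps)
      finally show "dist (\<phi> (s k)) (\<phi> (s l)) < e" .
    qed
  qed
  thus ?thesis using Cauchy_convergent convergent_LIMSEQ_iff by blast
qed

lemma lim_functional_linear: "linear_on CS (\<lambda>s. lim (\<lambda>k. \<phi> (s k)))"
proof -
  have "lim (\<lambda>k. \<phi> (s k \<oplus> t k)) = lim (\<lambda>k. \<phi> (s k)) + lim (\<lambda>k. \<phi> (t k))"
    if "s \<in> carrier CS" "t \<in> carrier CS" for s t
    using that by (intro limI) (auto simp: linear_onD[OF lin] CS_closed intro!: tendsto_add lim_functional)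
  moreover have "lim (\<lambda>k. \<phi> (c \<odot> s k)) = c * lim (\<lambda>k. \<phi> (s k))"
    if "s \<in> carrier CS" for s c
    using that by (intro limI) (auto simp: linear_onD[OF lin] CS_closed intro!: tendsto_mult_left lim_functional)
  ultimately show ?thesis by (simp add: linear_on_def CS_simps)
qed

lemma lim_functional_null: "s \<in> null_seqs V \<Longrightarrow> lim (\<lambda>k. \<phi> (s k)) = 0"
proof (rule limI)
  assume "s \<in> null_seqs V"
  hence s: "s \<in> carrier CS" and z: "(\<lambda>k. os_norm V (s k)) \<longlonglongrightarrow> 0"
    unfolding null_seqs_def by blast+
  show "(\<lambda>k. \<phi> (s k)) \<longlonglongrightarrow> 0"
  proof (rule tendsto_norm_zero_cancel, rule tendsto_sandwich[OF _ _ tendsto_const])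
    show "\<forall>\<^sub>F k in sequentially. cmod (\<phi> (s k)) \<le> K * os_norm V (s k)"
      by (intro always_eventually allI bd CS_closed s)
    show "(\<lambda>k. K * os_norm V (s k)) \<longlonglongrightarrow> 0"
      using tendsto_mult_left[OF z, of K] by simp
    show "\<forall>\<^sub>F k in sequentially. 0 \<le> cmod (\<phi> (s k))" by simp
  qed
qed

lemma extend_linear: "linear_on H (extend \<phi>)"
  unfolding extend_def H_eq
  using C.descend_linear[OF lim_functional_linear lim_functional_null] by (simp add: linear_on_def)

lemma extend_emb: "v \<in> carrier V \<Longrightarrow> extend \<phi> (emb v) = \<phi> v"
  unfolding extend_def to_completion_def
  by (subst C.descend_proj[OF lim_functional_linear lim_functional_null]) (auto simp: const_CS)

end

text \<open>
  A form is a finite sum of values of the functionals, so it is the limit of the forms along the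
  Cauchy sequences, and the matrix norms converge as well.
\<close>

lemma extend_fnorm_le:
  assumes fin: "finite S" "finite T" and K: "0 \<le> K" and lin: "\<And>k l. linear_on V (\<phi> k l)" 
    and bd: "\<And>k l v. v \<in> carrier V \<Longrightarrow> cmod (\<phi> k l v) \<le> B k l * os_norm V v"
    and le: "\<And>x. x \<in> mats V m m \<Longrightarrow> fnorm S T \<phi> x \<le> K * mnorm V x" and C: "C \<in> mats H m m"
  shows "fnorm S T (\<lambda>k l. extend (\<phi> k l)) C \<le> K * mnorm H C"
  unfolding extend_def H_eq
proof (rule C.quot_fnorm_le[OF K])
  show "linear_on CS (\<lambda>s. lim (\<lambda>n. \<phi> k l (s n)))" for k l
    by (rule lim_functional_linear[OF lin bd])
  show "lim (\<lambda>n. \<phi> k l (s n)) = 0" if "s \<in> null_seqs V" for k l s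
    by (rule lim_functional_null[OF lin bd that])
  show "C \<in> mats C.Q m m" using C by (simp add: H_eq)
  fix z assume z: "z \<in> mats CS m m"
  show "fnorm S T (\<lambda>k l s. lim (\<lambda>n. \<phi> k l (s n))) z \<le> K * mnorm CS z"
  proof (rule fnorm_leI[OF matsD(1)[OF z]])
    show "0 \<le> K * mnorm CS z" using K C.mnorm_nonneg[OF z] by simp
    fix \<eta> \<xi>
    show "cmod (mform S T (\<lambda>k l s. lim (\<lambda>n. \<phi> k l (s n))) z \<eta> \<xi>)
        \<le> K * mnorm CS z * nrm2 ({..<m} \<times> S) \<eta> * nrm2 ({..<m} \<times> T) \<xi>"
    proof (rule LIMSEQ_le)
      have "(\<lambda>n. mform S T \<phi> (at_k z n) \<eta> \<xi>) \<longlonglongrightarrow> mform S T (\<lambda>k l s. lim (\<lambda>n. \<phi> k l (s n))) z \<eta> \<xi>"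
        unfolding mform_def using matsD[OF z] matsE[OF z]
        by (auto intro!: tendsto_sum tendsto_mult tendsto_const lim_functional[OF lin bd])
      thus "(\<lambda>n. cmod (mform S T \<phi> (at_k z n) \<eta> \<xi>)) \<longlonglongrightarrow> cmod (mform S T (\<lambda>k l s. lim (\<lambda>n. \<phi> k l (s n))) z \<eta> \<xi>)"
        by (rule tendsto_norm)
      show "(\<lambda>n. K * mnorm V (at_k z n) * nrm2 ({..<m} \<times> S) \<eta> * nrm2 ({..<m} \<times> T) \<xi>)
          \<longlonglongrightarrow> K * mnorm CS z * nrm2 ({..<m} \<times> S) \<eta> * nrm2 ({..<m} \<times> T) \<xi>"
        by (intro tendsto_mult tendsto_const CS_mnorm_limit[OF z])
      have "cmod (mform S T \<phi> (at_k z n) \<eta> \<xi>) \<le> K * mnorm V (at_k z n) * nrm2 ({..<m} \<times> S) \<eta> * nrm2 ({..<m} \<times> T) \<xi>" for n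
        by (rule order_trans[OF fnorm_bound[OF fin matsD(1)[OF at_k_mats[OF z]]]])
           (intro mult_right_mono le at_k_mats z L2_set_nonneg)
      thus "\<exists>N. \<forall>n\<ge>N. cmod (mform S T \<phi> (at_k z n) \<eta> \<xi>) \<le> K * mnorm V (at_k z n) * nrm2 ({..<m} \<times> S) \<eta> * nrm2 ({..<m} \<times> T) \<xi>"
        by blast
    qed
  qed
qed

end

section \<open>Spans and closed spans\<close>

context cvs begin

lemma lin_span_submodule: "S \<subseteq> carrier V \<Longrightarrow> submodule class_ring (lin_span V S) V"
  by (rule LinearCombinations.module.span_is_submodule[OF is_module])

lemma lin_span_cvs_sub: "S \<subseteq> carrier V \<Longrightarrow> cvs_sub V (lin_span V S)"
  using lin_span_submodule[of S] unfolding submodule_def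
  by (intro cvs_sub.intro cvs_axioms cvs_sub_axioms.intro) auto

lemma subset_lin_span: "S \<subseteq> carrier V \<Longrightarrow> S \<subseteq> lin_span V S"
  by (rule LinearCombinations.module.in_own_span[OF is_module])

lemma linear_on_lin_span:
  assumes \<phi>: "linear_on V \<phi>" and S: "S \<subseteq> carrier V" "\<And>v. v \<in> S \<Longrightarrow> \<phi> v = 0" and v: "v \<in> lin_span V S"
  shows "\<phi> v = 0"
proof -
  have "submodule class_ring {v \<in> carrier V. \<phi> v = 0} V"
    by (auto simp: submodule_def is_module linear_onD[OF \<phi>] linear_on_zero[OF \<phi>])
  hence "lin_span V S \<subseteq> {v \<in> carrier V. \<phi> v = 0}"
    using S by (intro LinearCombinations.module.span_is_subset[OF is_module]) auto
  thus ?thesis using v by auto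
qed

end

context matrix_seminormed begin

lemma closed_span_cvs_sub:
  assumes S: "S \<subseteq> carrier V" shows "cvs_sub V (closed_span V S)"
proof -
  interpret L: cvs_sub V "lin_span V S" by (rule lin_span_cvs_sub[OF S])
  show ?thesis
  proof
    show "\<zero> \<in> closed_span V S"
      unfolding closed_span_def using L.zero_in by (auto intro!: bexI[of _ "\<zero>"] simp: minus_eq_smult os_norm_zero)
    fix v assume v: "v \<in> closed_span V S"
    hence vc: "v \<in> carrier V" by (simp add: closed_span_def)
    show "c \<odot> v \<in> closed_span V S" for c
      unfolding closed_span_def mem_Collect_eq
    proof (intro conjI allI impI)
      fix e :: real assume "e > 0"
      moreover have c: "cmod c + 1 > 0" by (simp add: add_nonneg_pos)
      ultimately obtain w where w: "w \<in> lin_span V S" "os_norm V (v \<ominus> w) < e / (cmod c + 1)"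
        using v unfolding closed_span_def mem_Collect_eq by (meson divide_pos_pos)
      have wc: "w \<in> carrier V" using w L.sub by auto
      have "c \<odot> v \<ominus> c \<odot> w = c \<odot> (v \<ominus> w)"
        using vc wc by (simp add: minus_eq_smult smult_r_distr smult_smult mult.commute)
      hence "os_norm V (c \<odot> v \<ominus> c \<odot> w) \<le> cmod c * os_norm V (v \<ominus> w)"
        using os_norm_smult vc wc by simp
      also have "\<dots> \<le> (cmod c + 1) * os_norm V (v \<ominus> w)"
        using vc wc by (intro mult_right_mono os_norm_nonneg) auto
      also have "\<dots> < e" using w(2) c by (simp add: field_simps)
      finally show "\<exists>w\<in>lin_span V S. os_norm V (c \<odot> v \<ominus> w) < e"
        using L.smult_in[OF w(1)] by blast
    qed (use vc in simp)
    fix w assume w: "w \<in> closed_span V S"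
    hence wc: "w \<in> carrier V" by (simp add: closed_span_def)
    show "v \<oplus> w \<in> closed_span V S"
      unfolding closed_span_def mem_Collect_eq
    proof (intro conjI allI impI)
      fix e :: real assume "e > 0"
      hence e: "e / 2 > 0" by simp
      obtain v' where v': "v' \<in> lin_span V S" "os_norm V (v \<ominus> v') < e / 2"
        using v e unfolding closed_span_def mem_Collect_eq by blast
      obtain w' where w': "w' \<in> lin_span V S" "os_norm V (w \<ominus> w') < e / 2"
        using w e unfolding closed_span_def mem_Collect_eq by blast
      have c: "v' \<in> carrier V" "w' \<in> carrier V" using v' w' L.sub by auto
      have "v \<oplus> w \<ominus> (v' \<oplus> w') = (v \<ominus> v') \<oplus> (w \<ominus> w')"
        using vc wc c by (simp add: minus_eq_smult smult_r_distr a_ac)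
      hence "os_norm V (v \<oplus> w \<ominus> (v' \<oplus> w')) < e"
        using os_norm_add[of "v \<ominus> v'" "w \<ominus> w'"] v'(2) w'(2) vc wc c by simp
      thus "\<exists>u\<in>lin_span V S. os_norm V (v \<oplus> w \<ominus> u) < e"
        using L.add_in[OF v'(1) w'(1)] by blast
    qed (use vc wc in simp)
  qed (auto simp: closed_span_def)
qed

lemma subset_closed_span: "S \<subseteq> carrier V \<Longrightarrow> S \<subseteq> closed_span V S"
  using subset_lin_span[of S]
  by (auto simp: closed_span_def a_minus_def r_neg os_norm_zero intro!: bexI)

text \<open>
  Up to a small error the value at \<open>v\<close> is the value at an element of the linear span.
\<close>

lemma linear_on_closed_span:
  assumes \<phi>: "linear_on V \<phi>" and bd: "\<And>v. v \<in> carrier V \<Longrightarrow> cmod (\<phi> v) \<le> K * os_norm V v"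
    and S: "S \<subseteq> carrier V" "\<And>v. v \<in> S \<Longrightarrow> \<phi> v = 0" and v: "v \<in> closed_span V S"
  shows "\<phi> v = 0"
proof -
  have vc: "v \<in> carrier V" using v by (simp add: closed_span_def)
  have "cmod (\<phi> v) \<le> e" if e: "e > 0" for e
  proof -
    have c: "\<bar>K\<bar> + 1 > 0" by simp
    obtain w where w: "w \<in> lin_span V S" "os_norm V (v \<ominus> w) < e / (\<bar>K\<bar> + 1)"
      using v e c unfolding closed_span_def mem_Collect_eq by (meson divide_pos_pos)
    have wc: "w \<in> carrier V" using w(1) cvs_sub.sub[OF lin_span_cvs_sub[OF S(1)]] by auto
    have "\<phi> v = \<phi> (v \<ominus> w)"
      using linear_on_minus[OF \<phi> vc wc] linear_on_lin_span[OF \<phi> S w(1)] by simp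
    hence "cmod (\<phi> v) \<le> K * os_norm V (v \<ominus> w)" using bd vc wc by simp
    also have "\<dots> \<le> (\<bar>K\<bar> + 1) * os_norm V (v \<ominus> w)"
      using vc wc by (intro mult_right_mono os_norm_nonneg) auto
    also have "\<dots> \<le> e" using w(2) c by (simp add: field_simps)
    finally show ?thesis .
  qed
  hence "cmod (\<phi> v) \<le> 0" by (rule field_le_epsilon) simp
  thus ?thesis by simp
qed

end

section \<open>The algebraic tensor product\<close>

lemma lookup_scale: "Poly_Mapping.lookup (Poly_Mapping.map ((*) c) f) k = c * Poly_Mapping.lookup f k" for c :: complex
  by (simp add: Poly_Mapping.map.rep_eq when_def)

lemma free_simps: "zero (free_module S) = 0" "add (free_module S) = (+)" "smult (free_module S) = (\<lambda>c. Poly_Mapping.map ((*) c))"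
  "f \<in> carrier (free_module S) \<longleftrightarrow> Poly_Mapping.keys f \<subseteq> S"
  by (simp_all add: free_module_def)

lemma free_closed:
  fixes f g :: "'s \<Rightarrow>\<^sub>0 complex"
  assumes "Poly_Mapping.keys f \<subseteq> S"
  shows "Poly_Mapping.keys g \<subseteq> S \<Longrightarrow> Poly_Mapping.keys (f + g) \<subseteq> S"
    and "Poly_Mapping.keys g \<subseteq> S \<Longrightarrow> Poly_Mapping.keys (f - g) \<subseteq> S"
    and "Poly_Mapping.keys (Poly_Mapping.map ((*) c) f) \<subseteq> S"
  using assms Poly_Mapping.keys_add[of f g] keys_diff[of f g]
  by (auto simp: Poly_Mapping.in_keys_iff lookup_scale subset_iff)

lemma cvs_free: "cvs (free_module S)"
  by (rule cvsI)
    (simp_all add: free_simps free_closed poly_mapping_eq_iff lookup_scale lookup_add fun_eq_iff algebra_simps)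

lemma free_minus: 
  assumes "f \<in> carrier (free_module S)" "g \<in> carrier (free_module S)"
  shows "f \<ominus>\<^bsub>free_module S\<^esub> g = f - g"
  unfolding cvs.minus_eq_smult[OF cvs_free assms]
  by (simp add: free_simps poly_mapping_eq_iff lookup_scale lookup_add lookup_minus fun_eq_iff)

definition lin_ext :: "('s \<Rightarrow> complex) \<Rightarrow> ('s \<Rightarrow>\<^sub>0 complex) \<Rightarrow> complex" where
  "lin_ext \<beta> f = (\<Sum>s\<in>Poly_Mapping.keys f. Poly_Mapping.lookup f s * \<beta> s)"

lemma lin_ext_superset: "finite A \<Longrightarrow> Poly_Mapping.keys f \<subseteq> A \<Longrightarrow> lin_ext \<beta> f = (\<Sum>s\<in>A. Poly_Mapping.lookup f s * \<beta> s)"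
  unfolding lin_ext_def by (rule sum.mono_neutral_left) (auto simp: Poly_Mapping.in_keys_iff)

lemma lin_ext_add: "lin_ext \<beta> (f + g) = lin_ext \<beta> f + lin_ext \<beta> g"
proof -
  let ?A = "Poly_Mapping.keys f \<union> Poly_Mapping.keys g"
  have "lin_ext \<beta> (f + g) = (\<Sum>s\<in>?A. Poly_Mapping.lookup (f + g) s * \<beta> s)"
    using Poly_Mapping.keys_add[of f g] by (intro lin_ext_superset) auto
  thus ?thesis by (simp add: lin_ext_superset[of ?A] lookup_add algebra_simps sum.distrib)
qed

lemma lin_ext_diff: "lin_ext \<beta> (f - g) = lin_ext \<beta> f - lin_ext \<beta> g"
  using lin_ext_add[of \<beta> "f - g" g] by simp

lemma lin_ext_single: "lin_ext \<beta> (Poly_Mapping.single s c) = c * \<beta> s"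
  by (simp add: lin_ext_def)

lemma lin_ext_linear: "linear_on (free_module S) (lin_ext \<beta>)"
proof -
  have "lin_ext \<beta> (Poly_Mapping.map ((*) c) f) = c * lin_ext \<beta> f" for c f
  proof -
    have "lin_ext \<beta> (Poly_Mapping.map ((*) c) f) = (\<Sum>s\<in>Poly_Mapping.keys f. Poly_Mapping.lookup (Poly_Mapping.map ((*) c) f) s * \<beta> s)"
      by (rule lin_ext_superset) (auto simp: Poly_Mapping.in_keys_iff lookup_scale)
    thus ?thesis by (simp add: lin_ext_def lookup_scale sum_distrib_left mult.assoc)
  qed
  thus ?thesis by (simp add: linear_on_def free_simps lin_ext_add)
qed

locale tensor = V: cvs V + W: cvs W
  for V :: "(complex, 'v, 'm) module_scheme" and W :: "(complex, 'w, 'k) module_scheme"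
begin

abbreviation F where "F \<equiv> free_module (carrier V \<times> carrier W)"
abbreviation T where "T \<equiv> tensor_module V W"
abbreviation pure where "pure \<equiv> pure_tensor V W"

lemma bilinear_rels_subset: "bilinear_rels V W \<subseteq> carrier F"
proof
  fix f assume f: "f \<in> bilinear_rels V W"
  show "f \<in> carrier F"
    using f unfolding bilinear_rels_def
    by (elim UnE CollectE exE conjE) (simp_all add: free_simps free_closed)
qed

lemma bilinear_relsI:
  assumes "v \<in> carrier V" "w \<in> carrier W"
  shows "v' \<in> carrier V \<Longrightarrow> Poly_Mapping.single (v \<oplus>\<^bsub>V\<^esub> v', w) 1
      - (Poly_Mapping.single (v, w) 1 + Poly_Mapping.single (v', w) 1) \<in> bilinear_rels V W"
    and "Poly_Mapping.single (c \<odot>\<^bsub>V\<^esub> v, w) 1 - Poly_Mapping.single (v, w) c \<in> bilinear_rels V W"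
    and "Poly_Mapping.single (v, c \<odot>\<^bsub>W\<^esub> w) 1 - Poly_Mapping.single (v, w) c \<in> bilinear_rels V W"
  using assms unfolding bilinear_rels_def diff_diff_add[symmetric] by blast+

sublocale R: cvs_sub F "tensor_rels V W"
  unfolding tensor_rels_def by (rule cvs.lin_span_cvs_sub[OF cvs_free bilinear_rels_subset])

lemma T_eq: "T = R.Q" by (simp add: tensor_module_def)

sublocale T: cvs T unfolding T_eq by (rule R.cvs_quot)

lemma rel_in: "f \<in> bilinear_rels V W \<Longrightarrow> f \<in> tensor_rels V W"
  unfolding tensor_rels_def using cvs.subset_lin_span[OF cvs_free bilinear_rels_subset] by blast

lemma single_F: "v \<in> carrier V \<Longrightarrow> w \<in> carrier W \<Longrightarrow> Poly_Mapping.single (v, w) c \<in> carrier F"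
  by (simp add: free_simps)

lemma pure_closed: "v \<in> carrier V \<Longrightarrow> w \<in> carrier W \<Longrightarrow> pure v w \<in> carrier T"
  unfolding T_eq pure_tensor_def by (intro R.proj_closed single_F)

lemma F_plus: "f \<in> carrier F \<Longrightarrow> g \<in> carrier F \<Longrightarrow> f + g \<in> carrier F"
  by (simp add: free_simps free_closed)

lemma proj_eqI: "f \<in> carrier F \<Longrightarrow> g \<in> carrier F \<Longrightarrow> f - g \<in> bilinear_rels V W \<Longrightarrow> R.proj f = R.proj g"
  by (simp add: R.proj_eq_iff free_minus rel_in)

lemma pure_add_left:
  assumes "v \<in> carrier V" "v' \<in> carrier V" "w \<in> carrier W"
  shows "pure (v \<oplus>\<^bsub>V\<^esub> v') w = pure v w \<oplus>\<^bsub>T\<^esub> pure v' w"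
proof -
  let ?s = "\<lambda>v. Poly_Mapping.single (v, w) (1::complex)"
  have "pure v w \<oplus>\<^bsub>T\<^esub> pure v' w = R.proj (?s v + ?s v')"
    unfolding T_eq pure_tensor_def using assms R.proj_add[OF single_F single_F, of v w v' w 1 1] by (simp add: free_simps)
  also have "\<dots> = R.proj (?s (v \<oplus>\<^bsub>V\<^esub> v'))"
    using assms by (intro proj_eqI[symmetric] F_plus single_F bilinear_relsI) auto
  finally show ?thesis by (simp add: pure_tensor_def)
qed

lemma smult_pure:
  assumes "v \<in> carrier V" "w \<in> carrier W"
  shows "c \<odot>\<^bsub>T\<^esub> pure v w = R.proj (Poly_Mapping.single (v, w) c)"
proof -
  have "Poly_Mapping.map ((*) c) (Poly_Mapping.single (v, w) 1) = Poly_Mapping.single (v, w) c"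
    by (auto simp: poly_mapping_eq_iff lookup_scale fun_eq_iff lookup_single when_def)
  thus ?thesis unfolding T_eq pure_tensor_def using R.proj_smult[OF single_F[OF assms, of 1], of c] by (simp add: free_simps)
qed

lemma pure_smult_left:
  assumes "v \<in> carrier V" "w \<in> carrier W"
  shows "pure (c \<odot>\<^bsub>V\<^esub> v) w = c \<odot>\<^bsub>T\<^esub> pure v w"
  unfolding smult_pure[OF assms] unfolding pure_tensor_def
  using assms by (intro proj_eqI single_F bilinear_relsI) auto

lemma pure_smult_right:
  assumes "v \<in> carrier V" "w \<in> carrier W"
  shows "pure v (c \<odot>\<^bsub>W\<^esub> w) = c \<odot>\<^bsub>T\<^esub> pure v w"
  unfolding smult_pure[OF assms] unfolding pure_tensor_def
  using assms by (intro proj_eqI single_F bilinear_relsI) auto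

lemma pure_zero_left: "w \<in> carrier W \<Longrightarrow> pure \<zero>\<^bsub>V\<^esub> w = \<zero>\<^bsub>T\<^esub>"
  using pure_smult_left[of "\<zero>\<^bsub>V\<^esub>" w 0] by (simp add: pure_closed)

lemma pure_zero_right: "v \<in> carrier V \<Longrightarrow> pure v \<zero>\<^bsub>W\<^esub> = \<zero>\<^bsub>T\<^esub>"
  using pure_smult_right[of v "\<zero>\<^bsub>W\<^esub>" 0] by (simp add: pure_closed)

text \<open>
  A tensor is a finite sum of pure tensors, the scalars being absorbed into the first factors.
\<close>

lemma T_induct [consumes 1, case_names zero add]:
  assumes t: "t \<in> carrier T" and z: "P \<zero>\<^bsub>T\<^esub>"
    and a: "\<And>v w t. v \<in> carrier V \<Longrightarrow> w \<in> carrier W \<Longrightarrow> t \<in> carrier T \<Longrightarrow> P t \<Longrightarrow> P (pure v w \<oplus>\<^bsub>T\<^esub> t)"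
  shows "P t"
proof -
  obtain f where f: "f \<in> carrier F" "t = R.proj f" using t by (auto simp: T_eq R.quot_carrier)
  have "finite A \<Longrightarrow> Poly_Mapping.keys f = A \<Longrightarrow> f \<in> carrier F \<Longrightarrow> P (R.proj f)" for A f
  proof (induction A arbitrary: f rule: finite_induct)
    case empty
    hence "f = 0" by simp
    thus ?case using z by (simp add: T_eq R.proj_zero free_simps)
  next
    case (insert s A)
    define g where "g = f - Poly_Mapping.single s (Poly_Mapping.lookup f s)"
    have g: "Poly_Mapping.lookup g k = (if k = s then 0 else Poly_Mapping.lookup f k)" for k
      by (simp add: g_def lookup_minus lookup_single when_def)
    have keys: "Poly_Mapping.keys g = A"
      using insert.prems(1) insert.hyps(2) by (auto simp: Poly_Mapping.in_keys_iff g set_eq_iff) 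
    have gF: "g \<in> carrier F" using keys insert.prems by (auto simp: free_simps)
    obtain v w where s: "s = (v, w)" by force
    have vw: "v \<in> carrier V" "w \<in> carrier W" using insert.prems by (auto simp: free_simps s)
    let ?c = "Poly_Mapping.lookup f s"
    have "f = Poly_Mapping.single (v, w) ?c + g" by (simp add: g_def s)
    hence "R.proj f = R.proj (Poly_Mapping.single (v, w) ?c) \<oplus>\<^bsub>T\<^esub> R.proj g"
      unfolding T_eq using R.proj_add[OF single_F[OF vw] gF] by (simp add: free_simps)
    also have "R.proj (Poly_Mapping.single (v, w) ?c) = pure (?c \<odot>\<^bsub>V\<^esub> v) w"
      using vw by (simp add: smult_pure pure_smult_left)
    finally show ?case
      using a[of "?c \<odot>\<^bsub>V\<^esub> v" w "R.proj g"] insert.IH[OF keys gF] vw gF by (simp add: T_eq R.proj_closed)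
  qed
  from this[OF finite_keys refl f(1)] show ?thesis unfolding f(2) .
qed

definition lift_bilinear :: "('v \<Rightarrow> 'w \<Rightarrow> complex) \<Rightarrow> ('v \<times> 'w \<Rightarrow>\<^sub>0 complex) set \<Rightarrow> complex" where
  "lift_bilinear B = descend F (tensor_rels V W) (lin_ext (\<lambda>(v, w). B v w))"

context
  fixes B :: "'v \<Rightarrow> 'w \<Rightarrow> complex"
  assumes left: "\<And>w. w \<in> carrier W \<Longrightarrow> linear_on V (\<lambda>v. B v w)"
    and right: "\<And>v. v \<in> carrier V \<Longrightarrow> linear_on W (B v)"
begin

lemma lin_ext_rels: "f \<in> tensor_rels V W \<Longrightarrow> lin_ext (\<lambda>(v, w). B v w) f = 0"
  unfolding tensor_rels_def
proof (rule cvs.linear_on_lin_span[OF cvs_free lin_ext_linear bilinear_rels_subset])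
  fix f assume "f \<in> bilinear_rels V W"
  thus "lin_ext (\<lambda>(v, w). B v w) f = 0"
    unfolding bilinear_rels_def
    by (auto simp: lin_ext_diff lin_ext_single linear_onD[OF left] linear_onD[OF right])
qed

lemma lift_bilinear_linear: "linear_on T (lift_bilinear B)"
  unfolding T_eq lift_bilinear_def by (rule R.descend_linear[OF lin_ext_linear lin_ext_rels])

lemma lift_bilinear_pure: "v \<in> carrier V \<Longrightarrow> w \<in> carrier W \<Longrightarrow> lift_bilinear B (pure v w) = B v w"
  unfolding lift_bilinear_def pure_tensor_def
  by (simp add: R.descend_proj[OF lin_ext_linear lin_ext_rels] single_F lin_ext_single)

end

end

section \<open>Rectangular matrices over an operator space\<close>

definition hcat :: "'v mat \<Rightarrow> 'v mat \<Rightarrow> 'v mat" where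
  "hcat a b = mat (dim_row a) (dim_col a + dim_col b)
     (\<lambda>(i, j). if j < dim_col a then a $$ (i, j) else b $$ (i, j - dim_col a))"

definition vcat :: "'v mat \<Rightarrow> 'v mat \<Rightarrow> 'v mat" where
  "vcat a b = mat (dim_row a + dim_row b) (dim_col a)
     (\<lambda>(i, j). if i < dim_row a then a $$ (i, j) else b $$ (i - dim_row a, j))"

lemma hcat_mats: "a \<in> mats V m k \<Longrightarrow> b \<in> mats V m l \<Longrightarrow> hcat a b \<in> mats V m (k + l)"
  by (auto simp: hcat_def mats_iff)

lemma vcat_mats: "a \<in> mats V k m \<Longrightarrow> b \<in> mats V l m \<Longrightarrow> vcat a b \<in> mats V (k + l) m"
  by (auto simp: vcat_def mats_iff)

locale ruan_space = fixes V :: "'v opspace" (structure)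
  assumes operator_space: "operator_space V"

sublocale ruan_space \<subseteq> matrix_seminormed V
  using operator_space_cvs[OF ruan_space.operator_space[OF ruan_space_axioms]]
    op_seminormD(1)[OF operator_space_op_seminorm[OF ruan_space.operator_space[OF ruan_space_axioms]]]
  by (intro matrix_seminormed.intro matrix_seminormed_axioms.intro)

context ruan_space begin

lemma mnorm_diag: "x \<in> mats V m m \<Longrightarrow> y \<in> mats V n n \<Longrightarrow> mnorm V (diag_sum V x y) \<le> max (mnorm V x) (mnorm V y)"
  by (rule op_seminormD(2)[OF operator_space_op_seminorm[OF operator_space]])

lemma mnorm_sandwich: "x \<in> mats V m m \<Longrightarrow> \<alpha> \<in> carrier_mat n m \<Longrightarrow> \<beta> \<in> carrier_mat m n \<Longrightarrow>
   mnorm V (scalar_sandwich V \<alpha> x \<beta>) \<le> mat_opnorm \<alpha> * mnorm V x * mat_opnorm \<beta>"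
  by (rule op_seminormD(3)[OF operator_space_op_seminorm[OF operator_space]])

definition pad :: "nat \<Rightarrow> 'v mat \<Rightarrow> 'v mat" where
  "pad N x = mat N N (\<lambda>(i, j). if i < dim_row x \<and> j < dim_col x then x $$ (i, j) else \<zero>)"

lemma rect_norm_pad: "x \<in> mats V m k \<Longrightarrow> rect_norm V x = mnorm V (pad (max m k) x)"
  by (auto simp: rect_norm_def pad_def Let_def mats_iff)

lemma pad_mats: "x \<in> mats V m k \<Longrightarrow> pad N x \<in> mats V N N"
  by (auto simp: pad_def mats_iff)

text \<open>
  Rectangular matrices enter Ruan's axioms only through their paddings; extending the test vectors
  by zero carries estimates for forms back to the rectangular matrix.
\<close>

lemma fnorm_pad:
  assumes fin: "finite K" "finite L" and lin: "\<forall>k\<in>K. \<forall>l\<in>L. linear_on V (\<pi> k l)"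
    and x: "x \<in> mats V m r" and N: "m \<le> N" "r \<le> N"
  shows "fnorm K L \<pi> x \<le> fnorm K L \<pi> (pad N x)"
proof (rule fnorm_leI[OF matsD(1)[OF x] fnorm_nonneg[OF fin]])
  fix \<eta> \<xi>
  let ?e = "\<lambda>n h (p, k). if p < n then h (p, k) else 0"
  note z = linear_on_zero[OF lin[rule_format]]
  have ext: "nrm2 ({..<N} \<times> K') (?e n h) = nrm2 ({..<n} \<times> K') h" if "n \<le> N"
    for n K' and h :: "nat \<times> 'z \<Rightarrow> complex"
  proof -
    have "(\<Sum>p<N. \<Sum>k\<in>K'. (cmod (?e n h (p, k)))\<^sup>2) = (\<Sum>p<n. \<Sum>k\<in>K'. (cmod (h (p, k)))\<^sup>2)"
      by (rule sum.mono_neutral_cong_right) (use that in auto)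
    thus ?thesis by (simp add: L2_set_def sum.cartesian_product')
  qed
  have "mform K L \<pi> x \<eta> \<xi> = (\<Sum>p<m. \<Sum>q<N. \<Sum>k\<in>K. \<Sum>l\<in>L. ?e m \<eta> (p, k) * \<pi> k l (pad N x $$ (p, q)) * ?e r \<xi> (q, l))"
    unfolding mform_def matsD(2,3)[OF x]
    by (rule sum.cong[OF refl], rule sum.mono_neutral_cong_left) (use matsD[OF x] N in \<open>auto simp: pad_def z\<close>)
  also have "\<dots> = mform K L \<pi> (pad N x) (?e m \<eta>) (?e r \<xi>)"
    unfolding mform_def by (rule sum.mono_neutral_cong_left) (use N in \<open>auto simp: pad_def\<close>)
  also have "cmod \<dots> \<le> fnorm K L \<pi> (pad N x) * nrm2 ({..<N} \<times> K) (?e m \<eta>) * nrm2 ({..<N} \<times> L) (?e r \<xi>)"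
    by (rule fnorm_bound[OF fin matsD(1)[OF pad_mats[OF x]]])
  finally show "cmod (mform K L \<pi> x \<eta> \<xi>) \<le> fnorm K L \<pi> (pad N x) * nrm2 ({..<m} \<times> K) \<eta> * nrm2 ({..<r} \<times> L) \<xi>"
    unfolding ext[OF N(1)] ext[OF N(2)] .
qed

lemma rect_norm_nonneg: "x \<in> mats V m k \<Longrightarrow> 0 \<le> rect_norm V x"
  by (simp add: rect_norm_pad mnorm_nonneg[OF pad_mats])

lemma rect_norm_mat1: "v \<in> carrier V \<Longrightarrow> rect_norm V (mat1 v) = os_norm V v"
proof -
  assume v: "v \<in> carrier V"
  have "pad (max 1 1) (mat1 v) = mat1 v" by (rule eq_matI) (auto simp: pad_def)
  thus ?thesis using rect_norm_pad[OF mat1_mats[OF v]] by (simp add: os_norm_def)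
qed

lemma rect_norm_smult:
  assumes x: "x \<in> mats V m k" shows "rect_norm V (map_mat (\<lambda>v. c \<odot> v) x) \<le> cmod c * rect_norm V x"
proof -
  have "pad N (map_mat (\<lambda>v. c \<odot> v) x) = map_mat (\<lambda>v. c \<odot> v) (pad N x)" for N
    by (rule eq_matI) (auto simp: pad_def)
  thus ?thesis
    using mnorm_smult[OF pad_mats[OF x]] by (simp add: rect_norm_pad[OF x] rect_norm_pad[OF smult_mats[OF x]])
qed

text \<open>
  Padding a product with zeros amounts to padding its outer factors, which does not increase their
  norms.
\<close>

lemma rect_norm_sandwich:
  assumes x: "x \<in> mats V N N" and ab: "\<alpha> \<in> carrier_mat m N" "\<beta> \<in> carrier_mat N k"
  shows "rect_norm V (scalar_sandwich V \<alpha> x \<beta>) \<le> mat_opnorm \<alpha> * mnorm V x * mat_opnorm \<beta>"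
proof -
  define M where "M = max m k"
  define \<alpha>' where "\<alpha>' = mat M N (\<lambda>(i, p). if i < m then \<alpha> $$ (i, p) else 0)"
  define \<beta>' where "\<beta>' = mat N M (\<lambda>(q, j). if j < k then \<beta> $$ (q, j) else 0)"
  have ab': "\<alpha>' \<in> carrier_mat M N" "\<beta>' \<in> carrier_mat N M" by (auto simp: \<alpha>'_def \<beta>'_def)
  let ?s = "scalar_sandwich V \<alpha> x \<beta>"
  have s: "?s \<in> mats V m k" by (rule sandwich_mats[OF x ab])
  have nrm_mono: "nrm2 {..<r} \<eta> \<le> nrm2 {..<M} \<eta>" if "r \<le> M" for r \<eta>
    using that unfolding L2_set_def by (intro real_sqrt_le_mono sum_mono2) auto
  have "pad M ?s = scalar_sandwich V \<alpha>' x \<beta>'"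
  proof (rule eq_matI)
    fix i j assume "i < dim_row (scalar_sandwich V \<alpha>' x \<beta>')" "j < dim_col (scalar_sandwich V \<alpha>' x \<beta>')"
    hence ij: "i < M" "j < M" by (auto simp: scalar_sandwich_def \<alpha>'_def \<beta>'_def)
    show "pad M ?s $$ (i, j) = scalar_sandwich V \<alpha>' x \<beta>' $$ (i, j)"
    proof (cases "i < m \<and> j < k")
      case True
      have "?s $$ (i, j) = scalar_sandwich V \<alpha>' x \<beta>' $$ (i, j)"
        unfolding sandwich_index[OF x ab conjunct1[OF True] conjunct2[OF True]] sandwich_index[OF x ab' ij]
        by (rule finsum_cong') (use True ij matsE[OF x] in \<open>auto simp: \<alpha>'_def \<beta>'_def\<close>)
      thus ?thesis using True ij matsD[OF s] by (simp add: pad_def)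
    next
      case False
      have "scalar_sandwich V \<alpha>' x \<beta>' $$ (i, j) = \<zero>"
        by (rule sandwich_entry_zero[OF x ab' ij]) (use False ij in \<open>auto simp: \<alpha>'_def \<beta>'_def\<close>)
      thus ?thesis using False ij matsD[OF s] by (auto simp: pad_def)
    qed
  qed (auto simp: pad_def scalar_sandwich_def \<alpha>'_def \<beta>'_def)
  hence "rect_norm V ?s \<le> mat_opnorm \<alpha>' * mnorm V x * mat_opnorm \<beta>'"
    using mnorm_sandwich[OF x ab'] by (simp add: rect_norm_pad[OF s] M_def)
  also have "\<dots> \<le> mat_opnorm \<alpha> * mnorm V x * mat_opnorm \<beta>"
  proof (intro mult_mono)
    show "mat_opnorm \<alpha>' \<le> mat_opnorm \<alpha>"
    proof (rule mat_opnorm_leI[OF ab'(1) mat_opnorm_nonneg])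
      fix \<eta> \<xi> :: "nat \<Rightarrow> complex"
      have "(\<Sum>i<M. \<Sum>j<N. \<eta> i * \<alpha>' $$ (i, j) * \<xi> j) = (\<Sum>i<m. \<Sum>j<N. \<eta> i * \<alpha>' $$ (i, j) * \<xi> j)"
        by (rule sum.mono_neutral_right) (auto simp: \<alpha>'_def M_def)
      also have "\<dots> = (\<Sum>i<m. \<Sum>j<N. \<eta> i * \<alpha> $$ (i, j) * \<xi> j)"
        by (intro sum.cong refl) (auto simp: \<alpha>'_def M_def)
      also have "cmod \<dots> \<le> mat_opnorm \<alpha> * nrm2 {..<m} \<eta> * nrm2 {..<N} \<xi>"
        by (rule mat_opnorm_bound[OF ab(1)])
      also have "\<dots> \<le> mat_opnorm \<alpha> * nrm2 {..<M} \<eta> * nrm2 {..<N} \<xi>"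
        by (intro mult_right_mono mult_left_mono nrm_mono mat_opnorm_nonneg) (auto simp: M_def)
      finally show "cmod (\<Sum>i<M. \<Sum>j<N. \<eta> i * \<alpha>' $$ (i, j) * \<xi> j) \<le> mat_opnorm \<alpha> * nrm2 {..<M} \<eta> * nrm2 {..<N} \<xi>" .
    qed
    show "mat_opnorm \<beta>' \<le> mat_opnorm \<beta>"
    proof (rule mat_opnorm_leI[OF ab'(2) mat_opnorm_nonneg])
      fix \<eta> \<xi> :: "nat \<Rightarrow> complex"
      have "(\<Sum>i<N. \<Sum>j<M. \<eta> i * \<beta>' $$ (i, j) * \<xi> j) = (\<Sum>i<N. \<Sum>j<k. \<eta> i * \<beta>' $$ (i, j) * \<xi> j)"
        by (intro sum.cong refl sum.mono_neutral_right) (auto simp: \<beta>'_def M_def)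
      also have "\<dots> = (\<Sum>i<N. \<Sum>j<k. \<eta> i * \<beta> $$ (i, j) * \<xi> j)"
        by (intro sum.cong refl) (auto simp: \<beta>'_def M_def)
      also have "cmod \<dots> \<le> mat_opnorm \<beta> * nrm2 {..<N} \<eta> * nrm2 {..<k} \<xi>"
        by (rule mat_opnorm_bound[OF ab(2)])
      also have "\<dots> \<le> mat_opnorm \<beta> * nrm2 {..<N} \<eta> * nrm2 {..<M} \<xi>"
        by (intro mult_left_mono nrm_mono mult_nonneg_nonneg mat_opnorm_nonneg) (auto simp: M_def)
      finally show "cmod (\<Sum>i<N. \<Sum>j<M. \<eta> i * \<beta>' $$ (i, j) * \<xi> j) \<le> mat_opnorm \<beta> * nrm2 {..<N} \<eta> * nrm2 {..<M} \<xi>" .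
    qed
  qed (auto simp: mat_opnorm_nonneg mnorm_nonneg[OF x])
  finally show ?thesis .
qed

text \<open>
  The contractive middle factor \<open>diag (a/c, b/c')\<close> of a concatenation.
\<close>

lemma scaled_diag:
  assumes a: "a \<in> mats V N N" and b: "b \<in> mats V N' N'" and c: "c > 0" "c' > 0"
    and le: "mnorm V a \<le> c" "mnorm V b \<le> c'"
  defines "D \<equiv> diag_sum V (map_mat (\<lambda>v. complex_of_real (1/c) \<odot> v) a) (map_mat (\<lambda>v. complex_of_real (1/c') \<odot> v) b)"
  shows "D \<in> mats V (N + N') (N + N')" "mnorm V D \<le> 1"
    "\<And>i j. i < N \<Longrightarrow> j < N \<Longrightarrow> complex_of_real c \<odot> D $$ (i, j) = a $$ (i, j)"
    "\<And>i j. i < N' \<Longrightarrow> j < N' \<Longrightarrow> complex_of_real c' \<odot> D $$ (N + i, N + j) = b $$ (i, j)"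
    "\<And>i j. i < N \<Longrightarrow> j < N' \<Longrightarrow> D $$ (i, N + j) = \<zero>" "\<And>i j. i < N' \<Longrightarrow> j < N \<Longrightarrow> D $$ (N + i, j) = \<zero>"
proof -
  have one: "mnorm V (map_mat (\<lambda>v. complex_of_real (1/r) \<odot> v) x) \<le> 1"
    if "x \<in> mats V n n" "mnorm V x \<le> r" "r > 0" for x r n
  proof -
    have "mnorm V (map_mat (\<lambda>v. complex_of_real (1/r) \<odot> v) x) \<le> mnorm V x / r"
      using mnorm_smult[OF that(1), of "complex_of_real (1/r)"] that(3) by (simp add: norm_divide)
    also have "\<dots> \<le> 1" using that(2,3) by simp
    finally show ?thesis .
  qed
  show "D \<in> mats V (N + N') (N + N')" unfolding D_def by (intro diag_sum_mats smult_mats a b)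
  show "mnorm V D \<le> 1"
    unfolding D_def
    by (rule order_trans[OF mnorm_diag[OF smult_mats[OF a] smult_mats[OF b]]]) (use one a b le c in auto)
qed (use matsD[OF a] matsD[OF b] matsE[OF a] matsE[OF b] c in
      \<open>auto simp: D_def diag_sum_def zero_mats_def smult_smult\<close>)

text \<open>
  In the factorization \<open>[a, b] = [c 1, c' 1] diag (a/c, b/c')\<close> the row \<open>[c 1, c' 1]\<close> of scalar matrices
  has norm \<open>sqrt (c\<^sup>2 + c'\<^sup>2)\<close>.  A further matrix of zeros and ones removes the padding.
\<close>

lemma rect_norm_hcat:
  assumes a: "a \<in> mats V m k" and b: "b \<in> mats V m l" and c: "c > 0" "c' > 0"
    and le: "rect_norm V a \<le> c" "rect_norm V b \<le> c'"
  shows "rect_norm V (hcat a b) \<le> sqrt (c\<^sup>2 + c'\<^sup>2)"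
proof -
  define N N' where "N = max m k" and "N' = max m l"
  have bounds: "m \<le> N" "k \<le> N" "m \<le> N'" "l \<le> N'" by (auto simp: N_def N'_def)
  note D = scaled_diag[OF pad_mats[OF a] pad_mats[OF b] c
      le[unfolded rect_norm_pad[OF a] rect_norm_pad[OF b]], folded N_def N'_def]
  define D where "D = diag_sum V (map_mat (\<lambda>v. complex_of_real (1/c) \<odot> v) (pad N a)) (map_mat (\<lambda>v. complex_of_real (1/c') \<odot> v) (pad N' b))"
  note D = D[folded D_def]
  define \<alpha> where "\<alpha> = mat m (N + N') (\<lambda>(i, p). complex_of_real (if p = i then c else if p = N + i then c' else 0))"
  define \<beta> where "\<beta> = mat (N + N') (k + l) (\<lambda>(q, j). if q = (if j < k then j else N + (j - k)) then 1 else 0 :: complex)"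
  have ab: "\<alpha> \<in> carrier_mat m (N + N')" "\<beta> \<in> carrier_mat (N + N') (k + l)" by (auto simp: \<alpha>_def \<beta>_def)
  have "hcat a b = scalar_sandwich V \<alpha> D \<beta>"
  proof (rule eq_matI)
    fix i j assume "i < dim_row (scalar_sandwich V \<alpha> D \<beta>)" "j < dim_col (scalar_sandwich V \<alpha> D \<beta>)"
    hence ij: "i < m" "j < k + l" by (auto simp: scalar_sandwich_def \<alpha>_def \<beta>_def)
    show "hcat a b $$ (i, j) = scalar_sandwich V \<alpha> D \<beta> $$ (i, j)"
    proof (cases "j < k")
      case True
      have "scalar_sandwich V \<alpha> D \<beta> $$ (i, j) = (\<alpha> $$ (i, i) * \<beta> $$ (j, j)) \<odot> D $$ (i, j)"
      proof (rule sandwich_entry[OF D(1) ab ij])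
        fix p q assume "p < N + N'" "q < N + N'" "(p, q) \<noteq> (i, j)"
        thus "\<alpha> $$ (i, p) * \<beta> $$ (q, j) = 0 \<or> D $$ (p, q) = \<zero>"
          using ij True bounds D(6)[of i j] by (auto simp: \<alpha>_def \<beta>_def split: if_splits)
      qed (use ij True bounds in auto)
      also have "\<dots> = a $$ (i, j)"
        using ij True bounds D(3)[of i j] matsD[OF a] by (simp add: \<alpha>_def \<beta>_def pad_def)
      finally show ?thesis using ij True matsD[OF a] matsD[OF b] by (simp add: hcat_def)
    next
      case False
      hence j: "j - k < l" using ij by simp
      have "scalar_sandwich V \<alpha> D \<beta> $$ (i, j) = (\<alpha> $$ (i, N + i) * \<beta> $$ (N + (j - k), j)) \<odot> D $$ (N + i, N + (j - k))"
      proof (rule sandwich_entry[OF D(1) ab ij])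
        fix p q assume "p < N + N'" "q < N + N'" "(p, q) \<noteq> (N + i, N + (j - k))"
        thus "\<alpha> $$ (i, p) * \<beta> $$ (q, j) = 0 \<or> D $$ (p, q) = \<zero>"
          using ij False j bounds D(5)[of i "j - k"] by (auto simp: \<alpha>_def \<beta>_def split: if_splits)
      qed (use ij j bounds in auto)
      also have "\<dots> = b $$ (i, j - k)"
        using ij False j bounds D(4)[of i "j - k"] matsD[OF b] by (simp add: \<alpha>_def \<beta>_def pad_def)
      finally show ?thesis using ij False matsD[OF a] matsD[OF b] by (simp add: hcat_def)
    qed
  qed (use matsD[OF a] matsD[OF b] in \<open>auto simp: hcat_def scalar_sandwich_def \<alpha>_def \<beta>_def\<close>)
  hence "rect_norm V (hcat a b) \<le> mat_opnorm \<alpha> * mnorm V D * mat_opnorm \<beta>"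
    using rect_norm_sandwich[OF D(1) ab] by simp
  also have "\<dots> \<le> sqrt (c\<^sup>2 + c'\<^sup>2) * 1 * 1"
  proof (intro mult_mono D(2))
    show "mat_opnorm \<alpha> \<le> sqrt (c\<^sup>2 + c'\<^sup>2)"
    proof (rule mat_opnorm_le_row[OF ab(1)])
      fix i assume i: "i < m"
      have "(\<Sum>p<N + N'. (cmod (\<alpha> $$ (i, p)))\<^sup>2) = (\<Sum>p<N + N'. (if p = i then c\<^sup>2 else 0) + (if p = N + i then c'\<^sup>2 else 0))"
        using i bounds c by (intro sum.cong refl) (auto simp: \<alpha>_def)
      also have "\<dots> = c\<^sup>2 + c'\<^sup>2" using i bounds by (simp add: sum.distrib)
      finally show "(\<Sum>p<N + N'. (cmod (\<alpha> $$ (i, p)))\<^sup>2) \<le> (sqrt (c\<^sup>2 + c'\<^sup>2))\<^sup>2" by simp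
    qed (use bounds in \<open>auto simp: \<alpha>_def split: if_splits\<close>)
    show "mat_opnorm \<beta> \<le> 1"
      by (rule mat_opnorm_01[OF ab(2)]) (use bounds in \<open>auto simp: \<beta>_def split: if_splits\<close>)
  qed (auto simp: mat_opnorm_nonneg mnorm_nonneg[OF D(1)])
  finally show ?thesis by simp
qed

text \<open>
  The transposed factorization, with the weights in the right-hand scalar matrix.
\<close>

lemma rect_norm_vcat:
  assumes a: "a \<in> mats V k m" and b: "b \<in> mats V l m" and c: "c > 0" "c' > 0"
    and le: "rect_norm V a \<le> c" "rect_norm V b \<le> c'"
  shows "rect_norm V (vcat a b) \<le> sqrt (c\<^sup>2 + c'\<^sup>2)"
proof -
  define N N' where "N = max k m" and "N' = max l m"
  have bounds: "m \<le> N" "k \<le> N" "m \<le> N'" "l \<le> N'" by (auto simp: N_def N'_def)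
  note D = scaled_diag[OF pad_mats[OF a] pad_mats[OF b] c
      le[unfolded rect_norm_pad[OF a] rect_norm_pad[OF b]], folded N_def N'_def]
  define D where "D = diag_sum V (map_mat (\<lambda>v. complex_of_real (1/c) \<odot> v) (pad N a)) (map_mat (\<lambda>v. complex_of_real (1/c') \<odot> v) (pad N' b))"
  note D = D[folded D_def]
  define \<alpha> where "\<alpha> = mat (k + l) (N + N') (\<lambda>(i, p). if p = (if i < k then i else N + (i - k)) then 1 else 0 :: complex)"
  define \<beta> where "\<beta> = mat (N + N') m (\<lambda>(q, j). complex_of_real (if q = j then c else if q = N + j then c' else 0))"
  have ab: "\<alpha> \<in> carrier_mat (k + l) (N + N')" "\<beta> \<in> carrier_mat (N + N') m" by (auto simp: \<alpha>_def \<beta>_def)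
  have "vcat a b = scalar_sandwich V \<alpha> D \<beta>"
  proof (rule eq_matI)
    fix i j assume "i < dim_row (scalar_sandwich V \<alpha> D \<beta>)" "j < dim_col (scalar_sandwich V \<alpha> D \<beta>)"
    hence ij: "i < k + l" "j < m" by (auto simp: scalar_sandwich_def \<alpha>_def \<beta>_def)
    show "vcat a b $$ (i, j) = scalar_sandwich V \<alpha> D \<beta> $$ (i, j)"
    proof (cases "i < k")
      case True
      have "scalar_sandwich V \<alpha> D \<beta> $$ (i, j) = (\<alpha> $$ (i, i) * \<beta> $$ (j, j)) \<odot> D $$ (i, j)"
      proof (rule sandwich_entry[OF D(1) ab ij])
        fix p q assume "p < N + N'" "q < N + N'" "(p, q) \<noteq> (i, j)"
        thus "\<alpha> $$ (i, p) * \<beta> $$ (q, j) = 0 \<or> D $$ (p, q) = \<zero>"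
          using ij True bounds D(5)[of i j] by (auto simp: \<alpha>_def \<beta>_def split: if_splits)
      qed (use ij True bounds in auto)
      also have "\<dots> = a $$ (i, j)"
        using ij True bounds D(3)[of i j] matsD[OF a] by (simp add: \<alpha>_def \<beta>_def pad_def)
      finally show ?thesis using ij True matsD[OF a] matsD[OF b] by (simp add: vcat_def)
    next
      case False
      hence i: "i - k < l" using ij by simp
      have "scalar_sandwich V \<alpha> D \<beta> $$ (i, j) = (\<alpha> $$ (i, N + (i - k)) * \<beta> $$ (N + j, j)) \<odot> D $$ (N + (i - k), N + j)"
      proof (rule sandwich_entry[OF D(1) ab ij])
        fix p q assume "p < N + N'" "q < N + N'" "(p, q) \<noteq> (N + (i - k), N + j)"
        thus "\<alpha> $$ (i, p) * \<beta> $$ (q, j) = 0 \<or> D $$ (p, q) = \<zero>"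
          using ij False i bounds D(6)[of "i - k" j] by (auto simp: \<alpha>_def \<beta>_def split: if_splits)
      qed (use ij i bounds in auto)
      also have "\<dots> = b $$ (i - k, j)"
        using ij False i bounds D(4)[of "i - k" j] matsD[OF b] by (simp add: \<alpha>_def \<beta>_def pad_def)
      finally show ?thesis using ij False matsD[OF a] matsD[OF b] by (simp add: vcat_def)
    qed
  qed (use matsD[OF a] matsD[OF b] in \<open>auto simp: vcat_def scalar_sandwich_def \<alpha>_def \<beta>_def\<close>)
  hence "rect_norm V (vcat a b) \<le> mat_opnorm \<alpha> * mnorm V D * mat_opnorm \<beta>"
    using rect_norm_sandwich[OF D(1) ab] by simp
  also have "\<dots> \<le> 1 * 1 * sqrt (c\<^sup>2 + c'\<^sup>2)"
  proof (intro mult_mono D(2))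
    show "mat_opnorm \<beta> \<le> sqrt (c\<^sup>2 + c'\<^sup>2)"
    proof (rule mat_opnorm_le_col[OF ab(2)])
      fix j assume j: "j < m"
      have "(\<Sum>p<N + N'. (cmod (\<beta> $$ (p, j)))\<^sup>2) = (\<Sum>p<N + N'. (if p = j then c\<^sup>2 else 0) + (if p = N + j then c'\<^sup>2 else 0))"
        using j bounds c by (intro sum.cong refl) (auto simp: \<beta>_def)
      also have "\<dots> = c\<^sup>2 + c'\<^sup>2" using j bounds by (simp add: sum.distrib)
      finally show "(\<Sum>p<N + N'. (cmod (\<beta> $$ (p, j)))\<^sup>2) \<le> (sqrt (c\<^sup>2 + c'\<^sup>2))\<^sup>2" by simp
    qed (use bounds in \<open>auto simp: \<beta>_def split: if_splits\<close>)
    show "mat_opnorm \<alpha> \<le> 1"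
      by (rule mat_opnorm_01[OF ab(1)]) (use bounds in \<open>auto simp: \<alpha>_def split: if_splits\<close>)
  qed (auto simp: mat_opnorm_nonneg mnorm_nonneg[OF D(1)])
  finally show ?thesis by simp
qed

lemma rect_norm_row:
  assumes a: "a \<in> mats V 1 k" and i: "i < n"
  shows "rect_norm V (mat n k (\<lambda>(i', l). if i' = i then a $$ (0, l) else \<zero>)) \<le> rect_norm V a"
proof -
  define N where "N = max 1 k"
  have N: "0 < N" "k \<le> N" by (auto simp: N_def)
  define \<alpha> where "\<alpha> = mat n N (\<lambda>(i', p). if i' = i \<and> p = 0 then 1 else 0 :: complex)"
  define \<beta> where "\<beta> = mat N k (\<lambda>(q, l). if q = l then 1 else 0 :: complex)"
  have ab: "\<alpha> \<in> carrier_mat n N" "\<beta> \<in> carrier_mat N k" by (auto simp: \<alpha>_def \<beta>_def)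
  note P = pad_mats[OF a, of N]
  have "mat n k (\<lambda>(i', l). if i' = i then a $$ (0, l) else \<zero>) = scalar_sandwich V \<alpha> (pad N a) \<beta>"
  proof (rule eq_matI)
    fix i' l assume "i' < dim_row (scalar_sandwich V \<alpha> (pad N a) \<beta>)" "l < dim_col (scalar_sandwich V \<alpha> (pad N a) \<beta>)"
    hence il: "i' < n" "l < k" by (auto simp: scalar_sandwich_def \<alpha>_def \<beta>_def)
    have "scalar_sandwich V \<alpha> (pad N a) \<beta> $$ (i', l) = (\<alpha> $$ (i', 0) * \<beta> $$ (l, l)) \<odot> pad N a $$ (0, l)"
      by (rule sandwich_entry[OF P ab il]) (use il N in \<open>auto simp: \<alpha>_def \<beta>_def\<close>)
    thus "mat n k (\<lambda>(i', l). if i' = i then a $$ (0, l) else \<zero>) $$ (i', l) = scalar_sandwich V \<alpha> (pad N a) \<beta> $$ (i', l)"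
      using il N matsD[OF a] matsE[OF a, of 0 l] by (auto simp: \<alpha>_def \<beta>_def pad_def)
  qed (auto simp: scalar_sandwich_def \<alpha>_def \<beta>_def)
  hence "rect_norm V (mat n k (\<lambda>(i', l). if i' = i then a $$ (0, l) else \<zero>)) \<le> mat_opnorm \<alpha> * mnorm V (pad N a) * mat_opnorm \<beta>"
    using rect_norm_sandwich[OF P ab] by simp
  also have "\<dots> \<le> 1 * mnorm V (pad N a) * 1"
    using mnorm_nonneg[OF P]
    by (intro mult_mono mat_opnorm_01[OF ab(1)] mat_opnorm_01[OF ab(2)])
       (auto simp: \<alpha>_def \<beta>_def mat_opnorm_nonneg split: if_splits)
  finally show ?thesis by (simp add: rect_norm_pad[OF a] N_def)
qed

lemma rect_norm_col:
  assumes b: "b \<in> mats V k 1" and j: "j < n"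
  shows "rect_norm V (mat k n (\<lambda>(l, j'). if j' = j then b $$ (l, 0) else \<zero>)) \<le> rect_norm V b"
proof -
  define N where "N = max k 1"
  have N: "0 < N" "k \<le> N" by (auto simp: N_def)
  define \<alpha> where "\<alpha> = mat k N (\<lambda>(l, q). if q = l then 1 else 0 :: complex)"
  define \<beta> where "\<beta> = mat N n (\<lambda>(p, j'). if j' = j \<and> p = 0 then 1 else 0 :: complex)"
  have ab: "\<alpha> \<in> carrier_mat k N" "\<beta> \<in> carrier_mat N n" by (auto simp: \<alpha>_def \<beta>_def)
  note P = pad_mats[OF b, of N]
  have "mat k n (\<lambda>(l, j'). if j' = j then b $$ (l, 0) else \<zero>) = scalar_sandwich V \<alpha> (pad N b) \<beta>"
  proof (rule eq_matI)
    fix l j' assume "l < dim_row (scalar_sandwich V \<alpha> (pad N b) \<beta>)" "j' < dim_col (scalar_sandwich V \<alpha> (pad N b) \<beta>)"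
    hence lj: "l < k" "j' < n" by (auto simp: scalar_sandwich_def \<alpha>_def \<beta>_def)
    have "scalar_sandwich V \<alpha> (pad N b) \<beta> $$ (l, j') = (\<alpha> $$ (l, l) * \<beta> $$ (0, j')) \<odot> pad N b $$ (l, 0)"
      by (rule sandwich_entry[OF P ab lj]) (use lj N in \<open>auto simp: \<alpha>_def \<beta>_def\<close>)
    thus "mat k n (\<lambda>(l, j'). if j' = j then b $$ (l, 0) else \<zero>) $$ (l, j') = scalar_sandwich V \<alpha> (pad N b) \<beta> $$ (l, j')"
      using lj N matsD[OF b] matsE[OF b, of l 0] by (auto simp: \<alpha>_def \<beta>_def pad_def)
  qed (auto simp: scalar_sandwich_def \<alpha>_def \<beta>_def)
  hence "rect_norm V (mat k n (\<lambda>(l, j'). if j' = j then b $$ (l, 0) else \<zero>)) \<le> mat_opnorm \<alpha> * mnorm V (pad N b) * mat_opnorm \<beta>"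
    using rect_norm_sandwich[OF P ab] by simp
  also have "\<dots> \<le> 1 * mnorm V (pad N b) * 1"
    using mnorm_nonneg[OF P]
    by (intro mult_mono mat_opnorm_01[OF ab(1)] mat_opnorm_01[OF ab(2)])
       (auto simp: \<alpha>_def \<beta>_def mat_opnorm_nonneg split: if_splits)
  finally show ?thesis by (simp add: rect_norm_pad[OF b] N_def)
qed

end

section \<open>The Haagerup norm\<close>

context abelian_monoid begin

lemma finsum_lessThan_add:
  fixes m n :: nat
  assumes "\<And>i. i < m + n \<Longrightarrow> f i \<in> carrier G"
  shows "finsum G f {..<m + n} = finsum G f {..<m} \<oplus> finsum G (\<lambda>i. f (m + i)) {..<n}"
  using assms
proof (induction n)
  case (Suc n)
  have "finsum G f {..<m + Suc n} = f (m + n) \<oplus> finsum G f {..<m + n}"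
    using Suc.prems by (simp add: lessThan_Suc)
  also have "finsum G f {..<m + n} = finsum G f {..<m} \<oplus> finsum G (\<lambda>i. f (m + i)) {..<n}"
    using Suc by auto
  also have "f (m + n) \<oplus> \<dots> = finsum G f {..<m} \<oplus> (f (m + n) \<oplus> finsum G (\<lambda>i. f (m + i)) {..<n})"
    using Suc.prems by (intro a_lcomm finsum_closed) auto
  also have "f (m + n) \<oplus> finsum G (\<lambda>i. f (m + i)) {..<n} = finsum G (\<lambda>i. f (m + i)) {..<Suc n}"
    using Suc.prems by (simp add: lessThan_Suc)
  finally show ?case .
qed (auto simp: finsum_closed)

end

lemma (in cvs) mats_induct [consumes 1, case_names zero add single]:
  assumes x: "x \<in> mats V n n" and z: "P (zero_mats V n n)"
    and a: "\<And>x y. x \<in> mats V n n \<Longrightarrow> y \<in> mats V n n \<Longrightarrow> P x \<Longrightarrow> P y \<Longrightarrow> P (add_mats V x y)"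
    and s: "\<And>i j v. i < n \<Longrightarrow> j < n \<Longrightarrow> v \<in> carrier V \<Longrightarrow> P (mat n n (\<lambda>ij. if ij = (i, j) then v else \<zero>\<^bsub>V\<^esub>))"
  shows "P x"
proof -
  define R where "R S = mat n n (\<lambda>ij. if ij \<in> S then x $$ ij else \<zero>\<^bsub>V\<^esub>)" for S
  have R: "R S \<in> mats V n n" for S using matsE[OF x] by (auto simp: mats_iff R_def)
  have "P (R S)" if "finite S" "S \<subseteq> {..<n} \<times> {..<n}" for S
    using that
  proof (induction S)
    case empty
    have "R {} = zero_mats V n n" by (rule eq_matI) (auto simp: R_def zero_mats_def)
    thus ?case using z by simp
  next
    case (insert ij S)
    obtain i j where ij: "ij = (i, j)" "i < n" "j < n" using insert.prems by auto
    let ?E = "mat n n (\<lambda>kl. if kl = (i, j) then x $$ (i, j) else \<zero>\<^bsub>V\<^esub>)"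
    have E: "?E \<in> mats V n n" using matsE[OF x] ij by (auto simp: mats_iff)
    have "R (insert ij S) = add_mats V (R S) ?E"
      using matsE[OF x] insert.hyps by (intro eq_matI) (auto simp: R_def add_mats_def ij)
    thus ?case using a[OF R E] insert.IH insert.prems s[OF ij(2,3) matsE[OF x ij(2,3)]] by auto
  qed
  from this[of "{..<n} \<times> {..<n}"] have "P (R ({..<n} \<times> {..<n}))" by simp
  moreover have "R ({..<n} \<times> {..<n}) = x"
    using matsD[OF x] by (intro eq_matI) (auto simp: R_def)
  ultimately show ?thesis by simp
qed

locale haagerup_pair = A: ruan_space V + B: ruan_space W for V :: "'v opspace" and W :: "'w opspace"
begin

sublocale tensor V W by unfold_locales

abbreviation odot where "odot \<equiv> tensor_mat_prod V W"

lemma odot_index: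
  assumes "a \<in> mats V n k" "b \<in> mats W k m" "i < n" "j < m"
  shows "odot a b $$ (i, j) = finsum T (\<lambda>l. pure (a $$ (i, l)) (b $$ (l, j))) {..<k}"
  using matsD[OF assms(1)] matsD[OF assms(2)] assms(3,4) by (simp add: tensor_mat_prod_def)

lemma odot_carrier: "a \<in> mats V n k \<Longrightarrow> b \<in> mats W k m \<Longrightarrow> odot a b \<in> carrier_mat n m"
  using matsD(2)[of a V n k] matsD(3)[of b W k m] by (simp add: tensor_mat_prod_def)

lemma odot_entries:
  assumes "a \<in> mats V n k" "b \<in> mats W k m" "i < n" "j < m" "l < k"
  shows "pure (a $$ (i, l)) (b $$ (l, j)) \<in> carrier T"
  using assms by (intro pure_closed matsE)

lemma odot_mats:
  assumes "a \<in> mats V n k" "b \<in> mats W k m" shows "odot a b \<in> mats T n m"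
  using odot_carrier[OF assms] odot_entries[OF assms]
  by (auto simp: mats_iff odot_index[OF assms] intro!: T.finsum_closed)

text \<open>
  Concatenation turns two factorizations into a factorization of the sum, which is the source of
  the triangle inequality.
\<close>

lemma odot_cat:
  assumes a: "a \<in> mats V n k" and b: "b \<in> mats W k m" and a': "a' \<in> mats V n l" and b': "b' \<in> mats W l m"
  shows "odot (hcat a a') (vcat b b') = add_mats T (odot a b) (odot a' b')"
proof (rule eq_matI)
  have d: "dim_row (add_mats T (odot a b) (odot a' b')) = n" "dim_col (add_mats T (odot a b) (odot a' b')) = m"
    using odot_carrier[OF a b] by (auto simp: add_mats_def)
  note h = hcat_mats[OF a a'] and v = vcat_mats[OF b b']
  show "dim_row (odot (hcat a a') (vcat b b')) = dim_row (add_mats T (odot a b) (odot a' b'))"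
    "dim_col (odot (hcat a a') (vcat b b')) = dim_col (add_mats T (odot a b) (odot a' b'))"
    using odot_carrier[OF h v] d by auto
  fix i j assume "i < dim_row (add_mats T (odot a b) (odot a' b'))" "j < dim_col (add_mats T (odot a b) (odot a' b'))"
  hence ij: "i < n" "j < m" using d by auto
  let ?f = "\<lambda>t. pure (hcat a a' $$ (i, t)) (vcat b b' $$ (t, j))"
  have "odot (hcat a a') (vcat b b') $$ (i, j) = finsum T ?f {..<k} \<oplus>\<^bsub>T\<^esub> finsum T (\<lambda>t. ?f (k + t)) {..<l}"
    unfolding odot_index[OF h v ij] by (rule T.finsum_lessThan_add) (rule odot_entries[OF h v ij])
  also have "finsum T ?f {..<k} = odot a b $$ (i, j)"
    unfolding odot_index[OF a b ij]
    by (rule T.finsum_cong') (use ij odot_entries[OF a b ij] matsD[OF a] matsD[OF b] matsD[OF a'] matsD[OF b'] in \<open>auto simp: hcat_def vcat_def\<close>)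
  also have "finsum T (\<lambda>t. ?f (k + t)) {..<l} = odot a' b' $$ (i, j)"
    unfolding odot_index[OF a' b' ij]
    by (rule T.finsum_cong') (use ij odot_entries[OF a' b' ij] matsD[OF a] matsD[OF b] matsD[OF a'] matsD[OF b'] in \<open>auto simp: hcat_def vcat_def\<close>)
  finally show "odot (hcat a a') (vcat b b') $$ (i, j) = add_mats T (odot a b) (odot a' b') $$ (i, j)"
    using odot_carrier[OF a b] ij by (simp add: add_mats_def)
qed

lemma odot_smult_left:
  assumes a: "a \<in> mats V n k" and b: "b \<in> mats W k m"
  shows "odot (map_mat (\<lambda>v. c \<odot>\<^bsub>V\<^esub> v) a) b = map_mat (\<lambda>t. c \<odot>\<^bsub>T\<^esub> t) (odot a b)"
proof (rule eq_matI)
  note ca = A.smult_mats[OF a, of c]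
  show "dim_row (odot (map_mat (\<lambda>v. c \<odot>\<^bsub>V\<^esub> v) a) b) = dim_row (map_mat (\<lambda>t. c \<odot>\<^bsub>T\<^esub> t) (odot a b))"
    "dim_col (odot (map_mat (\<lambda>v. c \<odot>\<^bsub>V\<^esub> v) a) b) = dim_col (map_mat (\<lambda>t. c \<odot>\<^bsub>T\<^esub> t) (odot a b))"
    by (simp_all add: tensor_mat_prod_def)
  fix i j assume "i < dim_row (map_mat (\<lambda>t. c \<odot>\<^bsub>T\<^esub> t) (odot a b))" "j < dim_col (map_mat (\<lambda>t. c \<odot>\<^bsub>T\<^esub> t) (odot a b))"
  hence ij: "i < n" "j < m" using odot_carrier[OF a b] by auto
  have "odot (map_mat (\<lambda>v. c \<odot>\<^bsub>V\<^esub> v) a) b $$ (i, j) = finsum T (\<lambda>l. c \<odot>\<^bsub>T\<^esub> pure (a $$ (i, l)) (b $$ (l, j))) {..<k}"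
    unfolding odot_index[OF ca b ij]
    by (rule T.finsum_cong') (use ij odot_entries[OF a b ij] matsD[OF a] matsE[OF a] matsE[OF b] in \<open>auto simp: pure_smult_left\<close>)
  also have "\<dots> = c \<odot>\<^bsub>T\<^esub> odot a b $$ (i, j)"
    unfolding odot_index[OF a b ij] using odot_entries[OF a b ij] by (intro T.finsum_smult[symmetric]) auto
  finally show "odot (map_mat (\<lambda>v. c \<odot>\<^bsub>V\<^esub> v) a) b $$ (i, j) = map_mat (\<lambda>t. c \<odot>\<^bsub>T\<^esub> t) (odot a b) $$ (i, j)"
    using odot_carrier[OF a b] ij by simp
qed

lemma odot_rescale:
  assumes a: "a \<in> mats V n k" and b: "b \<in> mats W k m" and c: "c \<noteq> 0"
  shows "odot (map_mat (\<lambda>v. c \<odot>\<^bsub>V\<^esub> v) a) (map_mat (\<lambda>w. (1/c) \<odot>\<^bsub>W\<^esub> w) b) = odot a b"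
proof (rule eq_matI)
  note ca = A.smult_mats[OF a, of c] and cb = B.smult_mats[OF b, of "1/c"]
  show "dim_row (odot (map_mat (\<lambda>v. c \<odot>\<^bsub>V\<^esub> v) a) (map_mat (\<lambda>w. (1/c) \<odot>\<^bsub>W\<^esub> w) b)) = dim_row (odot a b)"
    "dim_col (odot (map_mat (\<lambda>v. c \<odot>\<^bsub>V\<^esub> v) a) (map_mat (\<lambda>w. (1/c) \<odot>\<^bsub>W\<^esub> w) b)) = dim_col (odot a b)"
    by (simp_all add: tensor_mat_prod_def)
  fix i j assume "i < dim_row (odot a b)" "j < dim_col (odot a b)"
  hence ij: "i < n" "j < m" using odot_carrier[OF a b] by auto
  show "odot (map_mat (\<lambda>v. c \<odot>\<^bsub>V\<^esub> v) a) (map_mat (\<lambda>w. (1/c) \<odot>\<^bsub>W\<^esub> w) b) $$ (i, j) = odot a b $$ (i, j)"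
    unfolding odot_index[OF ca cb ij] odot_index[OF a b ij]
    by (rule T.finsum_cong')
      (use ij odot_entries[OF a b ij] matsD[OF a] matsD[OF b] matsE[OF a] matsE[OF b] c in
        \<open>auto simp: pure_smult_left pure_smult_right T.smult_smult pure_closed\<close>)
qed

lemma odot_place:
  assumes a: "a \<in> mats V 1 k" and b: "b \<in> mats W k 1" and ij: "i < n" "j < n"
  defines "a' \<equiv> mat n k (\<lambda>(i', l). if i' = i then a $$ (0, l) else \<zero>\<^bsub>V\<^esub>)"
    and "b' \<equiv> mat k n (\<lambda>(l, j'). if j' = j then b $$ (l, 0) else \<zero>\<^bsub>W\<^esub>)"
  shows "a' \<in> mats V n k" "b' \<in> mats W k n"
    "odot a' b' = mat n n (\<lambda>ij'. if ij' = (i, j) then odot a b $$ (0, 0) else \<zero>\<^bsub>T\<^esub>)"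
proof -
  show a': "a' \<in> mats V n k" using matsE[OF a] by (auto simp: a'_def mats_iff)
  show b': "b' \<in> mats W k n" using matsE[OF b] by (auto simp: b'_def mats_iff)
  show "odot a' b' = mat n n (\<lambda>ij'. if ij' = (i, j) then odot a b $$ (0, 0) else \<zero>\<^bsub>T\<^esub>)"
  proof (rule eq_matI)
    fix p q assume "p < dim_row (mat n n (\<lambda>ij'. if ij' = (i, j) then odot a b $$ (0, 0) else \<zero>\<^bsub>T\<^esub>))"
      "q < dim_col (mat n n (\<lambda>ij'. if ij' = (i, j) then odot a b $$ (0, 0) else \<zero>\<^bsub>T\<^esub>))"
    hence pq: "p < n" "q < n" by auto
    show "odot a' b' $$ (p, q) = mat n n (\<lambda>ij'. if ij' = (i, j) then odot a b $$ (0, 0) else \<zero>\<^bsub>T\<^esub>) $$ (p, q)"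
    proof (cases "p = i \<and> q = j")
      case True
      have one: "0 < (1 :: nat)" by simp
      have "odot a' b' $$ (p, q) = odot a b $$ (0, 0)"
        unfolding odot_index[OF a' b' pq] odot_index[OF a b one one]
        by (rule T.finsum_cong') (use True pq odot_entries[OF a b, of 0 0] in \<open>auto simp: a'_def b'_def\<close>)
      thus ?thesis using True pq by simp
    next
      case False
      have "odot a' b' $$ (p, q) = finsum T (\<lambda>_. \<zero>\<^bsub>T\<^esub>) {..<k}"
        unfolding odot_index[OF a' b' pq]
        by (rule T.finsum_cong') (use False pq matsE[OF a] matsE[OF b] in \<open>auto simp: a'_def b'_def pure_zero_left pure_zero_right\<close>)
      thus ?thesis using False pq by auto
    qed
  qed (use odot_carrier[OF a' b'] in auto)
qed

lemma odot_mat1: "v \<in> carrier V \<Longrightarrow> w \<in> carrier W \<Longrightarrow> odot (mat1 v) (mat1 w) = mat1 (pure v w)"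
  by (rule eq_matI) (auto simp: tensor_mat_prod_def pure_closed lessThan_Suc)

text \<open>
  The infimum in the Haagerup norm is taken over a nonempty set.
\<close>

lemma factorization_exists:
  assumes "u \<in> mats T n n"
  shows "\<exists>k. \<exists>a\<in>mats V n k. \<exists>b\<in>mats W k n. u = odot a b"
  using assms
proof (induction u rule: T.mats_induct)
  case zero
  have "odot (mat n 0 (\<lambda>_. \<zero>\<^bsub>V\<^esub>)) (mat 0 n (\<lambda>_. \<zero>\<^bsub>W\<^esub>)) = zero_mats T n n"
    by (rule eq_matI) (auto simp: tensor_mat_prod_def zero_mats_def)
  moreover have "mat n 0 (\<lambda>_. \<zero>\<^bsub>V\<^esub>) \<in> mats V n 0" "mat 0 n (\<lambda>_. \<zero>\<^bsub>W\<^esub>) \<in> mats W 0 n" by (auto simp: mats_iff)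
  ultimately show ?case by metis
next
  case (add x y)
  thus ?case using odot_cat hcat_mats vcat_mats by metis
next
  case (single i j t)
  have "\<exists>k. \<exists>a\<in>mats V 1 k. \<exists>b\<in>mats W k 1. mat1 t = odot a b"
    using single(3)
  proof (induction t rule: T_induct)
    case zero
    have "odot (mat 1 0 (\<lambda>_. \<zero>\<^bsub>V\<^esub>)) (mat 0 1 (\<lambda>_. \<zero>\<^bsub>W\<^esub>)) = mat1 \<zero>\<^bsub>T\<^esub>"
      by (rule eq_matI) (auto simp: tensor_mat_prod_def)
    moreover have "mat 1 0 (\<lambda>_. \<zero>\<^bsub>V\<^esub>) \<in> mats V 1 0" "mat 0 1 (\<lambda>_. \<zero>\<^bsub>W\<^esub>) \<in> mats W 0 1" by (auto simp: mats_iff)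
    ultimately show ?case by metis
  next
    case (add v w t)
    then obtain k a b where ab: "a \<in> mats V 1 k" "b \<in> mats W k 1" "mat1 t = odot a b" by blast
    have "mat1 (pure v w \<oplus>\<^bsub>T\<^esub> t) = add_mats T (mat1 (pure v w)) (mat1 t)"
      by (rule eq_matI) (auto simp: add_mats_def)
    also have "\<dots> = odot (hcat (mat1 v) a) (vcat (mat1 w) b)"
      using odot_cat[OF mat1_mats[OF add(1)] mat1_mats[OF add(2)] ab(1,2)] odot_mat1[OF add(1,2)] ab(3) by simp
    finally show ?case
      using hcat_mats[OF mat1_mats[OF add(1)] ab(1)] vcat_mats[OF mat1_mats[OF add(2)] ab(2)] by blast
  qed
  then obtain k a b where ab: "a \<in> mats V 1 k" "b \<in> mats W k 1" "mat1 t = odot a b" by blast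
  have "t = odot a b $$ (0, 0)" unfolding ab(3)[symmetric] by simp
  thus ?case using odot_place[OF ab(1,2) single(1,2)] by metis
qed

abbreviation AH where "AH \<equiv> alg_haagerup V W"

lemma AH_simps [simp]: "carrier AH = carrier T" "add AH = add T" "smult AH = smult T" "zero AH = zero T"
  "mats AH = mats T" "add_mats AH = add_mats T"
  by (simp_all add: alg_haagerup_def)

lemma AH_norm_alt:
  assumes u: "u \<in> mats T n n"
  shows "mnorm AH u = Inf {rect_norm V a * rect_norm W b | a b k. a \<in> mats V n k \<and> b \<in> mats W k n \<and> u = odot a b}"
  using matsD[OF u] by (simp add: alg_haagerup_def)

lemma AH_norm_le:
  assumes a: "a \<in> mats V n k" and b: "b \<in> mats W k n"
  shows "mnorm AH (odot a b) \<le> rect_norm V a * rect_norm W b"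
  unfolding AH_norm_alt[OF odot_mats[OF a b]]
proof (rule cInf_lower)
  show "bdd_below {rect_norm V a' * rect_norm W b' |a' b' k. a' \<in> mats V n k \<and> b' \<in> mats W k n \<and> odot a b = odot a' b'}"
    by (rule bdd_belowI[of _ 0]) (auto intro!: mult_nonneg_nonneg A.rect_norm_nonneg B.rect_norm_nonneg)
qed (use a b in blast)

lemma AH_norm_greatest:
  assumes u: "u \<in> mats T n n"
    and le: "\<And>a b k. a \<in> mats V n k \<Longrightarrow> b \<in> mats W k n \<Longrightarrow> u = odot a b \<Longrightarrow> c \<le> rect_norm V a * rect_norm W b"
  shows "c \<le> mnorm AH u"
  unfolding AH_norm_alt[OF u]
  by (rule cInf_greatest) (use factorization_exists[OF u] le in blast)+

text \<open>
  A factorization close to the infimum can be rescaled so that both factors have the same bound.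
\<close>

lemma AH_norm_factor:
  assumes u: "u \<in> mats T n n" and c: "mnorm AH u < c\<^sup>2" "c > 0"
  shows "\<exists>k. \<exists>a\<in>mats V n k. \<exists>b\<in>mats W k n. u = odot a b \<and> rect_norm V a \<le> c \<and> rect_norm W b \<le> c"
proof -
  have "\<exists>r\<in>{rect_norm V a * rect_norm W b | a b k. a \<in> mats V n k \<and> b \<in> mats W k n \<and> u = odot a b}. r < c\<^sup>2"
    using c(1) factorization_exists[OF u] unfolding AH_norm_alt[OF u] by (intro cInf_lessD) blast+
  then obtain k a b where ab: "a \<in> mats V n k" "b \<in> mats W k n" "u = odot a b" "rect_norm V a * rect_norm W b < c\<^sup>2"
    by blast
  define \<alpha> \<beta> where "\<alpha> = rect_norm V a" and "\<beta> = rect_norm W b"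
  have nn: "0 \<le> \<alpha>" "0 \<le> \<beta>" using A.rect_norm_nonneg[OF ab(1)] B.rect_norm_nonneg[OF ab(2)] by (auto simp: \<alpha>_def \<beta>_def)
  have "\<exists>s>0. s * \<alpha> \<le> c \<and> 1 / s * \<beta> \<le> c"
  proof (cases "\<alpha> = 0")
    case True
    \<comment> \<open>The summand \<open>1\<close> keeps the scaling factor positive when both norms vanish.\<close>
    show ?thesis using True nn c by (intro exI[of _ "(\<beta> + 1) / c"]) (auto simp: field_simps)
  next
    case False
    show ?thesis using False nn c ab(4)
      by (intro exI[of _ "c / \<alpha>"]) (auto simp: field_simps power2_eq_square \<alpha>_def[symmetric] \<beta>_def[symmetric])
  qed
  then obtain s where s: "s > 0" "s * \<alpha> \<le> c" "1 / s * \<beta> \<le> c" by blast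
  let ?s = "complex_of_real s"
  have "rect_norm V (map_mat (\<lambda>v. ?s \<odot>\<^bsub>V\<^esub> v) a) \<le> c"
    using A.rect_norm_smult[OF ab(1), of ?s] s by (simp add: \<alpha>_def)
  moreover have "rect_norm W (map_mat (\<lambda>w. (1 / ?s) \<odot>\<^bsub>W\<^esub> w) b) \<le> c"
    using B.rect_norm_smult[OF ab(2), of "1 / ?s"] s by (simp add: \<beta>_def norm_divide)
  moreover have "u = odot (map_mat (\<lambda>v. ?s \<odot>\<^bsub>V\<^esub> v) a) (map_mat (\<lambda>w. (1 / ?s) \<odot>\<^bsub>W\<^esub> w) b)"
    using odot_rescale[OF ab(1,2), of ?s] s ab(3) by simp
  ultimately show ?thesis using A.smult_mats[OF ab(1)] B.smult_mats[OF ab(2)] by blast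
qed

text \<open>
  With balanced factors of norm \<open>c\<close> and \<open>d\<close> the concatenations have norm at most
  \<open>sqrt (c\<^sup>2 + d\<^sup>2)\<close> each, and the product of these two bounds is the sum of the Haagerup norms up to
  \<open>\<epsilon>\<close>.
\<close>

lemma AH_sem: "matrix_seminormed AH"
proof (rule matrix_seminormed.intro)
  show "cvs AH" unfolding alg_haagerup_def by (intro cvs_with_mnorm T.cvs_axioms)
  show "matrix_seminormed_axioms AH"
  proof
    have nn: "0 \<le> mnorm AH u" if "u \<in> mats T n n" for u n
      using that by (rule AH_norm_greatest) (intro mult_nonneg_nonneg A.rect_norm_nonneg B.rect_norm_nonneg)
    have tri: "mnorm AH (add_mats T u v) \<le> mnorm AH u + mnorm AH v"
      if u: "u \<in> mats T n n" and v: "v \<in> mats T n n" for u v n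
    proof (rule field_le_epsilon)
      fix e :: real assume e: "e > 0"
      define c where "c = sqrt (mnorm AH u + e / 2)"
      define d where "d = sqrt (mnorm AH v + e / 2)"
      have c: "c > 0" "c\<^sup>2 = mnorm AH u + e / 2" and d: "d > 0" "d\<^sup>2 = mnorm AH v + e / 2"
        using nn[OF u] nn[OF v] e by (auto simp: c_def d_def)
      have uc: "mnorm AH u < c\<^sup>2" and vd: "mnorm AH v < d\<^sup>2" using c(2) d(2) e by auto
      obtain k a b where ab: "a \<in> mats V n k" "b \<in> mats W k n" "u = odot a b" "rect_norm V a \<le> c" "rect_norm W b \<le> c"
        using AH_norm_factor[OF u uc c(1)] by blast
      obtain l a' b' where ab': "a' \<in> mats V n l" "b' \<in> mats W l n" "v = odot a' b'" "rect_norm V a' \<le> d" "rect_norm W b' \<le> d"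
        using AH_norm_factor[OF v vd d(1)] by blast
      note h = hcat_mats[OF ab(1) ab'(1)] and w = vcat_mats[OF ab(2) ab'(2)]
      have "mnorm AH (add_mats T u v) \<le> rect_norm V (hcat a a') * rect_norm W (vcat b b')"
        using AH_norm_le[OF h w] odot_cat[OF ab(1,2) ab'(1,2)] ab(3) ab'(3) by simp
      also have "\<dots> \<le> sqrt (c\<^sup>2 + d\<^sup>2) * sqrt (c\<^sup>2 + d\<^sup>2)"
        using A.rect_norm_hcat[OF ab(1) ab'(1) c(1) d(1) ab(4) ab'(4)] B.rect_norm_vcat[OF ab(2) ab'(2) c(1) d(1) ab(5) ab'(5)]
        by (intro mult_mono B.rect_norm_nonneg[OF w]) auto
      also have "\<dots> = mnorm AH u + mnorm AH v + e" using c(2) d(2) nn[OF u] nn[OF v] e by simp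
      finally show "mnorm AH (add_mats T u v) \<le> mnorm AH u + mnorm AH v + e" .
    qed
    have hom: "mnorm AH (map_mat (\<lambda>t. c \<odot>\<^bsub>T\<^esub> t) u) \<le> cmod c * mnorm AH u" if u: "u \<in> mats T n n" for u c n
    proof -
      have key: "mnorm AH (map_mat (\<lambda>t. c \<odot>\<^bsub>T\<^esub> t) u) \<le> cmod c * (rect_norm V a * rect_norm W b)"
        if ab: "a \<in> mats V n k" "b \<in> mats W k n" "u = odot a b" for a b k
      proof -
        have "mnorm AH (map_mat (\<lambda>t. c \<odot>\<^bsub>T\<^esub> t) u) \<le> rect_norm V (map_mat (\<lambda>v. c \<odot>\<^bsub>V\<^esub> v) a) * rect_norm W b"
          using AH_norm_le[OF A.smult_mats[OF ab(1), of c] ab(2)] odot_smult_left[OF ab(1,2), of c] ab(3) by simp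
        also have "\<dots> \<le> cmod c * rect_norm V a * rect_norm W b"
          by (intro mult_right_mono A.rect_norm_smult[OF ab(1)] B.rect_norm_nonneg[OF ab(2)])
        finally show ?thesis by (simp add: mult.assoc)
      qed
      show ?thesis
      proof (cases "c = 0")
        case True
        obtain k a b where ab: "a \<in> mats V n k" "b \<in> mats W k n" "u = odot a b" using factorization_exists[OF u] by blast
        show ?thesis using key[OF ab] True by simp
      next
        case False
        have "mnorm AH (map_mat (\<lambda>t. c \<odot>\<^bsub>T\<^esub> t) u) / cmod c \<le> mnorm AH u"
          by (rule AH_norm_greatest[OF u]) (use key False in \<open>simp add: field_simps\<close>)
        thus ?thesis using False by (simp add: field_simps)
      qed
    qed
    show "mat_seminorm AH (mnorm AH)"
      unfolding mat_seminorm_def AH_simps using nn tri hom by blast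
  qed
qed

text \<open>
  A factorization of one entry, with its row moved to row \<open>i\<close> and its column to column \<open>j\<close>, is a
  factorization of the single-entry matrix.
\<close>

lemma AH_entries: "entry_bounded AH (mnorm AH)"
proof (rule cvs.entry_boundedI)
  interpret S: matrix_seminormed AH by (rule AH_sem)
  show "cvs AH" by (rule S.cvs_axioms)
  show "mat_seminorm AH (mnorm AH)" by (rule S.seminorm)
  fix n i j :: nat and t assume ij: "i < n" "j < n" and "t \<in> carrier AH"
  hence t: "t \<in> carrier T" by simp
  show "mnorm AH (mat n n (\<lambda>ij. if ij = (i, j) then t else \<zero>\<^bsub>AH\<^esub>)) \<le> mnorm AH (mat1 t)"
  proof (rule AH_norm_greatest[OF mat1_mats[OF t]])
    fix a b k assume ab: "a \<in> mats V 1 k" "b \<in> mats W k 1" "mat1 t = odot a b"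
    have t: "odot a b $$ (0, 0) = t" unfolding ab(3)[symmetric] by simp
    note p = odot_place[OF ab(1,2) ij]
    show "mnorm AH (mat n n (\<lambda>ij. if ij = (i, j) then t else \<zero>\<^bsub>AH\<^esub>)) \<le> rect_norm V a * rect_norm W b"
      using order_trans[OF AH_norm_le[OF p(1,2)]
          mult_mono[OF A.rect_norm_row[OF ab(1) ij(1)] B.rect_norm_col[OF ab(2) ij(2)]
            A.rect_norm_nonneg[OF ab(1)] B.rect_norm_nonneg[OF p(2)]]]
      unfolding p(3) t AH_simps .
  qed
qed

sublocale AH: matrix_seminormed_entries AH
  by (intro matrix_seminormed_entries.intro AH_sem matrix_seminormed_entries_axioms.intro AH_entries)

lemma os_norm_pure: "v \<in> carrier V \<Longrightarrow> w \<in> carrier W \<Longrightarrow> os_norm AH (pure v w) \<le> os_norm V v * os_norm W w"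
  using AH_norm_le[OF mat1_mats mat1_mats, of v w] A.rect_norm_mat1[of v] B.rect_norm_mat1[of w]
  by (simp add: os_norm_def[of AH] odot_mat1[simplified])

end

section \<open>The operator space dual\<close>

lemma sum_lessThan_mult: "(\<Sum>r<m * n. g r) = (\<Sum>p<m. \<Sum>k<n. g (p * n + k))" for g :: "nat \<Rightarrow> 'b::comm_monoid_add"
proof (induction m)
  case (Suc m)
  have "(\<Sum>r<Suc m * n. g r) = (\<Sum>r<m * n + n. g r)" by (simp add: add.commute)
  thus ?case using Suc by (simp add: sum_lessThan_add)
qed simp

lemma nrm2_lessThan_mult: "nrm2 {..<m * n :: nat} f = nrm2 ({..<m} \<times> {..<n}) (\<lambda>(p, k). f (p * n + k))"
  by (simp add: L2_set_def sum_lessThan_mult sum.cartesian_product')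

text \<open>
  The rows of a matrix in \<open>M\<^sub>m(M\<^sub>n) = M\<^sub>m\<^sub>n\<close> are numbered by \<open>r = p n + k\<close>, which turns the operator norm of
  the large matrix into the norm of a form; the norms of the dual space are suprema of such norms.
\<close>

lemma matrix_os_norm:
  assumes x: "x \<in> carrier_mat m m" and \<Phi>: "\<Phi> \<in> carrier_mat n n"
  shows "mnorm (matrix_os n) (map_mat (\<lambda>v. map_mat (\<lambda>\<phi>. \<phi> v) \<Phi>) x) = fnorm {..<n} {..<n} (\<lambda>k l. \<Phi> $$ (k, l)) x"
proof -
  define M where "M = mat (m * n) (m * n) (\<lambda>(r, s). (\<Phi> $$ (r mod n, s mod n)) (x $$ (r div n, s div n)))"
  have Mc: "M \<in> carrier_mat (m * n) (m * n)" by (simp add: M_def)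
  have dm: "r div n < m \<and> r mod n < n" if "r < m * n" for r
  proof -
    have "n > 0" using that by (cases n) auto
    thus ?thesis using that by (simp add: less_mult_imp_div_less)
  qed
  have "mat (m * n) (m * n) (\<lambda>(r, s). (map_mat (\<lambda>v. map_mat (\<lambda>\<phi>. \<phi> v) \<Phi>) x $$ (r div n, s div n)) $$ (r mod n, s mod n)) = M"
    unfolding M_def by (rule eq_matI) (use x \<Phi> dm in auto)
  hence eq: "mnorm (matrix_os n) (map_mat (\<lambda>v. map_mat (\<lambda>\<phi>. \<phi> v) \<Phi>) x) = mat_opnorm M"
    using x by (simp add: matrix_os_def)
  have idx: "p * n + k < m * n" if "p < m" "k < n" for p k
  proof -
    have "p * n + k < p * n + n" using that by simp
    also have "\<dots> = Suc p * n" by simp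
    also have "\<dots> \<le> m * n" using that by (intro mult_right_mono) auto
    finally show ?thesis .
  qed
  have form: "(\<Sum>r<m * n. \<Sum>s<m * n. \<eta> r * M $$ (r, s) * \<xi> s)
      = mform {..<n} {..<n} (\<lambda>k l. \<Phi> $$ (k, l)) x (\<lambda>(p, k). \<eta> (p * n + k)) (\<lambda>(q, l). \<xi> (q * n + l))" for \<eta> \<xi>
  proof -
    have "(\<Sum>r<m * n. \<Sum>s<m * n. \<eta> r * M $$ (r, s) * \<xi> s)
        = (\<Sum>p<m. \<Sum>k<n. \<Sum>q<m. \<Sum>l<n. \<eta> (p * n + k) * M $$ (p * n + k, q * n + l) * \<xi> (q * n + l))"
      by (simp add: sum_lessThan_mult)
    also have "\<dots> = (\<Sum>p<m. \<Sum>k<n. \<Sum>q<m. \<Sum>l<n. \<eta> (p * n + k) * (\<Phi> $$ (k, l)) (x $$ (p, q)) * \<xi> (q * n + l))"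
      by (intro sum.cong refl) (auto simp: M_def idx)
    also have "\<dots> = (\<Sum>p<m. \<Sum>q<m. \<Sum>k<n. \<Sum>l<n. \<eta> (p * n + k) * (\<Phi> $$ (k, l)) (x $$ (p, q)) * \<xi> (q * n + l))"
      by (intro sum.cong refl sum.swap)
    finally show ?thesis using x by (simp add: mform_def)
  qed
  show ?thesis unfolding eq
  proof (rule antisym)
    show "mat_opnorm M \<le> fnorm {..<n} {..<n} (\<lambda>k l. \<Phi> $$ (k, l)) x"
      by (rule mat_opnorm_leI[OF Mc fnorm_nonneg])
        (auto simp: form nrm2_lessThan_mult intro!: fnorm_bound[OF _ _ x])
    show "fnorm {..<n} {..<n} (\<lambda>k l. \<Phi> $$ (k, l)) x \<le> mat_opnorm M"
    proof (rule fnorm_leI[OF x mat_opnorm_nonneg])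
      fix \<eta> \<xi> :: "nat \<times> nat \<Rightarrow> complex"
      let ?\<eta> = "\<lambda>r. \<eta> (r div n, r mod n)" and ?\<xi> = "\<lambda>s. \<xi> (s div n, s mod n)"
      have f: "mform {..<n} {..<n} (\<lambda>k l. \<Phi> $$ (k, l)) x \<eta> \<xi> = (\<Sum>r<m * n. \<Sum>s<m * n. ?\<eta> r * M $$ (r, s) * ?\<xi> s)"
        unfolding form by (auto simp: mform_def intro!: sum.cong)
      have e: "nrm2 {..<m * n} (\<lambda>r. h (r div n, r mod n)) = nrm2 ({..<m} \<times> {..<n}) h" for h :: "nat \<times> nat \<Rightarrow> complex"
        unfolding nrm2_lessThan_mult by (rule L2_set_cong) auto
      show "cmod (mform {..<n} {..<n} (\<lambda>k l. \<Phi> $$ (k, l)) x \<eta> \<xi>)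
          \<le> mat_opnorm M * nrm2 ({..<m} \<times> {..<n}) \<eta> * nrm2 ({..<m} \<times> {..<n}) \<xi>"
        using mat_opnorm_bound[OF Mc, of ?\<eta> ?\<xi>] unfolding f e .
    qed
  qed
qed

lemma cvs_complex_module: "cvs complex_module"
  by (rule cvsI) (auto simp: complex_module_def algebra_simps)

lemma linear_map_iff:
  assumes "cvs V" "cvs W"
  shows "linear_map class_ring V W T \<longleftrightarrow> (\<forall>v\<in>carrier V. T v \<in> carrier W) \<and>
     (\<forall>v\<in>carrier V. \<forall>w\<in>carrier V. T (v \<oplus>\<^bsub>V\<^esub> w) = T v \<oplus>\<^bsub>W\<^esub> T w) \<and>
     (\<forall>v\<in>carrier V. \<forall>c. T (c \<odot>\<^bsub>V\<^esub> v) = c \<odot>\<^bsub>W\<^esub> T v)"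
  using assms cvs.is_module[OF assms(1)] cvs.is_module[OF assms(2)]
  by (auto simp: linear_map_def mod_hom_def mod_hom_axioms_def cvs_def LinearCombinations.module_hom_def Pi_iff)

context matrix_seminormed begin

abbreviation D where "D \<equiv> dual_os V"

lemma dual_carrier_iff: "\<phi> \<in> carrier D \<longleftrightarrow> \<phi> \<in> extensional (carrier V) \<and> linear_on V \<phi> \<and>
    (\<exists>K. \<forall>v\<in>carrier V. cmod (\<phi> v) \<le> K * os_norm V v)"
  unfolding dual_os_def using linear_map_iff[OF cvs_axioms cvs_complex_module]
  by (auto simp: linear_on_def complex_module_def)

lemma dual_simps: "zero D = (\<lambda>v\<in>carrier V. 0)" "add D = (\<lambda>\<phi> \<psi>. \<lambda>v\<in>carrier V. \<phi> v + \<psi> v)"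
  "smult D = (\<lambda>c \<phi>. \<lambda>v\<in>carrier V. c * \<phi> v)"
  by (simp_all add: dual_os_def)

lemma dual_restrict:
  assumes "linear_on V \<phi>" "\<And>v. v \<in> carrier V \<Longrightarrow> cmod (\<phi> v) \<le> K * os_norm V v"
  shows "restrict \<phi> (carrier V) \<in> carrier D"
  using assms unfolding dual_carrier_iff by (auto simp: linear_on_def)

lemma cvs_dual: "cvs D"
proof (rule cvsI)
  show "\<zero>\<^bsub>D\<^esub> \<in> carrier D"
    unfolding dual_simps by (rule dual_restrict[of _ 0]) (auto simp: linear_on_def)
  fix \<phi> c assume \<phi>: "\<phi> \<in> carrier D"
  then obtain K where K: "\<And>v. v \<in> carrier V \<Longrightarrow> cmod (\<phi> v) \<le> K * os_norm V v" by (auto simp: dual_carrier_iff)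
  have lin: "linear_on V \<phi>" using \<phi> by (simp add: dual_carrier_iff)
  show "c \<odot>\<^bsub>D\<^esub> \<phi> \<in> carrier D"
    unfolding dual_simps
  proof (rule dual_restrict)
    show "linear_on V (\<lambda>v. c * \<phi> v)" using lin by (auto simp: linear_on_def algebra_simps)
    show "cmod (c * \<phi> v) \<le> (cmod c * K) * os_norm V v" if "v \<in> carrier V" for v
      using mult_left_mono[OF K[OF that], of "cmod c"] by (simp add: norm_mult mult.assoc)
  qed
  fix \<psi> assume \<psi>: "\<psi> \<in> carrier D"
  then obtain K' where K': "\<And>v. v \<in> carrier V \<Longrightarrow> cmod (\<psi> v) \<le> K' * os_norm V v" by (auto simp: dual_carrier_iff)
  have lin': "linear_on V \<psi>" using \<psi> by (simp add: dual_carrier_iff)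
  show "\<phi> \<oplus>\<^bsub>D\<^esub> \<psi> \<in> carrier D"
    unfolding dual_simps
  proof (rule dual_restrict)
    show "linear_on V (\<lambda>v. \<phi> v + \<psi> v)" using lin lin' by (auto simp: linear_on_def algebra_simps)
    show "cmod (\<phi> v + \<psi> v) \<le> (K + K') * os_norm V v" if "v \<in> carrier V" for v
      using norm_triangle_mono[OF K[OF that] K'[OF that]] by (simp add: algebra_simps)
  qed
qed (auto simp: dual_simps dual_carrier_iff algebra_simps extensional_def restrict_def fun_eq_iff)

lemma dual_mnorm:
  assumes "\<Phi> \<in> mats D n n"
  shows "mnorm D \<Phi> = Sup {fnorm {..<n} {..<n} (\<lambda>k l. \<Phi> $$ (k, l)) x | m x. x \<in> mats V m m \<and> mnorm V x \<le> 1}"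
proof -
  have "{mnorm (matrix_os n) (map_mat (\<lambda>v. map_mat (\<lambda>\<phi>. \<phi> v) \<Phi>) x) | m x. x \<in> mats V m m \<and> mnorm V x \<le> 1}
     = {fnorm {..<n} {..<n} (\<lambda>k l. \<Phi> $$ (k, l)) x | m x. x \<in> mats V m m \<and> mnorm V x \<le> 1}"
  proof (intro Collect_cong ex_cong1)
    fix r m x
    have "mnorm (matrix_os n) (map_mat (\<lambda>v. map_mat (\<lambda>\<phi>. \<phi> v) \<Phi>) x) = fnorm {..<n} {..<n} (\<lambda>k l. \<Phi> $$ (k, l)) x"
      if "x \<in> mats V m m" using matrix_os_norm[OF matsD(1)[OF that] matsD(1)[OF assms]] .
    thus "(r = mnorm (matrix_os n) (map_mat (\<lambda>v. map_mat (\<lambda>\<phi>. \<phi> v) \<Phi>) x) \<and> x \<in> mats V m m \<and> mnorm V x \<le> 1)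
       = (r = fnorm {..<n} {..<n} (\<lambda>k l. \<Phi> $$ (k, l)) x \<and> x \<in> mats V m m \<and> mnorm V x \<le> 1)" by auto
  qed
  thus ?thesis using matsD[OF assms] by (simp add: dual_os_def cb_norm_def)
qed

end

lemma fnorm_mat1_ge:
  assumes "finite S" "finite T" "k \<in> S" "l \<in> T"
  shows "cmod (\<pi> k l v) \<le> fnorm S T \<pi> (mat1 v)"
proof -
  let ?\<eta> = "\<lambda>(p :: nat, k'). if k' = k then 1 else 0 :: complex" and ?\<xi> = "\<lambda>(q :: nat, l'). if l' = l then 1 else 0 :: complex"
  have one: "nrm2 ({..<1 :: nat} \<times> S') (\<lambda>(p, k'). if k' = k0 then 1 else 0) = 1" if "finite S'" "k0 \<in> S'" for S' and k0 :: 'z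
  proof -
    have "(\<Sum>k'\<in>S'. (cmod (if k' = k0 then 1 else 0))\<^sup>2) = (\<Sum>k'\<in>S'. if k' = k0 then 1 else 0)"
      by (rule sum.cong) auto
    thus ?thesis using that by (simp add: L2_set_def sum.cartesian_product' lessThan_Suc)
  qed
  have "mform S T \<pi> (mat1 v) ?\<eta> ?\<xi> = (\<Sum>k'\<in>S. \<Sum>l'\<in>T. if k' = k then (if l' = l then \<pi> k l v else 0) else 0)"
    by (auto simp: mform_def lessThan_Suc intro!: sum.cong)
  also have "\<dots> = (\<Sum>k'\<in>S. if k' = k then \<pi> k l v else 0)"
    using assms by (intro sum.cong refl) auto
  also have "\<dots> = \<pi> k l v" using assms by simp
  finally show ?thesis
    using fnorm_bound[OF assms(1,2), of "mat1 v" 1 1 \<pi> ?\<eta> ?\<xi>] one[OF assms(1,3)] one[OF assms(2,4)] by simp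
qed

lemma has_sum_finite_sum:
  fixes f :: "'a \<Rightarrow> 'b \<Rightarrow> complex"
  assumes "finite A" "\<And>x. x \<in> A \<Longrightarrow> (f x has_sum s x) B"
  shows "((\<lambda>i. \<Sum>x\<in>A. f x i) has_sum (\<Sum>x\<in>A. s x)) B"
  using assms by (induction A) (auto intro!: has_sum_add)

locale lp2 = lp +
  assumes p2: "p \<le> 2"
begin

abbreviation M where "M \<equiv> max_os E"

sublocale N: normed_by E contractions by (rule normed_by_contractions)

sublocale haagerup_pair M M
  by (intro haagerup_pair.intro ruan_space.intro N.max_os_operator_space)

lemma M_simps [simp]: "carrier M = carrier E" "add M = add E" "smult M = smult E" "zero M = zero E"
  "mats M = mats E" "monoid.mult M = monoid.mult E"
  by (simp_all add: max_os_def)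

lemma M_os_norm: "v \<in> carrier E \<Longrightarrow> os_norm M v = vnorm E v"
  by (rule N.max_os_norm)

section \<open>Rows and columns over the maximal structure on p-summable families\<close>

text \<open>
  A row over the maximal structure acts on \<open>l\<^sup>2\<close> vectors from the left as an operator into the square-summable
  families of \<open>l\<^sup>2(J)\<close>-valued vectors, with norm at most its operator space norm.  This is the row
  Hilbert space estimate tested against all vectors \<open>g\<close>.
\<close>

lemma row_bound:
  assumes a: "a \<in> mats E m r" and J: "finite J" "J \<subseteq> I"
  shows "nrm2 ({..<r} \<times> J) (\<lambda>(t, i). \<Sum>p<m. \<eta> p * (a $$ (p, t)) i) \<le> rect_norm M a * nrm2 {..<m} \<eta>"
proof (rule nrm2_le_of_pairings)
  let ?\<pi> = "\<lambda>(_::unit) i (v :: 'a \<Rightarrow> complex). v i"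
  have aM: "a \<in> mats M m r" using a by simp
  show "0 \<le> rect_norm M a * nrm2 {..<m} \<eta>" using A.rect_norm_nonneg[OF aM] by simp
  fix g :: "nat \<times> 'a \<Rightarrow> complex"
  have "fnorm {()} J ?\<pi> a \<le> fnorm {()} J ?\<pi> (A.pad (max m r) a)"
    using J coord_linear by (intro A.fnorm_pad[OF _ _ _ aM]) (auto simp: linear_on_def)
  also have "\<dots> \<le> rect_norm M a"
    using row_form_le(1)[OF p2 J, of "A.pad (max m r) a" "max m r"] A.pad_mats[OF aM] by (simp add: A.rect_norm_pad[OF aM])
  finally have le: "fnorm {()} J ?\<pi> a \<le> rect_norm M a" .
  have "(\<Sum>z\<in>{..<r} \<times> J. (case z of (t, i) \<Rightarrow> \<Sum>p<m. \<eta> p * (a $$ (p, t)) i) * g z)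
      = mform {()} J ?\<pi> a (\<lambda>(p, _). \<eta> p) g"
    using matsD[OF a] by (simp add: mform_def sum.cartesian_product' sum_distrib_right
        sum.swap[of _ J "{..<m}"] sum.swap[of _ "{..<r}" "{..<m}"])
  also have "cmod \<dots> \<le> fnorm {()} J ?\<pi> a * nrm2 ({..<m} \<times> {()}) (\<lambda>(p, _). \<eta> p) * nrm2 ({..<r} \<times> J) g"
    by (rule fnorm_bound[OF _ J(1) matsD(1)[OF a]]) simp
  also have "\<dots> \<le> rect_norm M a * nrm2 {..<m} \<eta> * nrm2 ({..<r} \<times> J) g"
    using le by (simp add: nrm2_unit mult_right_mono)
  finally show "cmod (\<Sum>z\<in>{..<r} \<times> J. (case z of (t, i) \<Rightarrow> \<Sum>p<m. \<eta> p * (a $$ (p, t)) i) * g z)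
      \<le> rect_norm M a * nrm2 {..<m} \<eta> * nrm2 ({..<r} \<times> J) g" .
qed

lemma col_bound:
  assumes b: "b \<in> mats E r m" and J: "finite J" "J \<subseteq> I"
  shows "nrm2 ({..<r} \<times> J) (\<lambda>(t, i). \<Sum>q<m. \<xi> q * (b $$ (t, q)) i) \<le> rect_norm M b * nrm2 {..<m} \<xi>"
proof (rule nrm2_le_of_pairings)
  let ?\<pi> = "\<lambda>i (_::unit) (v :: 'a \<Rightarrow> complex). v i"
  have bM: "b \<in> mats M r m" using b by simp
  show "0 \<le> rect_norm M b * nrm2 {..<m} \<xi>" using A.rect_norm_nonneg[OF bM] by simp
  fix g :: "nat \<times> 'a \<Rightarrow> complex"
  have "fnorm J {()} ?\<pi> b \<le> fnorm J {()} ?\<pi> (A.pad (max r m) b)"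
    using J coord_linear by (intro A.fnorm_pad[OF _ _ _ bM]) (auto simp: linear_on_def)
  also have "\<dots> \<le> rect_norm M b"
    using row_form_le(2)[OF p2 J, of "A.pad (max r m) b" "max r m"] A.pad_mats[OF bM] by (simp add: A.rect_norm_pad[OF bM])
  finally have le: "fnorm J {()} ?\<pi> b \<le> rect_norm M b" .
  have "(\<Sum>z\<in>{..<r} \<times> J. (case z of (t, i) \<Rightarrow> \<Sum>q<m. \<xi> q * (b $$ (t, q)) i) * g z)
      = mform J {()} ?\<pi> b g (\<lambda>(q, _). \<xi> q)"
    using matsD[OF b] by (simp add: mform_def sum.cartesian_product' sum_distrib_left sum_distrib_right
        sum.swap[of _ J "{..<m}"] mult_ac)
  also have "cmod \<dots> \<le> fnorm J {()} ?\<pi> b * nrm2 ({..<r} \<times> J) g * nrm2 ({..<m} \<times> {()}) (\<lambda>(q, _). \<xi> q)"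
    by (rule fnorm_bound[OF J(1) _ matsD(1)[OF b]]) simp
  also have "\<dots> \<le> rect_norm M b * nrm2 {..<m} \<xi> * nrm2 ({..<r} \<times> J) g"
    using mult_right_mono[OF le, of "nrm2 {..<m} \<xi> * nrm2 ({..<r} \<times> J) g"] by (simp add: nrm2_unit mult_ac)
  finally show "cmod (\<Sum>z\<in>{..<r} \<times> J. (case z of (t, i) \<Rightarrow> \<Sum>q<m. \<xi> q * (b $$ (t, q)) i) * g z)
      \<le> rect_norm M b * nrm2 {..<m} \<xi> * nrm2 ({..<r} \<times> J) g" .
qed

section \<open>The functional given by a bounded family\<close>

definition weighted_pairing :: "('a \<Rightarrow> complex) \<Rightarrow> ('a \<Rightarrow> complex) \<Rightarrow> ('a \<Rightarrow> complex) \<Rightarrow> complex" where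
  "weighted_pairing f a b = (\<Sum>\<^sub>\<infinity>i\<in>I. f i * (a i * b i))"

lemma weighted_summable:
  assumes f: "f \<in> carrier (linf_space I)" and a: "a \<in> carrier E" and b: "b \<in> carrier E"
  shows "(\<lambda>i. f i * (a i * b i)) summable_on I"
proof -
  obtain C where C: "\<And>i. cmod (f i) \<le> C" using f by (auto simp: linf_carrier_iff)
  have C0: "0 \<le> C" using order_trans[OF norm_ge_zero C] .
  have "(\<lambda>i. cmod (f i * (a i * b i))) summable_on I"
  proof (rule nonneg_bdd_above_summable_on)
    show "bdd_above (sum (\<lambda>i. cmod (f i * (a i * b i))) ` {F. F \<subseteq> I \<and> finite F})"
    proof (rule bdd_aboveI2)
      fix J assume "J \<in> {F. F \<subseteq> I \<and> finite F}"
      hence J: "finite J" "J \<subseteq> I" by auto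
      have "(\<Sum>i\<in>J. cmod (f i * (a i * b i))) \<le> (\<Sum>i\<in>J. C * (\<bar>cmod (a i)\<bar> * \<bar>cmod (b i)\<bar>))"
        by (intro sum_mono) (simp add: norm_mult mult_right_mono C)
      also have "\<dots> \<le> C * (nrm2 J a * nrm2 J b)"
        unfolding sum_distrib_left[symmetric] by (intro mult_left_mono C0 L2_set_mult_ineq)
      also have "\<dots> \<le> C * (vnorm E a * vnorm E b)"
        by (intro mult_left_mono C0 mult_mono l2_le_vnorm[OF p2 a J] l2_le_vnorm[OF p2 b J] vnorm_nonneg L2_set_nonneg)
      finally show "(\<Sum>i\<in>J. cmod (f i * (a i * b i))) \<le> C * (vnorm E a * vnorm E b)" .
    qed
  qed auto
  thus ?thesis by (rule abs_summable_summable)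
qed

lemma weighted_linear:
  assumes f: "f \<in> carrier (linf_space I)"
  shows "b \<in> carrier M \<Longrightarrow> linear_on M (\<lambda>a. weighted_pairing f a b)"
    and "a \<in> carrier M \<Longrightarrow> linear_on M (weighted_pairing f a)"
proof -
  note s = weighted_summable[OF f]
  have scale: "weighted_pairing f (\<lambda>i. c * a i) b = c * weighted_pairing f a b"
    "weighted_pairing f a (\<lambda>i. c * b i) = c * weighted_pairing f a b" for a b c
    unfolding weighted_pairing_def infsum_cmult_right'[symmetric] by (simp_all add: mult_ac)
  have add1: "weighted_pairing f (\<lambda>i. a i + a' i) b = weighted_pairing f a b + weighted_pairing f a' b"
    if "a \<in> carrier E" "a' \<in> carrier E" "b \<in> carrier E" for a a' b
    unfolding weighted_pairing_def infsum_add[OF s[OF that(1,3)] s[OF that(2,3)], symmetric]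
    by (simp add: algebra_simps)
  have add2: "weighted_pairing f b (\<lambda>i. a i + a' i) = weighted_pairing f b a + weighted_pairing f b a'"
    if "a \<in> carrier E" "a' \<in> carrier E" "b \<in> carrier E" for a a' b
    unfolding weighted_pairing_def infsum_add[OF s[OF that(3,1)] s[OF that(3,2)], symmetric]
    by (simp add: algebra_simps)
  show "b \<in> carrier M \<Longrightarrow> linear_on M (\<lambda>a. weighted_pairing f a b)"
    by (simp add: linear_on_def lp_simps scale add1)
  show "a \<in> carrier M \<Longrightarrow> linear_on M (weighted_pairing f a)"
    by (simp add: linear_on_def lp_simps scale add2)
qed

lemma sum_bilinear_rearrange:
  fixes \<eta> \<xi> :: "nat \<times> nat \<Rightarrow> complex"
  shows "(\<Sum>p\<in>P. \<Sum>q\<in>Q. \<Sum>k\<in>S. \<Sum>l\<in>S. \<eta> (p, k) * (\<Sum>t\<in>R. g k l * (a p t * b t q)) * \<xi> (q, l))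
    = (\<Sum>t\<in>R. \<Sum>k\<in>S. \<Sum>l\<in>S. (\<Sum>p\<in>P. \<eta> (p, k) * a p t) * g k l * (\<Sum>q\<in>Q. \<xi> (q, l) * b t q))"
proof -
  have "(\<Sum>p\<in>P. \<Sum>q\<in>Q. \<Sum>k\<in>S. \<Sum>l\<in>S. \<eta> (p, k) * (\<Sum>t\<in>R. g k l * (a p t * b t q)) * \<xi> (q, l))
      = (\<Sum>k\<in>S. \<Sum>l\<in>S. \<Sum>p\<in>P. \<Sum>q\<in>Q. \<Sum>t\<in>R. \<eta> (p, k) * a p t * g k l * (\<xi> (q, l) * b t q))"
    by (subst sum_swap22) (simp add: sum_distrib_left sum_distrib_right mult_ac)
  also have "\<dots> = (\<Sum>k\<in>S. \<Sum>l\<in>S. \<Sum>t\<in>R. (\<Sum>p\<in>P. \<eta> (p, k) * a p t) * g k l * (\<Sum>q\<in>Q. \<xi> (q, l) * b t q))"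
  proof (intro sum.cong refl)
    fix k l
    have "(\<Sum>p\<in>P. \<Sum>q\<in>Q. \<Sum>t\<in>R. \<eta> (p, k) * a p t * g k l * (\<xi> (q, l) * b t q))
        = (\<Sum>t\<in>R. \<Sum>p\<in>P. \<Sum>q\<in>Q. \<eta> (p, k) * a p t * g k l * (\<xi> (q, l) * b t q))"
      using sum_swap22[of "\<lambda>p q t (_::unit). \<eta> (p, k) * a p t * g k l * (\<xi> (q, l) * b t q)" "{()}" R Q P] by simp
    also have "\<dots> = (\<Sum>t\<in>R. (\<Sum>p\<in>P. \<eta> (p, k) * a p t) * g k l * (\<Sum>q\<in>Q. \<xi> (q, l) * b t q))"
      by (simp add: sum_distrib_left sum_distrib_right mult_ac)
    finally show "(\<Sum>p\<in>P. \<Sum>q\<in>Q. \<Sum>t\<in>R. \<eta> (p, k) * a p t * g k l * (\<xi> (q, l) * b t q))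
        = (\<Sum>t\<in>R. (\<Sum>p\<in>P. \<eta> (p, k) * a p t) * g k l * (\<Sum>q\<in>Q. \<xi> (q, l) * b t q))" .
  qed
  also have "\<dots> = (\<Sum>t\<in>R. \<Sum>k\<in>S. \<Sum>l\<in>S. (\<Sum>p\<in>P. \<eta> (p, k) * a p t) * g k l * (\<Sum>q\<in>Q. \<xi> (q, l) * b t q))"
    using sum_swap22[of "\<lambda>k l t (_::unit). (\<Sum>p\<in>P. \<eta> (p, k) * a p t) * g k l * (\<Sum>q\<in>Q. \<xi> (q, l) * b t q)" "{()}" R S S] by simp
  finally show ?thesis .
qed

text \<open>
  The core estimate.  The form is the sum over \<open>t\<close> and \<open>i \<in> J\<close> of the scalar matrices
  \<open>(G\<^sub>k\<^sub>l(i))\<close> evaluated at the vectors \<open>x = \<eta> a\<close> and \<open>y = b \<xi>\<close> in the coordinate \<open>(t, i)\<close>.  Each matrix has norm at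
  most \<open>C\<close>, and by the Cauchy-Schwarz inequality the sum is at most \<open>C\<close> times the norms of \<open>x\<close> and \<open>y\<close>,
  which the row and column estimates control.
\<close>

lemma finite_pairing_bound:
  fixes n :: nat
  assumes a: "a \<in> mats E m r" and b: "b \<in> mats E r m" and J: "finite J" "J \<subseteq> I" and C: "0 \<le> C"
    and G: "\<And>i \<eta> \<xi>. cmod (\<Sum>k<n. \<Sum>l<n. \<eta> k * G k l i * \<xi> l) \<le> C * nrm2 {..<n} \<eta> * nrm2 {..<n} \<xi>"
  shows "cmod (\<Sum>i\<in>J. \<Sum>p<m. \<Sum>q<m. \<Sum>k<n. \<Sum>l<n. \<eta> (p, k) * (\<Sum>t<r. G k l i * ((a $$ (p, t)) i * (b $$ (t, q)) i)) * \<xi> (q, l))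
    \<le> C * (rect_norm M a * rect_norm M b) * nrm2 ({..<m} \<times> {..<n}) \<eta> * nrm2 ({..<m} \<times> {..<n}) \<xi>"
proof -
  define x where "x = (\<lambda>((t, i), k). \<Sum>p<m. \<eta> (p, k) * (a $$ (p, t)) i)"
  define y where "y = (\<lambda>((t, i), l). \<Sum>q<m. \<xi> (q, l) * (b $$ (t, q)) i)"
  have aM: "a \<in> mats M m r" and bM: "b \<in> mats M r m" using a b by simp_all
  have x: "nrm2 (({..<r} \<times> J) \<times> {..<n}) x \<le> rect_norm M a * nrm2 ({..<m} \<times> {..<n}) \<eta>"
  proof (rule nrm2_Times_le)
    fix k
    show "nrm2 ({..<r} \<times> J) (\<lambda>z. x (z, k)) \<le> rect_norm M a * nrm2 {..<m} (\<lambda>p. \<eta> (p, k))"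
      using row_bound[OF a J, of "\<lambda>p. \<eta> (p, k)"] by (simp add: x_def case_prod_unfold)
  qed (use J A.rect_norm_nonneg[OF aM] in auto)
  have y: "nrm2 (({..<r} \<times> J) \<times> {..<n}) y \<le> rect_norm M b * nrm2 ({..<m} \<times> {..<n}) \<xi>"
  proof (rule nrm2_Times_le)
    fix l
    show "nrm2 ({..<r} \<times> J) (\<lambda>z. y (z, l)) \<le> rect_norm M b * nrm2 {..<m} (\<lambda>q. \<xi> (q, l))"
      using col_bound[OF b J, of "\<lambda>q. \<xi> (q, l)"] by (simp add: y_def case_prod_unfold)
  qed (use J A.rect_norm_nonneg[OF bM] in auto)
  have L2: "L2_set (\<lambda>z. nrm2 {..<n} (\<lambda>k. h (z, k))) ({..<r} \<times> J) = nrm2 (({..<r} \<times> J) \<times> {..<n}) h" for h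
    by (simp add: L2_set_def sum_nonneg sum.cartesian_product')
  have "(\<Sum>i\<in>J. \<Sum>p<m. \<Sum>q<m. \<Sum>k<n. \<Sum>l<n. \<eta> (p, k) * (\<Sum>t<r. G k l i * ((a $$ (p, t)) i * (b $$ (t, q)) i)) * \<xi> (q, l))
      = (\<Sum>i\<in>J. \<Sum>t<r. \<Sum>k<n. \<Sum>l<n. x ((t, i), k) * G k l i * y ((t, i), l))"
    unfolding x_def y_def prod.case by (rule sum.cong[OF refl], rule sum_bilinear_rearrange)
  also have "\<dots> = (\<Sum>z\<in>{..<r} \<times> J. \<Sum>k<n. \<Sum>l<n. x (z, k) * G k l (snd z) * y (z, l))"
    by (subst sum.swap) (simp add: sum.cartesian_product')
  also have "cmod \<dots> \<le> (\<Sum>z\<in>{..<r} \<times> J. C * (\<bar>nrm2 {..<n} (\<lambda>k. x (z, k))\<bar> * \<bar>nrm2 {..<n} (\<lambda>l. y (z, l))\<bar>))"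
  proof (rule sum_norm_le)
    fix z
    show "cmod (\<Sum>k<n. \<Sum>l<n. x (z, k) * G k l (snd z) * y (z, l)) \<le> C * (\<bar>nrm2 {..<n} (\<lambda>k. x (z, k))\<bar> * \<bar>nrm2 {..<n} (\<lambda>l. y (z, l))\<bar>)"
      using G[of "\<lambda>k. x (z, k)" "snd z" "\<lambda>l. y (z, l)"] by (simp add: mult_ac)
  qed
  also have "\<dots> \<le> C * (L2_set (\<lambda>z. nrm2 {..<n} (\<lambda>k. x (z, k))) ({..<r} \<times> J) * L2_set (\<lambda>z. nrm2 {..<n} (\<lambda>l. y (z, l))) ({..<r} \<times> J))"
    unfolding sum_distrib_left[symmetric] by (intro mult_left_mono C L2_set_mult_ineq)
  also have "\<dots> \<le> C * ((rect_norm M a * nrm2 ({..<m} \<times> {..<n}) \<eta>) * (rect_norm M b * nrm2 ({..<m} \<times> {..<n}) \<xi>))"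
    unfolding L2 using A.rect_norm_nonneg[OF aM]
    by (intro mult_left_mono C mult_mono x y) auto
  finally show ?thesis by (simp add: mult_ac)
qed

abbreviation tensor_functional where "tensor_functional f \<equiv> lift_bilinear (weighted_pairing f)"

lemma tensor_functional_linear: "f \<in> carrier (linf_space I) \<Longrightarrow> linear_on T (tensor_functional f)"
  by (intro lift_bilinear_linear weighted_linear)

lemma tensor_functional_pure:
  "f \<in> carrier (linf_space I) \<Longrightarrow> a \<in> carrier E \<Longrightarrow> b \<in> carrier E \<Longrightarrow> tensor_functional f (pure a b) = weighted_pairing f a b"
  using lift_bilinear_pure[of "weighted_pairing f" a b] weighted_linear[of f] by simp

text \<open>
  The finite estimates pass to the sum over all of \<open>I\<close>, and the bound holds for each factorization,
  hence for the Haagerup norm.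
\<close>

lemma tensor_functional_fnorm:
  fixes n :: nat
  assumes Gc: "\<And>k l. G k l \<in> carrier (linf_space I)" and C: "0 \<le> C"
    and G: "\<And>i \<eta> \<xi>. cmod (\<Sum>k<n. \<Sum>l<n. \<eta> k * G k l i * \<xi> l) \<le> C * nrm2 {..<n} \<eta> * nrm2 {..<n} \<xi>"
    and u: "u \<in> mats T m m"
  shows "fnorm {..<n} {..<n} (\<lambda>k l. tensor_functional (G k l)) u \<le> C * mnorm AH u"
proof -
  have key: "fnorm {..<n} {..<n} (\<lambda>k l. tensor_functional (G k l)) u \<le> C * (rect_norm M a * rect_norm M b)"
    if ab: "a \<in> mats M m r" "b \<in> mats M r m" "u = odot a b" for a b r
  proof (rule fnorm_leI[OF matsD(1)[OF u]])
    have abE: "a \<in> mats E m r" "b \<in> mats E r m" using ab by simp_all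
    show "0 \<le> C * (rect_norm M a * rect_norm M b)"
      using C A.rect_norm_nonneg[OF ab(1)] A.rect_norm_nonneg[OF ab(2)] by simp
    fix \<eta> \<xi> :: "nat \<times> nat \<Rightarrow> complex"
    let ?B = "C * (rect_norm M a * rect_norm M b) * nrm2 ({..<m} \<times> {..<n}) \<eta> * nrm2 ({..<m} \<times> {..<n}) \<xi>"
    define Z where "Z i = (\<Sum>p<m. \<Sum>q<m. \<Sum>k<n. \<Sum>l<n. \<eta> (p, k) * (\<Sum>t<r. G k l i * ((a $$ (p, t)) i * (b $$ (t, q)) i)) * \<xi> (q, l))" for i
    have e: "tensor_functional (G k l) (u $$ (p, q)) = (\<Sum>t<r. weighted_pairing (G k l) (a $$ (p, t)) (b $$ (t, q)))"
      if "p < m" "q < m" for p q k l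
    proof -
      have "tensor_functional (G k l) (u $$ (p, q)) = (\<Sum>t<r. tensor_functional (G k l) (pure (a $$ (p, t)) (b $$ (t, q))))"
        unfolding ab(3) odot_index[OF ab(1,2) that]
        by (rule T.linear_on_finsum[OF tensor_functional_linear[OF Gc]]) (use odot_entries[OF ab(1,2) that] in auto)
      thus ?thesis using that matsE[OF abE(1)] matsE[OF abE(2)] by (simp add: tensor_functional_pure[OF Gc])
    qed
    have form: "mform {..<n} {..<n} (\<lambda>k l. tensor_functional (G k l)) u \<eta> \<xi>
        = (\<Sum>p<m. \<Sum>q<m. \<Sum>k<n. \<Sum>l<n. \<eta> (p, k) * (\<Sum>t<r. weighted_pairing (G k l) (a $$ (p, t)) (b $$ (t, q))) * \<xi> (q, l))"
      using matsD[OF u] by (auto simp: mform_def e intro!: sum.cong)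
    have "(Z has_sum mform {..<n} {..<n} (\<lambda>k l. tensor_functional (G k l)) u \<eta> \<xi>) I"
      unfolding form Z_def weighted_pairing_def
      by (intro has_sum_finite_sum has_sum_cmult_left has_sum_cmult_right has_sum_infsum weighted_summable Gc matsE[OF abE(1)] matsE[OF abE(2)]) auto
    hence "((\<lambda>J. cmod (sum Z J)) \<longlongrightarrow> cmod (mform {..<n} {..<n} (\<lambda>k l. tensor_functional (G k l)) u \<eta> \<xi>)) (finite_subsets_at_top I)"
      unfolding has_sum_def by (rule tendsto_norm)
    moreover have "\<forall>\<^sub>F J in finite_subsets_at_top I. cmod (sum Z J) \<le> ?B"
      by (rule eventually_finite_subsets_at_top_weakI)
        (use finite_pairing_bound[OF abE _ _ C G] in \<open>simp add: Z_def\<close>)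
    ultimately show "cmod (mform {..<n} {..<n} (\<lambda>k l. tensor_functional (G k l)) u \<eta> \<xi>) \<le> ?B"
      by (rule tendsto_upperbound) simp
  qed
  show ?thesis
  proof (cases "C = 0")
    case True
    obtain r a b where "a \<in> mats M m r" "b \<in> mats M r m" "u = odot a b" using factorization_exists[OF u] by blast
    thus ?thesis using key[of a r b] True by simp
  next
    case False
    have "fnorm {..<n} {..<n} (\<lambda>k l. tensor_functional (G k l)) u / C \<le> mnorm AH u"
      by (rule AH_norm_greatest[OF u]) (use key False C in \<open>simp add: field_simps\<close>)
    thus ?thesis using False C by (simp add: field_simps)
  qed
qed

lemma scalar_family_bound:
  assumes "\<And>i. cmod (f i) \<le> C"
  shows "cmod (\<Sum>k<1::nat. \<Sum>l<1::nat. \<eta> k * f i * \<xi> l) \<le> C * nrm2 {..<1} \<eta> * nrm2 {..<1} \<xi>"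
  using mult_right_mono[OF assms[of i], of "cmod (\<eta> 0) * cmod (\<xi> 0)"] by (simp add: norm_mult mult_ac)

lemma tensor_functional_bounded:
  assumes f: "f \<in> carrier (linf_space I)"
  shows "\<exists>K\<ge>0. \<forall>t\<in>carrier T. cmod (tensor_functional f t) \<le> K * os_norm AH t"
proof -
  obtain C where C: "\<And>i. cmod (f i) \<le> C" using f by (auto simp: linf_carrier_iff)
  have C0: "0 \<le> C" using order_trans[OF norm_ge_zero C] .
  have "cmod (tensor_functional f t) \<le> C * os_norm AH t" if t: "t \<in> carrier T" for t
  proof -
    have "cmod (tensor_functional f t) \<le> fnorm {..<1::nat} {..<1::nat} (\<lambda>_ _. tensor_functional f) (mat1 t)"
      by (rule fnorm_mat1_ge[of _ _ 0 0]) auto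
    also have "\<dots> \<le> C * mnorm AH (mat1 t)"
      by (rule tensor_functional_fnorm[where G = "\<lambda>_ _. f" and n = 1, OF f C0 scalar_family_bound[of f C, OF C] mat1_mats[OF t]])
    finally show ?thesis by (simp add: os_norm_def)
  qed
  thus ?thesis using C0 by blast
qed

end

context lp2 begin

lemma mult_closed:
  assumes a: "a \<in> carrier E" and b: "b \<in> carrier E" shows "(\<lambda>i. a i * b i) \<in> carrier E"
proof (rule carrier_dominated)
  show "(\<lambda>i. vnorm E a powr p * cmod (b i) powr p) summable_on I"
    using b by (intro summable_on_cmult_right) (simp add: carrier_iff)
  show "cmod (a i * b i) powr p \<le> vnorm E a powr p * cmod (b i) powr p" for i
    using p1 coord_le_vnorm[OF a, of i] by (simp add: norm_mult powr_mult) (intro mult_right_mono powr_mono2, auto)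
qed (use a in \<open>auto simp: carrier_iff\<close>)

definition balance_gens :: "(nat \<Rightarrow> (('a \<Rightarrow> complex) \<times> ('a \<Rightarrow> complex) \<Rightarrow>\<^sub>0 complex) set) set set" where
  "balance_gens = {AH.emb (pure (\<lambda>i. a i * b i) x) \<ominus>\<^bsub>AH.H\<^esub> AH.emb (pure a (\<lambda>i. b i * x i))
     | a b x. a \<in> carrier E \<and> b \<in> carrier E \<and> x \<in> carrier E}"

lemma emb_pure_closed: "a \<in> carrier E \<Longrightarrow> b \<in> carrier E \<Longrightarrow> AH.emb (pure a b) \<in> carrier AH.H"
  by (intro AH.emb_closed) (simp add: pure_closed)

lemma balance_gens_subset: "balance_gens \<subseteq> carrier AH.H"
  unfolding balance_gens_def by (auto intro!: AH.H.minus_closed emb_pure_closed mult_closed)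

abbreviation BS where "BS \<equiv> closed_span AH.H balance_gens"

lemma balanced_subspace_eq: "balanced_subspace M M (monoid.mult M) = BS"
  unfolding balanced_subspace_def haagerup_def haagerup_pure_def balance_gens_def M_simps lp_simps ..

sublocale Q: matrix_seminormed_sub AH.H BS
  by (intro matrix_seminormed_sub.intro AH.H.matrix_seminormed_axioms AH.H.closed_span_cvs_sub balance_gens_subset)

lemma module_haagerup_eq: "module_haagerup M M (monoid.mult M) = Q.QO"
  unfolding module_haagerup_def balanced_subspace_eq by (simp add: haagerup_def)

lemma QO_sem: "matrix_seminormed Q.QO" by (rule Q.quot_matrix_seminormed)

definition unit_vec :: "'a \<Rightarrow> 'a \<Rightarrow> complex" where
  "unit_vec i = (\<lambda>j. if j = i then 1 else 0)"

lemma finite_support_carrier: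
  assumes "finite S" "S \<subseteq> I" shows "(\<lambda>j. if j \<in> S then a j else 0) \<in> carrier E"
proof (rule carrier_dominated)
  show "(\<lambda>j. if j \<in> S then cmod (a j) powr p else 0) summable_on I"
    using assms by (intro summable_on_cong_neutral[THEN iffD1, OF _ _ _ summable_on_finite[of S "\<lambda>j. cmod (a j) powr p"]]) auto
qed (use assms in auto)

lemma unit_vec_closed: "i \<in> I \<Longrightarrow> unit_vec i \<in> carrier E"
  using finite_support_carrier[of "{i}" "\<lambda>_. 1"] by (simp add: unit_vec_def)

lemma unit_vec_norm: "i \<in> I \<Longrightarrow> vnorm E (unit_vec i) \<le> 1"
proof (rule vnorm_leI[OF unit_vec_closed])
  fix J assume J: "finite J" "J \<subseteq> I"
  have "(\<Sum>j\<in>J. cmod (unit_vec i j) powr p) = (\<Sum>j\<in>J. if j = i then 1 else 0)"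
    by (intro sum.cong refl) (auto simp: unit_vec_def)
  thus "(\<Sum>j\<in>J. cmod (unit_vec i j) powr p) \<le> 1 powr p" using J by simp
qed auto

text \<open>
  The class of \<open>e\<^sub>i \<otimes> e\<^sub>i\<close>, at which the functional of the family \<open>f\<close> has the value \<open>f i\<close>.
\<close>

definition coord_class where "coord_class i = Q.proj (AH.emb (pure (unit_vec i) (unit_vec i)))"

lemma coord_class_closed: "i \<in> I \<Longrightarrow> coord_class i \<in> carrier Q.QO"
  by (simp add: coord_class_def Q.proj_closed emb_pure_closed unit_vec_closed)

lemma coord_class_norm: "i \<in> I \<Longrightarrow> os_norm Q.QO (coord_class i) \<le> 1"
proof -
  assume i: "i \<in> I"
  have "os_norm Q.QO (coord_class i) \<le> os_norm AH.H (AH.emb (pure (unit_vec i) (unit_vec i)))"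
    unfolding coord_class_def by (rule Q.quot_os_norm_proj) (use i in \<open>simp add: emb_pure_closed unit_vec_closed\<close>)
  also have "\<dots> \<le> os_norm AH (pure (unit_vec i) (unit_vec i))"
    by (rule AH.os_norm_emb) (use i in \<open>simp add: pure_closed unit_vec_closed\<close>)
  also have "\<dots> \<le> os_norm M (unit_vec i) * os_norm M (unit_vec i)"
    by (rule os_norm_pure) (use i in \<open>simp_all add: unit_vec_closed\<close>)
  also have "\<dots> \<le> 1"
    using i unit_vec_norm[OF i] vnorm_nonneg by (simp add: M_os_norm unit_vec_closed mult_le_one)
  finally show ?thesis .
qed

section \<open>Passage to the module tensor product\<close>

abbreviation extended_functional where "extended_functional f \<equiv> AH.extend (tensor_functional f)"

definition module_functional where
  "module_functional f = descend AH.H BS (extended_functional f)"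

lemma tensor_functional_linear_AH: "f \<in> carrier (linf_space I) \<Longrightarrow> linear_on AH (tensor_functional f)"
  using tensor_functional_linear[of f] by (simp add: linear_on_def)

lemma tensor_functional_constant:
  "\<exists>B. \<forall>f\<in>carrier (linf_space I). \<forall>t\<in>carrier AH. cmod (tensor_functional f t) \<le> B f * os_norm AH t"
proof -
  have "\<forall>f\<in>carrier (linf_space I). \<exists>K. \<forall>t\<in>carrier AH. cmod (tensor_functional f t) \<le> K * os_norm AH t"
    using tensor_functional_bounded by auto
  thus ?thesis by (rule bchoice)
qed

lemma extended_linear: "f \<in> carrier (linf_space I) \<Longrightarrow> linear_on AH.H (extended_functional f)"
  using tensor_functional_constant AH.extend_linear[OF tensor_functional_linear_AH] by metis

lemma extended_emb:
  "f \<in> carrier (linf_space I) \<Longrightarrow> t \<in> carrier T \<Longrightarrow> extended_functional f (AH.emb t) = tensor_functional f t"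
  using tensor_functional_constant AH.extend_emb[OF tensor_functional_linear_AH] AH_simps(1) by metis

lemma extended_fnorm:
  fixes n :: nat
  assumes Gc: "\<And>k l. G k l \<in> carrier (linf_space I)" and C: "0 \<le> C"
    and G: "\<And>i \<eta> \<xi>. cmod (\<Sum>k<n. \<Sum>l<n. \<eta> k * G k l i * \<xi> l) \<le> C * nrm2 {..<n} \<eta> * nrm2 {..<n} \<xi>"
    and x: "x \<in> mats AH.H m m"
  shows "fnorm {..<n} {..<n} (\<lambda>k l. extended_functional (G k l)) x \<le> C * mnorm AH.H x"
proof -
  obtain B where B: "\<And>f t. f \<in> carrier (linf_space I) \<Longrightarrow> t \<in> carrier AH \<Longrightarrow> cmod (tensor_functional f t) \<le> B f * os_norm AH t"
    using tensor_functional_constant by blast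
  show ?thesis
  proof (rule AH.extend_fnorm_le[OF _ _ C tensor_functional_linear_AH[OF Gc] B[OF Gc] _ x])
    fix u assume "u \<in> mats AH m m"
    thus "fnorm {..<n} {..<n} (\<lambda>k l. tensor_functional (G k l)) u \<le> C * mnorm AH u"
      by (intro tensor_functional_fnorm Gc C G) simp
  qed auto
qed

lemma extended_bounded:
  assumes f: "f \<in> carrier (linf_space I)"
  shows "\<exists>K. \<forall>h\<in>carrier AH.H. cmod (extended_functional f h) \<le> K * os_norm AH.H h"
proof -
  obtain C where C: "\<And>i. cmod (f i) \<le> C" using f by (auto simp: linf_carrier_iff)
  have C0: "0 \<le> C" using order_trans[OF norm_ge_zero C] .
  have "cmod (extended_functional f h) \<le> C * os_norm AH.H h" if h: "h \<in> carrier AH.H" for h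
  proof -
    have "cmod (extended_functional f h) \<le> fnorm {..<1::nat} {..<1::nat} (\<lambda>_ _. extended_functional f) (mat1 h)"
      by (rule fnorm_mat1_ge[of _ _ 0 0]) auto
    also have "\<dots> \<le> C * mnorm AH.H (mat1 h)"
      by (rule extended_fnorm[where G = "\<lambda>_ _. f" and n = 1, OF f C0 scalar_family_bound[of f C, OF C] mat1_mats[OF h]])
    finally show ?thesis by (simp add: os_norm_def)
  qed
  thus ?thesis by blast
qed

text \<open>
  The functional is balanced because the pointwise product is associative.
\<close>

lemma extended_BS:
  assumes f: "f \<in> carrier (linf_space I)" and h: "h \<in> BS" shows "extended_functional f h = 0"
proof -
  obtain K where K: "\<And>h. h \<in> carrier AH.H \<Longrightarrow> cmod (extended_functional f h) \<le> K * os_norm AH.H h"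
    using extended_bounded[OF f] by blast
  show ?thesis
  proof (rule AH.H.linear_on_closed_span[OF extended_linear[OF f] K balance_gens_subset _ h])
    fix g assume "g \<in> balance_gens"
    then obtain a b x where g: "g = AH.emb (pure (\<lambda>i. a i * b i) x) \<ominus>\<^bsub>AH.H\<^esub> AH.emb (pure a (\<lambda>i. b i * x i))"
      and abx: "a \<in> carrier E" "b \<in> carrier E" "x \<in> carrier E" unfolding balance_gens_def by blast
    note c = mult_closed[OF abx(1,2)] mult_closed[OF abx(2,3)]
    have "extended_functional f g = weighted_pairing f (\<lambda>i. a i * b i) x - weighted_pairing f a (\<lambda>i. b i * x i)"
      unfolding g using abx c
      by (simp add: AH.H.linear_on_minus[OF extended_linear[OF f]] emb_pure_closed extended_emb[OF f] pure_closed tensor_functional_pure[OF f])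
    thus "extended_functional f g = 0" by (simp add: weighted_pairing_def mult.assoc)
  qed
qed

lemma module_functional_linear: "f \<in> carrier (linf_space I) \<Longrightarrow> linear_on Q.QO (module_functional f)"
  unfolding module_functional_def
  using Q.descend_linear[OF extended_linear extended_BS] by (simp add: linear_on_def)

lemma module_functional_proj:
  "f \<in> carrier (linf_space I) \<Longrightarrow> h \<in> carrier AH.H \<Longrightarrow> module_functional f (Q.proj h) = extended_functional f h"
  unfolding module_functional_def by (rule Q.descend_proj[OF extended_linear extended_BS])

lemma module_functional_coord:
  assumes f: "f \<in> carrier (linf_space I)" and i: "i \<in> I" shows "module_functional f (coord_class i) = f i"
proof -
  have "module_functional f (coord_class i) = weighted_pairing f (unit_vec i) (unit_vec i)"
    using i by (simp add: coord_class_def module_functional_proj[OF f] emb_pure_closed unit_vec_closed extended_emb[OF f]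
        pure_closed tensor_functional_pure[OF f])
  also have "\<dots> = (\<Sum>\<^sub>\<infinity>j\<in>{i}. f j * (unit_vec i j * unit_vec i j))"
    unfolding weighted_pairing_def using i by (intro infsum_cong_neutral) (auto simp: unit_vec_def)
  finally show ?thesis by (simp add: unit_vec_def)
qed

text \<open>
  The estimate of the algebraic tensor product survives completion and quotient; with \<open>C\<close> the
  minimal norm of \<open>G\<close> it is the upper bound for the dual norm.
\<close>

lemma module_functional_fnorm:
  fixes n :: nat
  assumes Gc: "\<And>k l. G k l \<in> carrier (linf_space I)" and C: "0 \<le> C"
    and G: "\<And>i \<eta> \<xi>. cmod (\<Sum>k<n. \<Sum>l<n. \<eta> k * G k l i * \<xi> l) \<le> C * nrm2 {..<n} \<eta> * nrm2 {..<n} \<xi>"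
    and x: "x \<in> mats Q.QO m m"
  shows "fnorm {..<n} {..<n} (\<lambda>k l. module_functional (G k l)) x \<le> C * mnorm Q.QO x"
  unfolding module_functional_def
  by (rule Q.quot_fnorm_le[OF C extended_linear[OF Gc] extended_BS[OF Gc] extended_fnorm[OF Gc C G]]) (use x in auto)

lemma module_functional_bounded:
  assumes f: "f \<in> carrier (linf_space I)"
  shows "\<exists>K. \<forall>q\<in>carrier Q.QO. cmod (module_functional f q) \<le> K * os_norm Q.QO q"
proof -
  obtain C where C: "\<And>i. cmod (f i) \<le> C" using f by (auto simp: linf_carrier_iff)
  have C0: "0 \<le> C" using order_trans[OF norm_ge_zero C] .
  have "cmod (module_functional f q) \<le> C * os_norm Q.QO q" if q: "q \<in> carrier Q.QO" for q
  proof -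
    have "cmod (module_functional f q) \<le> fnorm {..<1::nat} {..<1::nat} (\<lambda>_ _. module_functional f) (mat1 q)"
      by (rule fnorm_mat1_ge[of _ _ 0 0]) auto
    also have "\<dots> \<le> C * mnorm Q.QO (mat1 q)"
      by (rule module_functional_fnorm[where G = "\<lambda>_ _. f" and n = 1, OF f C0 scalar_family_bound[of f C, OF C] mat1_mats[OF q]])
    finally show ?thesis by (simp add: os_norm_def)
  qed
  thus ?thesis by blast
qed

section \<open>A functional is determined by its values on the coordinate classes\<close>

lemma finite_approximation:
  assumes a: "a \<in> carrier E" and e: "e > 0"
  shows "\<exists>S. finite S \<and> S \<subseteq> I \<and> vnorm E (\<lambda>j. a j - (if j \<in> S then a j else 0)) \<le> e"
proof -
  let ?g = "\<lambda>i. cmod (a i) powr p"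
  have s: "?g summable_on I" using a by (simp add: carrier_iff)
  have "e powr p > 0" using e by simp
  from infsum_finite_approximation[OF s this] obtain S where S: "finite S" "S \<subseteq> I" "dist (sum ?g S) (infsum ?g I) \<le> e powr p"
    by blast
  let ?d = "\<lambda>j. a j - (if j \<in> S then a j else 0)"
  have d: "?d \<in> carrier E"
    by (rule carrier_dominated[OF _ s]) (use a in \<open>auto simp: carrier_iff\<close>)
  have "vnorm E ?d \<le> e"
  proof (rule vnorm_leI[OF d])
    fix J assume J: "finite J" "J \<subseteq> I"
    have "(\<Sum>j\<in>J. cmod (?d j) powr p) = (\<Sum>j\<in>J - S. ?g j)"
      using J by (intro sum.mono_neutral_cong_right) auto
    also have "\<dots> = sum ?g (J \<union> S) - sum ?g S"
      using J S sum.subset_diff[of S "J \<union> S" ?g] by (simp add: Un_Diff)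
    also have "sum ?g (J \<union> S) \<le> infsum ?g I"
      using J S s by (intro finite_sum_le_infsum) auto
    also have "infsum ?g I - sum ?g S \<le> e powr p" using S(3) by (simp add: dist_real_def)
    finally show "(\<Sum>j\<in>J. cmod (?d j) powr p) \<le> e powr p" by simp
  qed (use e in simp)
  thus ?thesis using S by blast
qed

text \<open>
  Write \<open>B\<close> for the bilinear form of the functional.  Being balanced, it satisfies
  \<open>B(e\<^sub>i, b) = B(e\<^sub>i e\<^sub>i, b) = B(e\<^sub>i, e\<^sub>i b) = b\<^sub>i B(e\<^sub>i, e\<^sub>i) = 0\<close>, so it vanishes for all first arguments
  of finite support, and these are dense.  Pure tensors span a dense subspace of the completion.
\<close>

lemma functional_zero:
  assumes lin: "linear_on Q.QO \<phi>" and bd: "\<And>q. q \<in> carrier Q.QO \<Longrightarrow> cmod (\<phi> q) \<le> K * os_norm Q.QO q"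
    and z: "\<And>i. i \<in> I \<Longrightarrow> \<phi> (coord_class i) = 0" and q: "q \<in> carrier Q.QO"
  shows "\<phi> q = 0"
proof -
  interpret QS: matrix_seminormed Q.QO by (rule QO_sem)
  define \<psi> where "\<psi> h = \<phi> (Q.proj h)" for h
  define K' where "K' = \<bar>K\<bar>"
  have K': "0 \<le> K'" "K \<le> K'" by (auto simp: K'_def)
  have projc: "h \<in> carrier AH.H \<Longrightarrow> Q.proj h \<in> carrier Q.QO" for h by (simp add: Q.proj_closed)
  have \<psi>lin: "linear_on AH.H \<psi>"
    using lin Q.proj_add Q.proj_smult projc by (auto simp: linear_on_def \<psi>_def simp flip: Q.proj_add Q.proj_smult)
  have \<psi>bd: "cmod (\<psi> h) \<le> K' * os_norm AH.H h" if h: "h \<in> carrier AH.H" for h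
  proof -
    have "cmod (\<psi> h) \<le> K * os_norm Q.QO (Q.proj h)" unfolding \<psi>_def by (rule bd[OF projc[OF h]])
    also have "\<dots> \<le> K' * os_norm AH.H h"
      using K' QS.os_norm_nonneg[OF projc[OF h]] Q.quot_os_norm_proj[OF h] by (intro mult_mono) auto
    finally show ?thesis .
  qed
  define B where "B a b = \<psi> (AH.emb (pure a b))" for a b
  have B_add: "B (\<lambda>i. a i + a' i) b = B a b + B a' b" if "a \<in> carrier E" "a' \<in> carrier E" "b \<in> carrier E" for a a' b
    unfolding B_def using pure_add_left[of a a' b] that AH.emb_add[of "pure a b" "pure a' b"]
    by (simp add: lp_simps pure_closed linear_onD[OF \<psi>lin] emb_pure_closed)
  have B_smult: "B (\<lambda>i. c * a i) b = c * B a b" if "a \<in> carrier E" "b \<in> carrier E" for a b c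
    unfolding B_def using pure_smult_left[of a b c] that AH.emb_smult[of "pure a b" c]
    by (simp add: lp_simps pure_closed linear_onD[OF \<psi>lin] emb_pure_closed)
  have B_smult_right: "B a (\<lambda>i. c * b i) = c * B a b" if "a \<in> carrier E" "b \<in> carrier E" for a b c
    unfolding B_def using pure_smult_right[of a b c] that AH.emb_smult[of "pure a b" c]
    by (simp add: lp_simps pure_closed linear_onD[OF \<psi>lin] emb_pure_closed)
  have B_balanced: "B (\<lambda>i. a i * b i) x = B a (\<lambda>i. b i * x i)" if "a \<in> carrier E" "b \<in> carrier E" "x \<in> carrier E" for a b x
  proof -
    let ?u = "AH.emb (pure (\<lambda>i. a i * b i) x)" and ?v = "AH.emb (pure a (\<lambda>i. b i * x i))"
    have uv: "?u \<in> carrier AH.H" "?v \<in> carrier AH.H" using that by (simp_all add: emb_pure_closed mult_closed)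
    have "?u \<ominus>\<^bsub>AH.H\<^esub> ?v \<in> balance_gens" using that unfolding balance_gens_def by blast
    hence "?u \<ominus>\<^bsub>AH.H\<^esub> ?v \<in> BS" using AH.H.subset_closed_span[OF balance_gens_subset] by blast
    hence "Q.proj ?u = Q.proj ?v" using Q.proj_eq_iff uv by blast
    thus ?thesis by (simp add: B_def \<psi>_def)
  qed
  have B_bound: "cmod (B a b) \<le> K' * (vnorm E a * vnorm E b)" if "a \<in> carrier E" "b \<in> carrier E" for a b
  proof -
    have p: "pure a b \<in> carrier AH" using that by (simp add: pure_closed)
    have "cmod (B a b) \<le> K' * os_norm AH.H (AH.emb (pure a b))"
      unfolding B_def by (intro \<psi>bd emb_pure_closed that)
    also have "\<dots> \<le> K' * os_norm AH (pure a b)" by (intro mult_left_mono K' AH.os_norm_emb p)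
    also have "\<dots> \<le> K' * (os_norm M a * os_norm M b)" using that by (intro mult_left_mono K' os_norm_pure) auto
    finally show ?thesis using that by (simp add: M_os_norm)
  qed
  have B_unit: "B (unit_vec i) b = 0" if i: "i \<in> I" and b: "b \<in> carrier E" for i b
  proof -
    have "(\<lambda>j. unit_vec i j * unit_vec i j) = unit_vec i" by (auto simp: unit_vec_def)
    hence "B (unit_vec i) b = B (unit_vec i) (\<lambda>j. unit_vec i j * b j)"
      using B_balanced[of "unit_vec i" "unit_vec i" b] i b by (simp add: unit_vec_closed)
    also have "(\<lambda>j. unit_vec i j * b j) = (\<lambda>j. b i * unit_vec i j)" by (auto simp: unit_vec_def)
    also have "B (unit_vec i) \<dots> = b i * B (unit_vec i) (unit_vec i)" using i by (simp add: B_smult_right unit_vec_closed)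
    also have "B (unit_vec i) (unit_vec i) = 0" using z[OF i] by (simp add: B_def \<psi>_def coord_class_def)
    finally show ?thesis by simp
  qed
  have B_finite: "B (\<lambda>j. if j \<in> S then a j else 0) b = 0" if "finite S" "S \<subseteq> I" and b: "b \<in> carrier E" for S a b
    using that(1,2)
  proof (induction S)
    case empty
    show ?case using B_smult[of "\<lambda>_. 0" b 0] finite_support_carrier[of "{}"] b by simp
  next
    case (insert i S)
    have "(\<lambda>j. if j \<in> insert i S then a j else 0) = (\<lambda>j. a i * unit_vec i j + (if j \<in> S then a j else 0))"
      using insert.hyps by (auto simp: unit_vec_def)
    moreover have "(\<lambda>j. a i * unit_vec i j) \<in> carrier E"
      using insert.prems N.smult_closed[OF unit_vec_closed, of i "a i"] by (simp add: lp_simps)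
    ultimately show ?case
      using insert b by (simp add: B_add finite_support_carrier B_smult unit_vec_closed B_unit)
  qed
  have B0: "B a b = 0" if a: "a \<in> carrier E" and b: "b \<in> carrier E" for a b
  proof -
    have "cmod (B a b) \<le> e" if e: "e > 0" for e
    proof -
      \<comment> \<open>The summand \<open>1\<close> covers the case that the bound of the functional or the norm of \<open>b\<close> is zero.\<close>
      define d where "d = e / (K' * vnorm E b + 1)"
      have den: "K' * vnorm E b + 1 > 0" using K'(1) vnorm_nonneg[of b] by (simp add: add_nonneg_pos)
      have d: "d > 0" using e den by (simp add: d_def)
      obtain S where S: "finite S" "S \<subseteq> I" "vnorm E (\<lambda>j. a j - (if j \<in> S then a j else 0)) \<le> d"
        using finite_approximation[OF a d] by blast
      let ?s = "\<lambda>j. if j \<in> S then a j else 0" and ?r = "\<lambda>j. a j - (if j \<in> S then a j else 0)"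
      have r: "?r \<in> carrier E"
        using a by (intro carrier_dominated[of _ "\<lambda>i. cmod (a i) powr p"]) (auto simp: carrier_iff)
      have "(\<lambda>j. ?r j + ?s j) = a" by auto
      hence "B a b = B ?r b" using B_add[OF r finite_support_carrier[OF S(1,2)] b, of a] B_finite[OF S(1,2) b, of a] by simp
      hence "cmod (B a b) \<le> K' * (vnorm E ?r * vnorm E b)" using B_bound[OF r b] by simp
      also have "\<dots> \<le> K' * (d * vnorm E b)" by (intro mult_left_mono mult_right_mono S K' vnorm_nonneg)
      also have "\<dots> \<le> d * (K' * vnorm E b + 1)" using d by (simp add: algebra_simps)
      also have "\<dots> = e" using den by (simp add: d_def)
      finally show ?thesis .
    qed
    hence "cmod (B a b) \<le> 0" by (rule field_le_epsilon) simp
    thus ?thesis by simp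
  qed
  have \<psi>T: "\<psi> (AH.emb t) = 0" if "t \<in> carrier T" for t
    using that
  proof (induction t rule: T_induct)
    case zero
    show ?case using AH.emb_smult[of "\<zero>\<^bsub>T\<^esub>" 0] AH.emb_closed[of "\<zero>\<^bsub>T\<^esub>"] linear_onD(2)[OF \<psi>lin, of "AH.emb \<zero>\<^bsub>T\<^esub>" 0] by simp
  next
    case (add v w t)
    thus ?case using B0[of v w] AH.emb_add[of "pure v w" t] AH.emb_closed[of t]
      by (simp add: pure_closed linear_onD[OF \<psi>lin] emb_pure_closed B_def)
  qed
  obtain h where h: "h \<in> carrier AH.H" "q = Q.proj h" using q by (auto simp: Q.quot_carrier)
  have "cmod (\<psi> h) \<le> e" if e: "e > 0" for e
  proof -
    have d: "e / (K' + 1) > 0" using e K' by simp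
    obtain t where t: "t \<in> carrier AH" "os_norm AH.H (h \<ominus>\<^bsub>AH.H\<^esub> AH.emb t) \<le> e / (K' + 1)"
      using AH.emb_dense[OF h(1) d] by blast
    have tc: "AH.emb t \<in> carrier AH.H" using t(1) by (rule AH.emb_closed)
    have hc: "h \<ominus>\<^bsub>AH.H\<^esub> AH.emb t \<in> carrier AH.H" using h tc by simp
    have "\<psi> h = \<psi> (h \<ominus>\<^bsub>AH.H\<^esub> AH.emb t)"
      using t(1) by (simp add: AH.H.linear_on_minus[OF \<psi>lin h(1) tc] \<psi>T)
    hence "cmod (\<psi> h) \<le> K' * os_norm AH.H (h \<ominus>\<^bsub>AH.H\<^esub> AH.emb t)" using \<psi>bd[OF hc] by simp
    also have "\<dots> \<le> (K' + 1) * (e / (K' + 1))"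
      using t(2) K' AH.H.os_norm_nonneg[OF hc] by (intro mult_mono) auto
    also have "\<dots> = e" using K' by simp
    finally show ?thesis .
  qed
  hence "cmod (\<psi> h) \<le> 0" by (rule field_le_epsilon) simp
  thus ?thesis using h(2) by (simp add: \<psi>_def)
qed

section \<open>The isomorphism\<close>

sublocale QS: matrix_seminormed Q.QO by (rule QO_sem)

abbreviation D where "D \<equiv> QS.D"

definition diagonal_values :: "_ \<Rightarrow> 'a \<Rightarrow> complex" where
  "diagonal_values \<phi> = (\<lambda>i. if i \<in> I then \<phi> (coord_class i) else 0)"

lemma diagonal_values_closed:
  assumes "\<phi> \<in> carrier D" shows "diagonal_values \<phi> \<in> carrier (linf_space I)"
proof -
  obtain K where K: "\<And>q. q \<in> carrier Q.QO \<Longrightarrow> cmod (\<phi> q) \<le> K * os_norm Q.QO q"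
    using assms unfolding QS.dual_carrier_iff by blast
  have "cmod (\<phi> (coord_class i)) \<le> \<bar>K\<bar>" if i: "i \<in> I" for i
  proof -
    have "cmod (\<phi> (coord_class i)) \<le> K * os_norm Q.QO (coord_class i)" by (rule K[OF coord_class_closed[OF i]])
    also have "\<dots> \<le> \<bar>K\<bar> * 1"
      using coord_class_norm[OF i] QS.os_norm_nonneg[OF coord_class_closed[OF i]] by (intro mult_mono) auto
    finally show ?thesis by simp
  qed
  thus ?thesis by (auto simp: linf_carrier_iff diagonal_values_def intro!: exI[of _ "\<bar>K\<bar>"])
qed

text \<open>
  The difference of the two functionals vanishes at the coordinate classes.
\<close>

lemma functional_of_diagonal:
  assumes \<phi>: "\<phi> \<in> carrier D" and q: "q \<in> carrier Q.QO"
  shows "\<phi> q = module_functional (diagonal_values \<phi>) q"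
proof -
  note d = diagonal_values_closed[OF \<phi>]
  obtain K where K: "\<And>q. q \<in> carrier Q.QO \<Longrightarrow> cmod (\<phi> q) \<le> K * os_norm Q.QO q"
    using \<phi> unfolding QS.dual_carrier_iff by blast
  obtain L where L: "\<And>q. q \<in> carrier Q.QO \<Longrightarrow> cmod (module_functional (diagonal_values \<phi>) q) \<le> L * os_norm Q.QO q"
    using module_functional_bounded[OF d] by blast
  have lin: "linear_on Q.QO \<phi>" using \<phi> unfolding QS.dual_carrier_iff by blast
  have "\<phi> q - module_functional (diagonal_values \<phi>) q = 0"
  proof (rule functional_zero[OF _ _ _ q])
    show "linear_on Q.QO (\<lambda>q. \<phi> q - module_functional (diagonal_values \<phi>) q)"
      using lin module_functional_linear[OF d] by (auto simp: linear_on_def algebra_simps)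
    show "cmod (\<phi> q - module_functional (diagonal_values \<phi>) q) \<le> (K + L) * os_norm Q.QO q" if "q \<in> carrier Q.QO" for q
      using norm_triangle_ineq4[of "\<phi> q" "module_functional (diagonal_values \<phi>) q"] K[OF that] L[OF that] by (simp add: algebra_simps)
    show "\<phi> (coord_class i) - module_functional (diagonal_values \<phi>) (coord_class i) = 0" if "i \<in> I" for i
      using that by (simp add: module_functional_coord[OF d]) (simp add: diagonal_values_def)
  qed
  thus ?thesis by simp
qed

lemma diagonal_values_bij: "bij_betw diagonal_values (carrier D) (carrier (linf_space I))"
proof (rule bij_betwI')
  fix \<phi> \<psi> assume p: "\<phi> \<in> carrier D" "\<psi> \<in> carrier D"
  show "(diagonal_values \<phi> = diagonal_values \<psi>) = (\<phi> = \<psi>)"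
  proof
    assume e: "diagonal_values \<phi> = diagonal_values \<psi>"
    show "\<phi> = \<psi>"
    proof (rule extensionalityI)
      show "\<phi> \<in> extensional (carrier Q.QO)" "\<psi> \<in> extensional (carrier Q.QO)" using p unfolding QS.dual_carrier_iff by blast+
      show "\<phi> q = \<psi> q" if "q \<in> carrier Q.QO" for q
        using functional_of_diagonal[OF p(1) that] functional_of_diagonal[OF p(2) that] e by simp
    qed
  qed simp
next
  fix f assume f: "f \<in> carrier (linf_space I)"
  obtain K where K: "\<And>q. q \<in> carrier Q.QO \<Longrightarrow> cmod (module_functional f q) \<le> K * os_norm Q.QO q"
    using module_functional_bounded[OF f] by blast
  have "restrict (module_functional f) (carrier Q.QO) \<in> carrier D"
    by (rule QS.dual_restrict[OF module_functional_linear[OF f] K])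
  moreover have "f = diagonal_values (restrict (module_functional f) (carrier Q.QO))"
    using f coord_class_closed by (auto simp: diagonal_values_def module_functional_coord[OF f] linf_carrier_iff)
  ultimately show "\<exists>\<phi>\<in>carrier D. f = diagonal_values \<phi>" by blast
qed (rule diagonal_values_closed)

text \<open>
  The upper bound for the dual norm is the matrix estimate for the functionals of the family
  \<open>\<Phi>\<close>.  For the lower bound it suffices to test \<open>\<Phi>\<close> on the \<open>1 \<times> 1\<close> matrices of the coordinate
  classes, which have norm at most one.
\<close>

lemma diagonal_values_mnorm:
  assumes \<Phi>: "\<Phi> \<in> mats D n n"
  shows "mnorm (min_os (linf_space I)) (map_mat diagonal_values \<Phi>) = mnorm D \<Phi>"
proof -
  let ?X = "map_mat diagonal_values \<Phi>"
  let ?\<pi> = "\<lambda>k l. \<Phi> $$ (k, l)"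
  let ?S = "{fnorm {..<n} {..<n} ?\<pi> x | m x. x \<in> mats Q.QO m m \<and> mnorm Q.QO x \<le> 1}"
  define s where "s = mnorm (min_os (linf_space I)) ?X"
  have X: "?X \<in> mats (linf_space I) n n"
    using matsD[OF \<Phi>] matsE[OF \<Phi>] diagonal_values_closed by (auto simp: mats_iff)
  have Xe: "?X $$ (k, l) = diagonal_values (\<Phi> $$ (k, l))" if "k < n" "l < n" for k l
    using that matsD[OF \<Phi>] by simp
  have s0: "0 \<le> s"
    unfolding s_def by (rule min_linf_nonneg[OF X])
  have upper: "fnorm {..<n} {..<n} ?\<pi> x \<le> s * mnorm Q.QO x" if x: "x \<in> mats Q.QO m m" for m x
  proof -
    \<comment> \<open>Entries outside the matrix are unspecified, so the family is extended by zero.\<close>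
    define G where "G k l = (if k < n \<and> l < n then ?X $$ (k, l) else (\<lambda>_. 0))" for k l
    have Gc: "G k l \<in> carrier (linf_space I)" for k l
      using matsE[OF X, of k l] by (auto simp: G_def linf_carrier_iff)
    have "mform {..<n} {..<n} ?\<pi> x \<eta> \<xi> = mform {..<n} {..<n} (\<lambda>k l. module_functional (G k l)) x \<eta> \<xi>" for \<eta> \<xi>
      unfolding mform_def using matsD[OF x] matsE[OF x] matsE[OF \<Phi>]
      by (intro sum.cong refl) (auto simp: G_def Xe functional_of_diagonal)
    hence "fnorm {..<n} {..<n} ?\<pi> x = fnorm {..<n} {..<n} (\<lambda>k l. module_functional (G k l)) x"
      unfolding fnorm_def by simp
    also have "\<dots> \<le> s * mnorm Q.QO x"
    proof (rule module_functional_fnorm[OF Gc s0 _ x])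
      fix i \<eta> \<xi>
      have "(\<Sum>k<n. \<Sum>l<n. \<eta> k * G k l i * \<xi> l) = (\<Sum>k<n. \<Sum>l<n. \<eta> k * (?X $$ (k, l)) i * \<xi> l)"
        by (intro sum.cong refl) (auto simp: G_def)
      thus "cmod (\<Sum>k<n. \<Sum>l<n. \<eta> k * G k l i * \<xi> l) \<le> s * nrm2 {..<n} \<eta> * nrm2 {..<n} \<xi>"
        using min_linf_bound[OF X, of \<eta> i \<xi>] unfolding s_def by simp
    qed
    finally show ?thesis .
  qed
  have bdd: "bdd_above ?S"
  proof (rule bdd_aboveI)
    fix r assume "r \<in> ?S"
    then obtain m x where r: "r = fnorm {..<n} {..<n} ?\<pi> x" "x \<in> mats Q.QO m m" "mnorm Q.QO x \<le> 1" by blast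
    show "r \<le> s" using upper[OF r(2)] mult_left_mono[OF r(3) s0] r(1) by simp
  qed
  have zero_in: "mnorm Q.QO (zero_mats Q.QO 1 1) \<le> 1"
    using QS.mat_seminorm_zero[OF QS.seminorm, of 1] by simp
  have in_S: "fnorm {..<n} {..<n} ?\<pi> x \<le> Sup ?S" if "x \<in> mats Q.QO m m" "mnorm Q.QO x \<le> 1" for m x
    using that by (intro cSup_upper[OF _ bdd]) blast
  have "Sup ?S \<le> s"
  proof (rule cSup_least)
    show "?S \<noteq> {}" using zero_in QS.zero_mats_mats[of 1 1] by blast
    fix r assume "r \<in> ?S"
    then obtain m x where r: "r = fnorm {..<n} {..<n} ?\<pi> x" "x \<in> mats Q.QO m m" "mnorm Q.QO x \<le> 1" by blast
    show "r \<le> s" using upper[OF r(2)] mult_left_mono[OF r(3) s0] r(1) by simp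
  qed
  moreover have "s \<le> Sup ?S"
    unfolding s_def
  proof (rule min_linf_leI[OF X])
    show S0: "0 \<le> Sup ?S"
      using in_S[OF QS.zero_mats_mats zero_in] fnorm_nonneg[of "{..<n}" "{..<n}" ?\<pi> "zero_mats Q.QO 1 1"] by simp
    fix i and \<eta> \<xi> :: "nat \<Rightarrow> complex"
    show "cmod (\<Sum>k<n. \<Sum>l<n. \<eta> k * (?X $$ (k, l)) i * \<xi> l) \<le> Sup ?S * nrm2 {..<n} \<eta> * nrm2 {..<n} \<xi>"
    proof (cases "i \<in> I")
      case True
      let ?c = "mat1 (coord_class i)"
      have c: "?c \<in> mats Q.QO 1 1" using coord_class_closed[OF True] by (rule mat1_mats)
      have c1: "mnorm Q.QO ?c \<le> 1" using coord_class_norm[OF True] by (simp add: os_norm_def)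
      have "(\<Sum>k<n. \<Sum>l<n. \<eta> k * (?X $$ (k, l)) i * \<xi> l) = mform {..<n} {..<n} ?\<pi> ?c (\<lambda>(_ :: nat, k). \<eta> k) (\<lambda>(_ :: nat, l). \<xi> l)"
        using True by (simp add: mform_def Xe diagonal_values_def)
      also have "cmod \<dots> \<le> fnorm {..<n} {..<n} ?\<pi> ?c * nrm2 ({..<1 :: nat} \<times> {..<n}) (\<lambda>(_ :: nat, k). \<eta> k) * nrm2 ({..<1 :: nat} \<times> {..<n}) (\<lambda>(_ :: nat, l). \<xi> l)"
        by (rule fnorm_bound) auto
      also have "\<dots> = fnorm {..<n} {..<n} ?\<pi> ?c * nrm2 {..<n} \<eta> * nrm2 {..<n} \<xi>"
        by (simp add: L2_set_def sum.cartesian_product')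
      also have "\<dots> \<le> Sup ?S * nrm2 {..<n} \<eta> * nrm2 {..<n} \<xi>"
        by (intro mult_right_mono in_S[OF c c1]) auto
      finally show ?thesis .
    next
      case False
      have "(\<Sum>k<n. \<Sum>l<n. \<eta> k * (?X $$ (k, l)) i * \<xi> l) = 0"
        using False by (simp add: Xe diagonal_values_def)
      thus ?thesis using S0 by simp
    qed
  qed
  ultimately show ?thesis unfolding QS.dual_mnorm[OF \<Phi>] s_def by simp
qed

theorem haagerup_dual_max_lp:
  "completely_isometric (haagerup_dual M M (monoid.mult M)) (min_os (linf_space I))"
proof -
  have c: "cvs (min_os (linf_space I))" unfolding min_os_def by (intro cvs_with_mnorm cvs_linf)
  have "completely_isometric_iso D (min_os (linf_space I)) diagonal_values"
    unfolding completely_isometric_iso_def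
  proof (intro conjI allI ballI)
    show "linear_map class_ring D (min_os (linf_space I)) diagonal_values"
      unfolding linear_map_iff[OF QS.cvs_dual c]
      using diagonal_values_closed coord_class_closed
      by (auto simp: min_os_def linf_simps QS.dual_simps diagonal_values_def)
    show "bij_betw diagonal_values (carrier D) (carrier (min_os (linf_space I)))"
      using diagonal_values_bij by (simp add: min_os_def)
  qed (rule diagonal_values_mnorm)
  thus ?thesis
    unfolding completely_isometric_def haagerup_dual_def module_haagerup_eq by blast
qed

end

theorem corollary4p2:
  fixes I :: "'i set" and p :: real
  assumes "1 \<le> p" and "p \<le> 2"
  shows "completely_isometric
           (haagerup_dual (max_os (lp_space p I)) (max_os (lp_space p I)) 
             (monoid.mult (max_os (lp_space p I))))
           (min_os (linf_space I))"
proof -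
  interpret lp2 p I by unfold_locales (use assms in auto)
  show ?thesis by (rule haagerup_dual_max_lp)
qed

end
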